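(* Let $A<B$ and let $X(t)$, $t\in[A,B]$, be a Gaussian process with zero mean and twice a.s. differentiable trajectories, such that for every $t\in[A,B]$ the joint density $p_t(u,x)$ of $(X(t),X'(t))$ exists. Assume that the variance $\sigma^2(t)$ of $X(t)$ attains its maximum over $[A,B]$ at only one point $t_0\in[A,B]$, and put $S:=\sigma^2(t_0)$. Moreover, assume that if $\sigma'(t_0)=0$, then $\mathbb{P}\{X'(t_0)=0\}<1$. For $\delta>0$ denote $$\mathcal{M}(\delta):=\Bigl\{t\in[A,B]:\ \sigma^2(t)\ge \frac{S}{1+\delta}\Bigr\}.$$ Then there exist some small $\delta>0$ and some $\chi>0$ such that $$\mathbb{P}\Bigl\{\max_{t\in[A,B]}|X(t)|\ge u\Bigr\}=\mathscr{P}(u)+O\Bigl(e^{-u^2(1+\chi)/(2S)}\Bigr),\qquad u\to\infty,$$ where the function $\mathscr{P}:\mathbb{R}_+\to\mathbb{R}$ is defined as follows: (i) if $t_0=A$ or $t_0=B$, and $\sigma'(t_0)\ne 0$, then $\mathscr{P}(u)=2\,\mathbb{P}\{X(t_0)\ge u\}$; (ii) if $t_0=A$ and $\sigma'(t_0)=0$, then $\mathscr{P}(u)=2\,\mathbb{P}\{X(t_0)\ge u\}+2\,\mathbb{E}\bigl[N_u^+(\mathcal{M}(\delta))\bigr]$; (iii) if $t_0\in(A,B]$ and $\sigma'(t_0)=0$, then $\mathscr{P}(u)=2\,\mathbb{E}\bigl[N_u^+(\mathcal{M}(\delta))\bigr]$.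
   Context: For a set $M\subseteq[A,B]$ which is the closure of an open set, $N_u^+(M)$ denotes the number of up-crossings of the level $u$ by $X(t)$ on $M$; its expectation is given by $$\mathbb{E}N_u^+(M)=\int_M\int_0^\infty x\,p_t(u,x)\,dx\,dt,$$ where $p_t(u,x)$ is the density of $(X(t),X'(t))$. Derivatives at the endpoints of $[A,B]$ are one-sided.
   Formalization: "Twice a.s. differentiable trajectories" is taken as a.s. twice continuously differentiable on [A,B]; with mere existence of the second derivative the claim fails, e.g. X(t)=ξr(t)+ηt near 0 with ξ,η independent N(0,1), r(0)=1, r'(t)=-2t+3t² sin(1/t). *)

theory Defs
  imports "HOL-Probability.Probability" "HOL-Library.Landau_Symbols"
begin

text \<open>Constants count as (degenerate) Gaussian variables, so that processes with singular
  finite-dimensional distributions are included.\<close>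

definition gaussian_rv :: "'a measure \<Rightarrow> ('a \<Rightarrow> real) \<Rightarrow> bool" where
  "gaussian_rv M Y \<longleftrightarrow> Y \<in> borel_measurable M \<and>
     ((\<exists>m s. 0 < s \<and> distributed M lborel Y (\<lambda>x. ennreal (normal_density m s x))) \<or>
      (\<exists>m. AE \<omega> in M. Y \<omega> = m))"

definition gaussian_process :: "'a measure \<Rightarrow> real set \<Rightarrow> (real \<Rightarrow> 'a \<Rightarrow> real) \<Rightarrow> bool" where
  "gaussian_process M T X \<longleftrightarrow>
     (\<forall>F c. finite F \<and> F \<subseteq> T \<longrightarrow> gaussian_rv M (\<lambda>\<omega>. \<Sum>t\<in>F. c t * X t \<omega>))"

text \<open>\<open>f'\<close> is the first derivative of \<open>f\<close> on the interval (one-sided at the endpoints).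
  The second derivative is required to be continuous. Mere existence everywhere is not enough for
  the asymptotics: if \<open>\<xi>\<close>, \<open>\<eta>\<close> are independent standard normal and
  \<open>X(t) = \<xi> r(t) + \<eta> t\<close> near \<open>0\<close>, where \<open>r(0) = 1\<close> and
  \<open>r'(t) = -2 t + 3 t^2 sin(1/t)\<close>, then for arbitrarily small \<open>\<epsilon> > 0\<close> the probability of at
  least two up-crossings near \<open>0\<close> is at least \<open>exp (- u^2 (1 + \<epsilon>) / 2)\<close> for large \<open>u\<close>, so
  the expected number of up-crossings overcounts by more than the error term.\<close>

definition C2_path :: "real \<Rightarrow> real \<Rightarrow> (real \<Rightarrow> real) \<Rightarrow> (real \<Rightarrow> real) \<Rightarrow> bool" where
  "C2_path A B f f' \<longleftrightarrow>
     (\<forall>t\<in>{A..B}. (f has_real_derivative f' t) (at t within {A..B})) \<and>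
     (\<exists>f''. continuous_on {A..B} f'' \<and>
        (\<forall>t\<in>{A..B}. (f' has_real_derivative f'' t) (at t within {A..B})))"

definition process_var :: "'a measure \<Rightarrow> (real \<Rightarrow> 'a \<Rightarrow> real) \<Rightarrow> real \<Rightarrow> real" where
  "process_var M X t = prob_space.variance M (X t)"

definition process_sd_deriv ::
    "'a measure \<Rightarrow> real \<Rightarrow> real \<Rightarrow> (real \<Rightarrow> 'a \<Rightarrow> real) \<Rightarrow> real \<Rightarrow> real" where
  "process_sd_deriv M A B X t =
     vector_derivative (\<lambda>s. sqrt (process_var M X s)) (at t within {A..B})"

definition near_max_set ::
    "'a measure \<Rightarrow> real \<Rightarrow> real \<Rightarrow> (real \<Rightarrow> 'a \<Rightarrow> real) \<Rightarrow> real \<Rightarrow> real \<Rightarrow> real set" where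
  "near_max_set M A B X t0 \<delta> =
     {t\<in>{A..B}. process_var M X t \<ge> process_var M X t0 / (1 + \<delta>)}"

text \<open>Counting measure is used so that an infinite number of up-crossings has the value \<open>\<infinity>\<close>
  (\<open>card\<close> would give \<open>0\<close>).\<close>

definition num_upcrossings ::
    "(real \<Rightarrow> real) \<Rightarrow> (real \<Rightarrow> real) \<Rightarrow> real \<Rightarrow> real set \<Rightarrow> ennreal" where
  "num_upcrossings f f' u K =
     emeasure (count_space UNIV) {t\<in>K. f t = u \<and> f' t > 0}"

text \<open>Since trajectories are regular only almost surely, the number of up-crossings and the
  maximum are in general measurable only with respect to the completed measure.\<close>

definition expected_upcrossings ::
    "'a measure \<Rightarrow> (real \<Rightarrow> 'a \<Rightarrow> real) \<Rightarrow> (real \<Rightarrow> 'a \<Rightarrow> real) \<Rightarrow> real \<Rightarrow> real set \<Rightarrow> real" where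
  "expected_upcrossings M X X' u K =
     enn2real (\<integral>\<^sup>+\<omega>. num_upcrossings (\<lambda>t. X t \<omega>) (\<lambda>t. X' t \<omega>) u K \<partial>completion M)"

definition prob_max_abs_ge ::
    "'a measure \<Rightarrow> real \<Rightarrow> real \<Rightarrow> (real \<Rightarrow> 'a \<Rightarrow> real) \<Rightarrow> real \<Rightarrow> real" where
  "prob_max_abs_ge M A B X u =
     measure (completion M) {\<omega>\<in>space M. (SUP t\<in>{A..B}. \<bar>X t \<omega>\<bar>) \<ge> u}"

text \<open>The last branch is \<open>t0 \<in> {A<..B}\<close> with zero derivative: at an interior maximum the
  derivative of the standard deviation vanishes.\<close>

definition max_tail_approx ::
    "'a measure \<Rightarrow> real \<Rightarrow> real \<Rightarrow> (real \<Rightarrow> 'a \<Rightarrow> real) \<Rightarrow> (real \<Rightarrow> 'a \<Rightarrow> real) \<Rightarrow>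
     real \<Rightarrow> real \<Rightarrow> real \<Rightarrow> real" where
  "max_tail_approx M A B X X' t0 \<delta> u =
     (if (t0 = A \<or> t0 = B) \<and> process_sd_deriv M A B X t0 \<noteq> 0 then
        2 * measure M {\<omega>\<in>space M. X t0 \<omega> \<ge> u}
      else if t0 = A \<and> process_sd_deriv M A B X t0 = 0 then
        2 * measure M {\<omega>\<in>space M. X t0 \<omega> \<ge> u}
        + 2 * expected_upcrossings M X X' u (near_max_set M A B X t0 \<delta>)
      else
        2 * expected_upcrossings M X X' u (near_max_set M A B X t0 \<delta>))"

end

theory Submission
  imports Defs
begin

text \<open>
  Write \<open>S = \<sigma>\<^sup>2(t\<^sub>0)\<close> and call a quantity negligible if it is \<open>O (exp (- (1 + \<kappa>) u\<^sup>2 / (2 S)))\<close> for some \<open>\<kappa> > 0\<close>.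
  By the symmetry of the law of the process it suffices to treat the event \<open>max X \<ge> u\<close>: the path cannot reach both
  \<open>u\<close> and \<open>-u\<close> except on a negligible event, because on an interval \<open>[a, b]\<close> around \<open>t\<^sub>0\<close> the increments are small,
  and away from \<open>t\<^sub>0\<close> the variance stays below \<open>S\<close>.

  If \<open>\<sigma>'(t\<^sub>0) \<noteq> 0\<close> (at an end point), a path that reaches \<open>u\<close> but is below \<open>u\<close> at \<open>t\<^sub>0\<close> has a point with
  \<open>X = u\<close> and a slope of the wrong sign, hence \<open>X + \<lambda> X' \<ge> u\<close> there; for small \<open>\<lambda>\<close> of the right sign
  the variance of \<open>X + \<lambda> X'\<close> is below \<open>S\<close>.

  If \<open>\<sigma>'(t\<^sub>0) = 0\<close>, the probability that the maximum exceeds \<open>u\<close> is the expected number of up-crossings, up to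
  the start above \<open>u\<close> and up to the up-crossings that end an excursion below \<open>u\<close>. The latter are bounded
  pathwise by an integral over \<open>[a, b]\<close> of a function of \<open>(X, X', X'')\<close>, which is essentially
  \<open>X''\<^sup>+ / (u - X)\<close> restricted to \<open>0 \<le> X' \<le> u - X\<close> with \<open>X\<close> just below \<open>u\<close>. Since \<open>E X X'' \<le> - E X'\<^sup>2 < 0\<close> at the
  maximum of the variance, \<open>X'' > 0\<close> there is an additional independent large deviation, so the
  expectation of the integral is negligible.
\<close>

section \<open>Centered Gaussian variables\<close>

text \<open>The expected count is compared with the probability of reaching \<open>u\<close>
  directly. Pathwise, outside a negligible event, the number N of up-crossings lies between the
  indicator of reaching \<open>u\<close> without starting above it and this indicator plus an
  integral R, so only E R has to be estimated. The obstacle is the singular weight 1 / (u - X) in R.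
  It is harmless because 0 \<le> X' \<le> u - X confines the part of X' that is independent of X to
  an interval of length u - X, whose probability is at most a constant times u - X. What remains is
  a tail of X times a tail of the residual of X''. The former is slightly too large, since X only
  has to exceed (1 - \<eta>) u; the latter gains a fixed amount in the exponent, and \<eta> is
  chosen small compared with that gain. Joint laws are handled through the linear span of the
  process, closed under almost sure limits: every joint law then reduces to characteristic functions
  of single variables, that is, to covariances.\<close>

definition cnormal :: "real \<Rightarrow> real measure" where
  "cnormal v = distr std_normal_distribution borel (\<lambda>x. sqrt v * x)"

lemma sets_cnormal [measurable_cong, simp]: "sets (cnormal v) = sets borel"
  by (simp add: cnormal_def)

lemma space_cnormal [simp]: "space (cnormal v) = UNIV"
  by (simp add: cnormal_def)

lemma prob_space_cnormal: "prob_space (cnormal v)"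
proof -
  interpret real_distribution std_normal_distribution by (rule real_dist_normal_dist)
  show ?thesis unfolding cnormal_def by (rule prob_space_distr) simp
qed

lemma real_distribution_cnormal: "real_distribution (cnormal v)"
  by (simp add: real_distribution_def real_distribution_axioms_def prob_space_cnormal)

lemma char_cnormal: "0 \<le> v \<Longrightarrow> char (cnormal v) \<theta> = of_real (exp (- (v * \<theta>\<^sup>2 / 2)))"
proof -
  assume v: "0 \<le> v"
  have "char (cnormal v) \<theta> = char std_normal_distribution (sqrt v * \<theta>)"
    unfolding char_def cnormal_def by (subst integral_distr) (auto simp: ac_simps)
  also have "\<dots> = of_real (exp (- ((sqrt v * \<theta>)\<^sup>2 / 2)))"
    by (simp add: char_std_normal_distribution exp_of_real[symmetric] power_mult_distrib)
  finally show ?thesis using v by (simp add: power_mult_distrib)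
qed

lemma nn_integral_cnormal:
  "f \<in> borel_measurable borel \<Longrightarrow>
   (\<integral>\<^sup>+x. f x \<partial>cnormal v) = (\<integral>\<^sup>+x. ennreal (std_normal_density x) * f (sqrt v * x) \<partial>lborel)"
  unfolding cnormal_def
  by (subst nn_integral_distr) (auto simp: nn_integral_density)

lemma nn_integral_std_normal_density: 
  assumes "0 < \<sigma>" shows "(\<integral>\<^sup>+x. ennreal (normal_density \<mu> \<sigma> x) \<partial>lborel) = 1"
  by (subst nn_integral_eq_integral) (use assms in auto)

text \<open>Multiplying the normal density by exp (c x^2) gives a multiple of another normal
  density, so the moment is explicit. It increases with the variance, hence the bound in terms of
  \<open>v\<close>. All exponential tail bounds below combine this moment with an inequality of
  Markov type.\<close>

lemma cnormal_exp_square_le: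
  assumes "0 \<le> w" "w \<le> v" "0 \<le> c" "2 * c * v < 1"
  shows "(\<integral>\<^sup>+x. ennreal (exp (c * x\<^sup>2)) \<partial>cnormal w) \<le> ennreal (1 / sqrt (1 - 2 * c * v))"
proof -
  define r where "r = 1 - 2 * c * w"
  have cw: "2 * c * w \<le> 2 * c * v" using assms by (intro mult_left_mono) auto
  have r: "r > 0" "r \<ge> 1 - 2 * c * v" using assms cw by (auto simp: r_def)
  have eq: "std_normal_density x * exp (c * (sqrt w * x)\<^sup>2) = 1 / sqrt r * normal_density 0 (1 / sqrt r) x" for x
  proof -
    have "std_normal_density x * exp (c * (sqrt w * x)\<^sup>2) = exp (- (r * x\<^sup>2) / 2) / sqrt (2 * pi)"
      using assms by (simp add: std_normal_density_def power_mult_distrib exp_add[symmetric] r_def field_simps)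
    also have "\<dots> = 1 / sqrt r * normal_density 0 (1 / sqrt r) x"
      using r by (simp add: normal_density_def power_divide real_sqrt_divide field_simps)
    finally show ?thesis .
  qed
  have "(\<integral>\<^sup>+x. ennreal (exp (c * x\<^sup>2)) \<partial>cnormal w) = 
        (\<integral>\<^sup>+x. ennreal (1 / sqrt r) * ennreal (normal_density 0 (1 / sqrt r) x) \<partial>lborel)"
    apply (subst nn_integral_cnormal, simp)
    apply (subst ennreal_mult[symmetric], simp, simp)
    apply (subst eq)
    using r by (subst ennreal_mult[symmetric]) auto
  also have "\<dots> = ennreal (1 / sqrt r)"
    using r by (subst nn_integral_cmult) (auto simp: nn_integral_std_normal_density)
  also have "\<dots> \<le> ennreal (1 / sqrt (1 - 2 * c * v))"
    using r assms by (intro ennreal_leI divide_left_mono) auto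
  finally show ?thesis .
qed

text \<open>After rescaling by \<open>sqrt v\<close> the density is at most 1. Linearity in the
  length is what matters: it rules out tangencies by means of fine grids and cancels the factor 1 /
  (u - x) in the excess estimate.\<close>

lemma cnormal_interval_le:
  assumes "0 < v" "a \<le> b"
  shows "emeasure (cnormal v) {a..b} \<le> ennreal ((b - a) / sqrt v)"
proof -
  have "emeasure (cnormal v) {a..b} = (\<integral>\<^sup>+x. indicator {a..b} x \<partial>cnormal v)"
    by simp
  also have "\<dots> = (\<integral>\<^sup>+x. ennreal (std_normal_density x) * indicator {a..b} (sqrt v * x) \<partial>lborel)"
    by (rule nn_integral_cnormal) simp
  also have "\<dots> \<le> (\<integral>\<^sup>+x. indicator {a / sqrt v..b / sqrt v} x \<partial>lborel)"
  proof (intro nn_integral_mono)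
    fix x
    have "std_normal_density x \<le> 1"
    proof -
      have "exp (- x\<^sup>2 / 2) \<le> 1" by simp
      moreover have "1 \<le> sqrt (2 * pi)" using pi_ge_two by (simp add: real_le_rsqrt)
      ultimately show ?thesis unfolding std_normal_density_def
        by (smt (verit) divide_le_eq_1 mult.commute mult_cancel_right1 divide_divide_eq_left
            exp_ge_zero frac_le times_divide_eq_left)
    qed
    then show "ennreal (std_normal_density x) * indicator {a..b} (sqrt v * x) \<le> indicator {a / sqrt v..b / sqrt v} x"
      using assms by (auto simp: indicator_def field_simps)
  qed
  also have "\<dots> = ennreal ((b - a) / sqrt v)"
    using assms by (simp add: divide_right_mono diff_divide_distrib)
  finally show ?thesis .
qed

section \<open>Random variables with a centered normal law\<close>

context prob_space begin

text \<open>The parameter is the variance, and \<open>cnormal\<close> is a push-forward, so that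
  \<open>v = 0\<close> means the point mass at 0 and degenerate variables need no separate
  treatment.\<close>

definition cgauss :: "real \<Rightarrow> ('a \<Rightarrow> real) \<Rightarrow> bool" where
  "cgauss v Y \<longleftrightarrow> 0 \<le> v \<and> Y \<in> borel_measurable M \<and> distr M borel Y = cnormal v"

lemma cgauss_measurable: "cgauss v Y \<Longrightarrow> Y \<in> borel_measurable M"
  by (simp add: cgauss_def)

lemma cgauss_nonneg: "cgauss v Y \<Longrightarrow> 0 \<le> v"
  by (simp add: cgauss_def)

lemma cgauss_char:
  assumes "cgauss v Y" 
  shows "(CLINT \<omega>|M. iexp (\<theta> * Y \<omega>)) = of_real (exp (- (v * \<theta>\<^sup>2 / 2)))"
proof -
  have "char (distr M borel Y) \<theta> = of_real (exp (- (v * \<theta>\<^sup>2 / 2)))"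
    using assms char_cnormal unfolding cgauss_def by auto
  then show ?thesis unfolding char_def
    using assms by (subst (asm) integral_distr) (auto simp: cgauss_def)
qed

lemma cgaussI_char:
  assumes "0 \<le> v" "Y \<in> borel_measurable M"
    and "\<And>\<theta>. (CLINT \<omega>|M. iexp (\<theta> * Y \<omega>)) = of_real (exp (- (v * \<theta>\<^sup>2 / 2)))"
  shows "cgauss v Y"
proof -
  have "distr M borel Y = cnormal v"
  proof (rule Levy_uniqueness)
    show "real_distribution (distr M borel Y)"
      using assms by (simp add: real_distribution_distr)
    show "real_distribution (cnormal v)" by (rule real_distribution_cnormal)
    show "char (distr M borel Y) = char (cnormal v)"
    proof
      fix \<theta>
      have "char (distr M borel Y) \<theta> = (CLINT \<omega>|M. iexp (\<theta> * Y \<omega>))"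
        unfolding char_def using assms(2) by (subst integral_distr) auto
      then show "char (distr M borel Y) \<theta> = char (cnormal v) \<theta>"
        unfolding assms(3) using assms(1) by (simp add: char_cnormal)
    qed
  qed
  then show ?thesis using assms by (simp add: cgauss_def)
qed

lemma cgauss_nn_integral:
  assumes "cgauss v Y" "f \<in> borel_measurable borel"
  shows "(\<integral>\<^sup>+\<omega>. f (Y \<omega>) \<partial>M) = (\<integral>\<^sup>+x. f x \<partial>cnormal v)"
  using assms by (subst nn_integral_distr[of Y M borel, symmetric]) (auto simp: cgauss_def)

lemma cgauss_exp_square_le:
  assumes "cgauss w Y" "w \<le> v" "0 \<le> c" "2 * c * v < 1"
  shows "(\<integral>\<^sup>+\<omega>. ennreal (exp (c * (Y \<omega>)\<^sup>2)) \<partial>M) \<le> ennreal (1 / sqrt (1 - 2 * c * v))"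
  using cnormal_exp_square_le[of w v c] assms
  by (subst cgauss_nn_integral[of _ _ "\<lambda>x. ennreal (exp (c * x\<^sup>2))"]) (auto simp: cgauss_def)

lemma cgauss_interval_le:
  assumes "cgauss v Y" "0 < v" "a \<le> b"
  shows "prob {\<omega>\<in>space M. Y \<omega> \<in> {a..b}} \<le> (b - a) / sqrt v"
proof -
  have [measurable]: "Y \<in> borel_measurable M" using assms(1) by (simp add: cgauss_def)
  have "emeasure M {\<omega>\<in>space M. Y \<omega> \<in> {a..b}} = emeasure (distr M borel Y) {a..b}"
    by (subst emeasure_distr) (auto intro!: arg_cong[where f="emeasure M"])
  also have "\<dots> \<le> ennreal ((b - a) / sqrt v)"
    using cnormal_interval_le[of v a b] assms by (simp add: cgauss_def)
  finally show ?thesis using assms by (simp add: emeasure_eq_measure)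
qed

lemma cgauss_second_moment:
  assumes "cgauss v Y"
  shows "integrable M (\<lambda>\<omega>. (Y \<omega>)\<^sup>2)" "expectation (\<lambda>\<omega>. (Y \<omega>)\<^sup>2) = v"
proof -
  have [measurable]: "Y \<in> borel_measurable M" and v: "0 \<le> v" and d: "distr M borel Y = cnormal v"
    using assms by (auto simp: cgauss_def)
  have i: "integrable std_normal_distribution (\<lambda>x. (sqrt v * x)\<^sup>2)"
    using integrable_std_normal_distribution_moment[of 2] by (simp add: power_mult_distrib)
  have "integrable (distr M borel Y) (\<lambda>x. x\<^sup>2)" unfolding d cnormal_def
    using i by (subst integrable_distr_eq) auto
  then show "integrable M (\<lambda>\<omega>. (Y \<omega>)\<^sup>2)" by (subst (asm) integrable_distr_eq) auto
  have "expectation (\<lambda>\<omega>. (Y \<omega>)\<^sup>2) = (\<integral>x. x\<^sup>2 \<partial>cnormal v)"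
    unfolding d[symmetric] by (subst integral_distr) auto
  also have "\<dots> = (\<integral>x. (sqrt v * x)\<^sup>2 \<partial>std_normal_distribution)"
    unfolding cnormal_def by (subst integral_distr) auto
  also have "\<dots> = v" using v std_normal_distribution_even_moments[of 1]
    by (simp add: power_mult_distrib)
  finally show "expectation (\<lambda>\<omega>. (Y \<omega>)\<^sup>2) = v" .
qed

text \<open>Dominated convergence carries characteristic functions to the limit, and the variances
  are read off from them by a logarithm. This is how derivatives of the process inherit normality;
  the variances converge without any domination of the squares.\<close>

lemma cgauss_AE_limit:
  assumes Y: "\<And>n. cgauss (v n) (Y n)" and Z[measurable]: "Z \<in> borel_measurable M"
    and lim: "AE \<omega> in M. (\<lambda>n. Y n \<omega>) \<longlonglongrightarrow> Z \<omega>"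
  shows "\<exists>w. cgauss w Z \<and> v \<longlonglongrightarrow> w"
proof -
  have [measurable]: "Y n \<in> borel_measurable M" for n using Y by (rule cgauss_measurable)
  define \<phi> where "\<phi> \<theta> = (CLINT \<omega>|M. iexp (\<theta> * Z \<omega>))" for \<theta>
  have conv: "(\<lambda>n. complex_of_real (exp (- (v n * \<theta>\<^sup>2 / 2)))) \<longlonglongrightarrow> \<phi> \<theta>" for \<theta>
    unfolding \<phi>_def cgauss_char[OF Y, symmetric]
  proof (rule integral_dominated_convergence[where w="\<lambda>_. 1"])
    show "AE \<omega> in M. (\<lambda>n. iexp (\<theta> * Y n \<omega>)) \<longlonglongrightarrow> iexp (\<theta> * Z \<omega>)"
      using lim by eventually_elim (intro tendsto_intros)
  qed auto
  have re: "(\<lambda>n. exp (- (v n * \<theta>\<^sup>2 / 2))) \<longlonglongrightarrow> Re (\<phi> \<theta>)" for \<theta>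
    using tendsto_Re[OF conv[of \<theta>]] by simp
  have im: "Im (\<phi> \<theta>) = 0" for \<theta>
    using tendsto_Im[OF conv[of \<theta>]] by (simp add: LIMSEQ_const_iff)
  \<comment> \<open>Continuity of \<open>\<phi>\<close> at 0 yields some \<open>t > 0\<close> where
    its real part is positive. The logarithm there is finite, which rules out variances tending to
    infinity.\<close>
  have "(\<lambda>k. \<phi> (1 / Suc k)) \<longlonglongrightarrow> (CLINT \<omega>|M. 1)"
    unfolding \<phi>_def
  proof (rule integral_dominated_convergence[where w="\<lambda>_. 1"])
    show "AE \<omega> in M. (\<lambda>k. iexp (1 / Suc k * Z \<omega>)) \<longlonglongrightarrow> 1"
    proof (rule AE_I2)
      fix \<omega>
      have *: "(\<lambda>k. 1 / real (Suc k)) \<longlonglongrightarrow> 0" using LIMSEQ_inverse_real_of_nat by (simp add: inverse_eq_divide)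
      have "(\<lambda>k. iexp (1 / Suc k * Z \<omega>)) \<longlonglongrightarrow> iexp (0 * Z \<omega>)" by (intro tendsto_intros *)
      then show "(\<lambda>k. iexp (1 / Suc k * Z \<omega>)) \<longlonglongrightarrow> 1" by simp
    qed
  qed auto
  then have "(\<lambda>k. Re (\<phi> (1 / Suc k))) \<longlonglongrightarrow> 1" by (auto dest: tendsto_Re simp: prob_space)
  then have "eventually (\<lambda>k. Re (\<phi> (1 / Suc k)) > 0) sequentially"
    by (rule order_tendstoD) simp
  then obtain k where k: "Re (\<phi> (1 / Suc k)) > 0" by (auto simp: eventually_sequentially)
  define t where "t = 1 / real (Suc k)"
  have t: "t > 0" "Re (\<phi> t) > 0" using k by (auto simp: t_def)
  have "(\<lambda>n. ln (exp (- (v n * t\<^sup>2 / 2)))) \<longlonglongrightarrow> ln (Re (\<phi> t))"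
    by (intro tendsto_ln re) (use t in auto)
  then have "(\<lambda>n. (- (v n * t\<^sup>2 / 2)) * (-2 / t\<^sup>2)) \<longlonglongrightarrow> ln (Re (\<phi> t)) * (-2 / t\<^sup>2)"
    by (intro tendsto_intros) simp
  then have v: "v \<longlonglongrightarrow> ln (Re (\<phi> t)) * (-2 / t\<^sup>2)" using t by (simp add: field_simps)
  define w where "w = ln (Re (\<phi> t)) * (-2 / t\<^sup>2)"
  have v: "v \<longlonglongrightarrow> w" using v by (simp add: w_def)
  have "0 \<le> w" using v by (rule LIMSEQ_le_const) (use Y cgauss_nonneg in blast)
  moreover have "\<phi> \<theta> = of_real (exp (- (w * \<theta>\<^sup>2 / 2)))" for \<theta>
  proof -
    have "(\<lambda>n. exp (- (v n * \<theta>\<^sup>2 / 2))) \<longlonglongrightarrow> exp (- (w * \<theta>\<^sup>2 / 2))" by (intro tendsto_intros v) simp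
    then have "Re (\<phi> \<theta>) = exp (- (w * \<theta>\<^sup>2 / 2))" using re LIMSEQ_unique by blast
    then show ?thesis using im by (simp add: complex_eq_iff)
  qed
  ultimately have "cgauss w Z" by (intro cgaussI_char) (auto simp: \<phi>_def)
  then show ?thesis using v by blast
qed

lemma cgauss_AE_cong:
  assumes "cgauss v Y" "AE \<omega> in M. Y \<omega> = Z \<omega>" "Z \<in> borel_measurable M"
  shows "cgauss v Z"
  using cgauss_AE_limit[of "\<lambda>_. v" "\<lambda>_. Y" Z] assms by (auto simp: LIMSEQ_const_iff elim!: eventually_mono)

end

section \<open>Gaussian linear spaces\<close>

text \<open>One-dimensional normality and closure under linear combinations fix all joint laws: the
  characteristic function of a vector at \<open>c\<close> is that of a single member of
  \<open>G\<close> at 1.\<close>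

locale gauss_space = prob_space +
  fixes G :: "('a \<Rightarrow> real) set"
  assumes gauss: "Y \<in> G \<Longrightarrow> \<exists>v. cgauss v Y"
    and lin: "Y \<in> G \<Longrightarrow> Z \<in> G \<Longrightarrow> (\<lambda>\<omega>. a * Y \<omega> + b * Z \<omega>) \<in> G"

text \<open>It will be applied twice: the first derivative of the process lies in the closure of the
  span, the second derivative in the closure of that closure.\<close>

definition (in prob_space) AE_closure :: "('a \<Rightarrow> real) set \<Rightarrow> ('a \<Rightarrow> real) set" where
  "AE_closure G = {Z \<in> borel_measurable M. \<exists>Y. (\<forall>n. Y n \<in> G) \<and> (AE \<omega> in M. (\<lambda>n. Y n \<omega>) \<longlonglongrightarrow> Z \<omega>)}"

definition (in prob_space) cov :: "('a \<Rightarrow> real) \<Rightarrow> ('a \<Rightarrow> real) \<Rightarrow> real" where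
  "cov Y Z = expectation (\<lambda>\<omega>. Y \<omega> * Z \<omega>)"

context gauss_space begin

lemma measurable_G: "Y \<in> G \<Longrightarrow> Y \<in> borel_measurable M"
  using gauss cgauss_measurable by blast

lemma G_scale: "Y \<in> G \<Longrightarrow> (\<lambda>\<omega>. a * Y \<omega>) \<in> G"
  using lin[of Y Y a 0] by simp

lemma G_add: "Y \<in> G \<Longrightarrow> Z \<in> G \<Longrightarrow> (\<lambda>\<omega>. Y \<omega> + Z \<omega>) \<in> G"
  using lin[of Y Z 1 1] by simp

lemma G_diff: "Y \<in> G \<Longrightarrow> Z \<in> G \<Longrightarrow> (\<lambda>\<omega>. Y \<omega> - Z \<omega>) \<in> G"
  using lin[of Y Z 1 "-1"] by simp

lemma cgauss_cov: "Y \<in> G \<Longrightarrow> cgauss (cov Y Y) Y"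
  using gauss[of Y] cgauss_second_moment(2)[of _ Y] by (auto simp: cov_def power2_eq_square)

lemma cov_nonneg: "0 \<le> cov Y Y"
  by (simp add: cov_def)

lemma integrable_prod:
  assumes "Y \<in> G" "Z \<in> G" shows "integrable M (\<lambda>\<omega>. Y \<omega> * Z \<omega>)"
proof -
  have sq: "W \<in> G \<Longrightarrow> integrable M (\<lambda>\<omega>. (W \<omega>)\<^sup>2)" for W
    using cgauss_second_moment(1)[OF cgauss_cov] by blast
  have "integrable M (\<lambda>\<omega>. ((Y \<omega> + Z \<omega>)\<^sup>2 - (Y \<omega>)\<^sup>2 - (Z \<omega>)\<^sup>2) / 2)"
    using sq[OF assms(1)] sq[OF assms(2)] sq[OF G_add[OF assms]] by auto
  then show ?thesis by (simp add: power2_sum algebra_simps)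
qed

lemma cov_commute: "cov Y Z = cov Z Y"
  by (simp add: cov_def mult.commute)

lemma cov_lin_left:
  assumes "Y \<in> G" "Z \<in> G" "W \<in> G"
  shows "cov (\<lambda>\<omega>. a * Y \<omega> + b * Z \<omega>) W = a * cov Y W + b * cov Z W"
proof -
  have "cov (\<lambda>\<omega>. a * Y \<omega> + b * Z \<omega>) W = expectation (\<lambda>\<omega>. a * (Y \<omega> * W \<omega>) + b * (Z \<omega> * W \<omega>))"
    unfolding cov_def by (simp add: algebra_simps)
  also have "\<dots> = a * cov Y W + b * cov Z W" unfolding cov_def
    using integrable_prod assms by (subst Bochner_Integration.integral_add) auto
  finally show ?thesis .
qed

lemma cov_lin_right:
  assumes "Y \<in> G" "Z \<in> G" "W \<in> G"
  shows "cov W (\<lambda>\<omega>. a * Y \<omega> + b * Z \<omega>) = a * cov W Y + b * cov W Z"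
  using cov_lin_left[OF assms] by (simp add: cov_commute)

lemma cov_diff_left: "Y \<in> G \<Longrightarrow> Z \<in> G \<Longrightarrow> W \<in> G \<Longrightarrow> cov (\<lambda>\<omega>. Y \<omega> - Z \<omega>) W = cov Y W - cov Z W"
  using cov_lin_left[of Y Z W 1 "-1"] by simp

lemma cov_diff_right: "Y \<in> G \<Longrightarrow> Z \<in> G \<Longrightarrow> W \<in> G \<Longrightarrow> cov W (\<lambda>\<omega>. Y \<omega> - Z \<omega>) = cov W Y - cov W Z"
  using cov_lin_right[of Y Z W 1 "-1"] by simp

lemma cov_scale_left: "cov (\<lambda>\<omega>. a * Y \<omega>) W = a * cov Y W"
  by (simp add: cov_def mult.assoc)

lemma cov_scale_right: "cov W (\<lambda>\<omega>. a * Y \<omega>) = a * cov W Y"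
  by (simp add: cov_def mult.left_commute)

lemma cov_square_lin:
  assumes "Y \<in> G" "Z \<in> G"
  shows "cov (\<lambda>\<omega>. a * Y \<omega> + b * Z \<omega>) (\<lambda>\<omega>. a * Y \<omega> + b * Z \<omega>) =
    a\<^sup>2 * cov Y Y + 2 * a * b * cov Y Z + b\<^sup>2 * cov Z Z"
  using assms by (simp add: cov_lin_left cov_lin_right lin cov_commute[of Z Y] power2_eq_square algebra_simps)

text \<open>For centered Gaussian variables almost sure convergence already forces convergence of
  the variances, by \<open>cgauss_AE_limit\<close>; polarization extends this to covariances.
  Pathwise derivatives can therefore be moved inside covariances.\<close>

lemma cov_tendsto:
  assumes G: "\<And>n. Y n \<in> G" "Y' \<in> G" "\<And>n. Z n \<in> G" "Z' \<in> G"
    and lim: "AE \<omega> in M. (\<lambda>n. Y n \<omega>) \<longlonglongrightarrow> Y' \<omega>" "AE \<omega> in M. (\<lambda>n. Z n \<omega>) \<longlonglongrightarrow> Z' \<omega>"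
  shows "(\<lambda>n. cov (Y n) (Z n)) \<longlonglongrightarrow> cov Y' Z'"
proof -
  have sq: "(\<lambda>n. cov (U n) (U n)) \<longlonglongrightarrow> cov U' U'"
    if U: "\<And>n. U n \<in> G" "U' \<in> G" "AE \<omega> in M. (\<lambda>n. U n \<omega>) \<longlonglongrightarrow> U' \<omega>" for U U'
  proof -
    obtain w where w: "cgauss w U'" "(\<lambda>n. cov (U n) (U n)) \<longlonglongrightarrow> w"
      using cgauss_AE_limit[of "\<lambda>n. cov (U n) (U n)" U U', OF cgauss_cov[OF U(1)] measurable_G[OF U(2)] U(3)] by (elim exE conjE)
    then have "w = cov U' U'" using cgauss_second_moment(2)[OF w(1)] by (simp add: cov_def power2_eq_square)
    then show ?thesis using w by simp
  qed
  have pol: "cov U V = (cov (\<lambda>\<omega>. U \<omega> + V \<omega>) (\<lambda>\<omega>. U \<omega> + V \<omega>) - cov U U - cov V V) / 2"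
    if "U \<in> G" "V \<in> G" for U V
    using cov_square_lin[OF that, of 1 1] by simp
  have "AE \<omega> in M. (\<lambda>n. Y n \<omega> + Z n \<omega>) \<longlonglongrightarrow> Y' \<omega> + Z' \<omega>"
    using lim by eventually_elim (rule tendsto_add)
  then have "(\<lambda>n. (cov (\<lambda>\<omega>. Y n \<omega> + Z n \<omega>) (\<lambda>\<omega>. Y n \<omega> + Z n \<omega>) - cov (Y n) (Y n) - cov (Z n) (Z n)) / 2)
    \<longlonglongrightarrow> (cov (\<lambda>\<omega>. Y' \<omega> + Z' \<omega>) (\<lambda>\<omega>. Y' \<omega> + Z' \<omega>) - cov Y' Y' - cov Z' Z') / 2"
    using lim by (intro tendsto_divide tendsto_diff tendsto_const sq G_add G) simp_all
  then show ?thesis unfolding pol[OF G(1) G(3)] pol[OF G(2) G(4)] .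
qed

lemma cov_Cauchy_Schwarz:
  assumes "Y \<in> G" "Z \<in> G" shows "(cov Y Z)\<^sup>2 \<le> cov Y Y * cov Z Z"
proof -
  have q: "0 \<le> cov Y Y + 2 * b * cov Y Z + b\<^sup>2 * cov Z Z" for b
    using cov_square_lin[OF assms, of 1 b] cov_nonneg[of "\<lambda>\<omega>. 1 * Y \<omega> + b * Z \<omega>"] by simp
  show ?thesis
  proof (cases "cov Z Z = 0")
    case True
    have "cov Y Z = 0"
    proof (rule ccontr)
      assume "cov Y Z \<noteq> 0"
      \<comment> \<open>The quadratic is linear in \<open>b\<close> here, and this argument gives it
        the value -1.\<close>
      then show False using q[of "- (cov Y Y + 1) / (2 * cov Y Z)"] True by (simp add: field_simps)
    qed
    then show ?thesis using True by simp
  next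
    case False
    then have p: "cov Z Z > 0" using cov_nonneg[of Z] by simp
    have "0 \<le> (cov Y Y + 2 * (- cov Y Z / cov Z Z) * cov Y Z + (- cov Y Z / cov Z Z)\<^sup>2 * cov Z Z) * cov Z Z"
      by (rule mult_nonneg_nonneg[OF q less_imp_le[OF p]])
    also have "\<dots> = cov Y Y * cov Z Z - (cov Y Z)\<^sup>2"
      using p by (simp add: field_simps power2_eq_square)
    finally show ?thesis by simp
  qed
qed

lemma gauss_space_AE_closure: "gauss_space M (AE_closure G)"
proof unfold_locales
  fix Z assume "Z \<in> AE_closure G"
  then obtain Y where "Z \<in> borel_measurable M" "\<And>n. Y n \<in> G" "AE \<omega> in M. (\<lambda>n. Y n \<omega>) \<longlonglongrightarrow> Z \<omega>"
    by (auto simp: AE_closure_def)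
  then show "\<exists>v. cgauss v Z"
    using cgauss_AE_limit[of "\<lambda>n. cov (Y n) (Y n)" Y Z] cgauss_cov by blast
next
  fix Y Z a b assume "Y \<in> AE_closure G" "Z \<in> AE_closure G"
  then obtain U V where *: "Y \<in> borel_measurable M" "\<And>n. U n \<in> G" "AE \<omega> in M. (\<lambda>n. U n \<omega>) \<longlonglongrightarrow> Y \<omega>"
    "Z \<in> borel_measurable M" "\<And>n. V n \<in> G" "AE \<omega> in M. (\<lambda>n. V n \<omega>) \<longlonglongrightarrow> Z \<omega>"
    by (auto simp: AE_closure_def)
  have "AE \<omega> in M. (\<lambda>n. a * U n \<omega> + b * V n \<omega>) \<longlonglongrightarrow> a * Y \<omega> + b * Z \<omega>"
    using *(3) *(6) by eventually_elim (intro tendsto_intros)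
  then show "(\<lambda>\<omega>. a * Y \<omega> + b * Z \<omega>) \<in> AE_closure G"
    using * lin unfolding AE_closure_def
    by (auto intro!: exI[of _ "\<lambda>n \<omega>. a * U n \<omega> + b * V n \<omega>"])
qed

lemma subset_AE_closure: "G \<subseteq> AE_closure G"
  unfolding AE_closure_def by (auto dest: measurable_G intro!: exI[of _ "\<lambda>_. _"])

lemma G_sum:
  assumes "finite F" "F \<noteq> {}" "\<And>i. i \<in> F \<Longrightarrow> Y i \<in> G"
  shows "(\<lambda>\<omega>. \<Sum>i\<in>F. c i * Y i \<omega>) \<in> G"
  using assms
proof (induction F rule: finite_ne_induct)
  case (singleton x) then show ?case by (simp add: G_scale)
next
  case (insert x F) then show ?case by (auto intro!: G_add G_scale)
qed

end

section \<open>Laws determined by linear combinations\<close>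

text \<open>Dividing by the total mass \<open>c\<close>, which is the transform at 0 and so common
  to both sides, turns the weights into probability densities, to which one-dimensional uniqueness
  applies. If \<open>c = 0\<close>, both weights vanish almost everywhere.\<close>

lemma weighted_Levy:
  fixes Y :: "'a \<Rightarrow> real" and Z :: "'b \<Rightarrow> real" and W :: "'a \<Rightarrow> real" and V :: "'b \<Rightarrow> real"
  assumes "prob_space M" "prob_space N"
    and [measurable]: "Y \<in> borel_measurable M" "Z \<in> borel_measurable N"
      "W \<in> borel_measurable M" "V \<in> borel_measurable N"
    and W: "\<And>x. 0 \<le> W x" "\<And>x. W x \<le> K" and V: "\<And>x. 0 \<le> V x" "\<And>x. V x \<le> K"
    and eq: "\<And>\<theta>. (CLINT x|M. W x * iexp (\<theta> * Y x)) = (CLINT x|N. V x * iexp (\<theta> * Z x))"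
    and [measurable]: "B \<in> sets borel"
  shows "(LINT x|M. W x * indicator B (Y x)) = (LINT x|N. V x * indicator B (Z x))"
proof -
  interpret M: prob_space M by fact
  interpret N: prob_space N by fact
  have iW: "integrable M W" by (rule M.integrable_const_bound[of _ K]) (use W in auto)
  have iV: "integrable N V" by (rule N.integrable_const_bound[of _ K]) (use V in auto)
  define c where "c = (LINT x|M. W x)"
  have c': "c = (LINT x|N. V x)"
  proof -
    have "complex_of_real (LINT x|M. W x) = of_real (LINT x|N. V x)"
      using eq[of 0] by simp
    then show ?thesis by (simp add: c_def del: integral_of_real)
  qed
  have "c \<ge> 0" unfolding c_def using W by (intro integral_nonneg_AE) auto
  show ?thesis
  proof (cases "c = 0")
    case True
    have "AE x in M. W x = 0" using integral_nonneg_eq_0_iff_AE[OF iW] W True by (simp add: c_def)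
    then have "(LINT x|M. W x * indicator B (Y x)) = (LINT x|M. 0)"
      by (intro integral_cong_AE) auto
    moreover have "AE x in N. V x = 0" using integral_nonneg_eq_0_iff_AE[OF iV] V True c' by simp
    then have "(LINT x|N. V x * indicator B (Z x)) = (LINT x|N. 0)"
      by (intro integral_cong_AE) auto
    ultimately show ?thesis by simp
  next
    case False
    with \<open>c \<ge> 0\<close> have c: "c > 0" by simp
    have law: "real_distribution (distr (density P (\<lambda>x. ennreal (U x / c))) borel X) \<and>
        (\<forall>\<theta>. char (distr (density P (\<lambda>x. ennreal (U x / c))) borel X) \<theta> = (CLINT x|P. U x * iexp (\<theta> * X x)) / c) \<and>
        measure (distr (density P (\<lambda>x. ennreal (U x / c))) borel X) B = (LINT x|P. U x * indicator B (X x)) / c"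
      if [measurable]: "X \<in> borel_measurable P" "U \<in> borel_measurable P" and U: "\<And>x. 0 \<le> U x" "integrable P U" "(LINT x|P. U x) = c"
      for P :: "'c measure" and U X :: "'c \<Rightarrow> real"
    proof -
      let ?D = "density P (\<lambda>x. ennreal (U x / c))"
      have "emeasure ?D (space ?D) = (\<integral>\<^sup>+x. ennreal (U x / c) \<partial>P)"
        by (subst emeasure_density) (auto intro!: nn_integral_cong)
      also have "\<dots> = ennreal (LINT x|P. U x / c)"
        using U c by (intro nn_integral_eq_integral) auto
      also have "\<dots> = 1" using U c by simp
      finally interpret D: prob_space ?D by (rule prob_spaceI)
      have 1: "real_distribution (distr ?D borel X)"
        by (rule D.real_distribution_distr) simp
      have 2: "char (distr ?D borel X) \<theta> = (CLINT x|P. U x * iexp (\<theta> * X x)) / c" for \<theta>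
      proof -
        have "char (distr ?D borel X) \<theta> = (CLINT x|?D. iexp (\<theta> * X x))"
          unfolding char_def by (subst integral_distr) auto
        also have "\<dots> = (CLINT x|P. (U x / c) *\<^sub>R iexp (\<theta> * X x))"
          using U c by (subst integral_density) auto
        also have "\<dots> = (CLINT x|P. (U x * iexp (\<theta> * X x)) / c)"
          by (simp add: scaleR_conv_of_real)
        finally show ?thesis by simp
      qed
      have "measure (distr ?D borel X) B = (LINT x|?D. indicator B (X x))"
      proof -
        have "measure (distr ?D borel X) B = (LINT x|distr ?D borel X. indicator B x)" by simp
        also have "\<dots> = (LINT x|?D. indicator B (X x))" by (subst integral_distr) auto
        finally show ?thesis .
      qed
      also have "\<dots> = (LINT x|P. (U x / c) *\<^sub>R indicator B (X x))"
        using U c by (subst integral_density) auto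
      also have "\<dots> = (LINT x|P. U x * indicator B (X x)) / c" by simp
      finally show ?thesis using 1 2 by blast
    qed
    note lM = law[OF assms(3,5) W(1) iW c_def[symmetric]]
    note lN = law[OF assms(4,6) V(1) iV c'[symmetric]]
    have "distr (density M (\<lambda>x. ennreal (W x / c))) borel Y = distr (density N (\<lambda>x. ennreal (V x / c))) borel Z"
    proof (rule Levy_uniqueness)
      show "char (distr (density M (\<lambda>x. ennreal (W x / c))) borel Y) =
         char (distr (density N (\<lambda>x. ennreal (V x / c))) borel Z)"
        using lM lN eq by (intro ext) simp
    qed (use lM lN in auto)
    then have "(LINT x|M. W x * indicator B (Y x)) / c = (LINT x|N. V x * indicator B (Z x)) / c"
      by (simp only: conjunct2[OF conjunct2[OF lM], symmetric] conjunct2[OF conjunct2[OF lN], symmetric])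
    then show ?thesis using c by simp
  qed
qed

text \<open>A form of the Cramer--Wold theorem that only needs one-dimensional uniqueness: the coordinates are
  moved one at a time from the exponential into the indicator, with \<open>1 + cos\<close> and \<open>1 + sin\<close> as weights.\<close>

lemma Cramer_Wold_rectangles:
  fixes Y :: "'i \<Rightarrow> 'a \<Rightarrow> real" and Z :: "'i \<Rightarrow> 'b \<Rightarrow> real"
  assumes "prob_space M" "prob_space N" and F: "finite F"
    and mY: "\<And>i. i \<in> F \<Longrightarrow> Y i \<in> borel_measurable M" and mZ: "\<And>i. i \<in> F \<Longrightarrow> Z i \<in> borel_measurable N"
    and eq: "\<And>c. (CLINT x|M. iexp (\<Sum>i\<in>F. c i * Y i x)) = (CLINT x|N. iexp (\<Sum>i\<in>F. c i * Z i x))"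
    and B: "\<And>i. i \<in> F \<Longrightarrow> B i \<in> sets borel"
  shows "measure M {x\<in>space M. \<forall>i\<in>F. Y i x \<in> B i} = measure N {x\<in>space N. \<forall>i\<in>F. Z i x \<in> B i}"
proof -
  interpret M: prob_space M by fact
  interpret N: prob_space N by fact
  define wY where "wY D x = (\<Prod>i\<in>D. indicator (B i) (Y i x) :: real)" for D x
  define wZ where "wZ D x = (\<Prod>i\<in>D. indicator (B i) (Z i x) :: real)" for D x
  define LY where "LY c x = (\<Sum>i\<in>F. c i * Y i x)" for c x
  define LZ where "LZ c x = (\<Sum>i\<in>F. c i * Z i x)" for c x
  have w01Y: "0 \<le> wY D x" "wY D x \<le> 1" for D x
    by (auto simp: wY_def intro!: prod_nonneg prod_le_1)
  have w01Z: "0 \<le> wZ D y" "wZ D y \<le> 1" for D y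
    by (auto simp: wZ_def intro!: prod_nonneg prod_le_1)
  note w01 = w01Y w01Z
  have bnd: "w * (1 + g) \<le> 2" "0 \<le> w * (1 + g)" if "0 \<le> w" "w \<le> 1" "-1 \<le> g" "g \<le> 1" for w g :: real
    using mult_mono[of w 1 "1 + g" 2] that by (simp_all add: mult_nonneg_nonneg)
  have mL [measurable]: "LY c \<in> borel_measurable M" "LZ c \<in> borel_measurable N" for c
    unfolding LY_def LZ_def using mY mZ by auto
  have mw: "wY D \<in> borel_measurable M" "wZ D \<in> borel_measurable N" if "D \<subseteq> F" for D
  proof -
    have "(\<lambda>x. indicator (B i) (Y i x) :: real) \<in> borel_measurable M" "(\<lambda>x. indicator (B i) (Z i x) :: real) \<in> borel_measurable N" if "i \<in> D" for i
    proof -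
      have [measurable]: "Y i \<in> borel_measurable M" "Z i \<in> borel_measurable N" "B i \<in> sets borel"
        using mY mZ B \<open>i \<in> D\<close> \<open>D \<subseteq> F\<close> by auto
      show "(\<lambda>x. indicator (B i) (Y i x) :: real) \<in> borel_measurable M" by measurable
      show "(\<lambda>x. indicator (B i) (Z i x) :: real) \<in> borel_measurable N" by measurable
    qed
    then show "wY D \<in> borel_measurable M" "wZ D \<in> borel_measurable N"
      unfolding wY_def[abs_def] wZ_def[abs_def] by (auto intro!: borel_measurable_prod)
  qed
  have iY: "complex_integrable M (\<lambda>x. wY D x * iexp (LY c x))" and iZ: "complex_integrable N (\<lambda>x. wZ D x * iexp (LZ c x))" 
    if "D \<subseteq> F" for D c
    using mw[OF that] w01
    by (auto intro!: M.integrable_const_bound[of _ 1] N.integrable_const_bound[of _ 1] simp: norm_mult)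
  \<comment> \<open>The exponential keeps all coordinates of \<open>F\<close> while the indicators
    cover only \<open>D\<close>. For \<open>D = F\<close> and zero coefficients this is the
    claim.\<close>
  have H: "(CLINT x|M. wY D x * iexp (LY c x)) = (CLINT x|N. wZ D x * iexp (LZ c x))"
    if "D \<subseteq> F" for D c
  proof -
    have "finite D" using that F finite_subset by blast
    then show ?thesis using that
    proof (induction D arbitrary: c)
      case empty then show ?case using eq by (simp add: wY_def wZ_def LY_def LZ_def)
    next
      case (insert j D)
      then have D: "D \<subseteq> F" and j: "j \<in> F" and jD: "j \<notin> D" by auto
      have [measurable]: "Y j \<in> borel_measurable M" "Z j \<in> borel_measurable N" "B j \<in> sets borel"
        "wY D \<in> borel_measurable M" "wZ D \<in> borel_measurable N"
        using mY mZ B j mw[OF D] by auto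
      \<comment> \<open>Raising the coefficient of \<open>j\<close> by \<open>\<theta>\<close>
        isolates \<open>Y j\<close>, so the induction hypothesis becomes an equality of transforms
        in \<open>\<theta>\<close>.\<close>
      have shift: "LY (d(j := d j + \<theta>)) x = LY d x + \<theta> * Y j x" "LZ (d(j := d j + \<theta>)) y = LZ d y + \<theta> * Z j y" for d \<theta> x y
      proof -
        have 1: "(\<Sum>i\<in>F - {j}. (d(j := d j + \<theta>)) i * U i) = (\<Sum>i\<in>F - {j}. d i * U i)" for U :: "'i \<Rightarrow> real"
          by (intro sum.cong) auto
        show "LY (d(j := d j + \<theta>)) x = LY d x + \<theta> * Y j x"
          unfolding LY_def using sum.remove[OF F j, of "\<lambda>i. (d(j := d j + \<theta>)) i * Y i x"] sum.remove[OF F j, of "\<lambda>i. d i * Y i x"] 1[of "\<lambda>i. Y i x"]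
          by (simp add: algebra_simps)
        show "LZ (d(j := d j + \<theta>)) y = LZ d y + \<theta> * Z j y"
          unfolding LZ_def using sum.remove[OF F j, of "\<lambda>i. (d(j := d j + \<theta>)) i * Z i y"] sum.remove[OF F j, of "\<lambda>i. d i * Z i y"] 1[of "\<lambda>i. Z i y"]
          by (simp add: algebra_simps)
      qed
      have neg: "LY (\<lambda>i. - c i) x = - LY c x" "LZ (\<lambda>i. - c i) y = - LZ c y" for c x y
        by (simp_all add: LY_def LZ_def sum_negf)
      have zero: "LY (\<lambda>i. 0) x = 0" "LZ (\<lambda>i. 0) y = 0" for x y by (simp_all add: LY_def LZ_def)
      have base: "(CLINT x|M. wY D x * iexp (LY d x + \<theta> * Y j x)) = (CLINT x|N. wZ D x * iexp (LZ d x + \<theta> * Z j x))" for d \<theta>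
        using insert.IH[OF D, of "d(j := d j + \<theta>)"] by (simp only: shift)
      have ib: "complex_integrable M (\<lambda>x. wY D x * iexp (LY d x + \<theta> * Y j x))"
        "complex_integrable N (\<lambda>x. wZ D x * iexp (LZ d x + \<theta> * Z j x))" for d \<theta>
        using iY[OF D, of "d(j := d j + \<theta>)"] iZ[OF D, of "d(j := d j + \<theta>)"] by (simp_all only: shift)
      let ?n = "\<lambda>i. - c i"
      \<comment> \<open>The weights expand into exponentials with coefficients 0, \<open>c\<close>
        and \<open>- c\<close>, each covered by the induction hypothesis. The summand 1 keeps the
        weights nonnegative, as \<open>weighted_Levy\<close> demands.\<close>
      have trig: "complex_of_real (w * (1 + cos l)) * iexp t = 
          w * iexp (0 + t) + (w * iexp (l + t) + w * iexp (- l + t)) / 2"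
        "complex_of_real (w * (1 + sin l)) * iexp t = 
          w * iexp (0 + t) + (w * iexp (l + t) - w * iexp (- l + t)) / (2 * \<i>)" for w l t :: real
      proof -
        have e: "iexp (l + t) = iexp l * iexp t" "iexp (- l + t) = iexp (- l) * iexp t" "iexp (0 + t) = iexp t" for l t
          by (simp_all add: exp_add[symmetric] algebra_simps)
        have c: "complex_of_real (cos l) = (iexp l + iexp (- l)) / 2"
          by (simp add: cos_of_real[symmetric] cos_exp_eq)
        show "complex_of_real (w * (1 + cos l)) * iexp t = w * iexp (0 + t) + (w * iexp (l + t) + w * iexp (- l + t)) / 2"
          unfolding e unfolding of_real_mult of_real_add c by (simp add: field_simps)
        have s: "complex_of_real (sin l) = (iexp l - iexp (- l)) / (2 * \<i>)"
          by (simp add: sin_of_real[symmetric] sin_exp_eq)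
        show "complex_of_real (w * (1 + sin l)) * iexp t = w * iexp (0 + t) + (w * iexp (l + t) - w * iexp (- l + t)) / (2 * \<i>)"
          unfolding e unfolding of_real_mult of_real_add s by (simp add: field_simps)
      qed
      have b0: "(CLINT x|M. wY D x * iexp (0 + \<theta> * Y j x)) = (CLINT x|N. wZ D x * iexp (0 + \<theta> * Z j x))"
        "complex_integrable M (\<lambda>x. wY D x * iexp (0 + \<theta> * Y j x))"
        "complex_integrable N (\<lambda>x. wZ D x * iexp (0 + \<theta> * Z j x))" for \<theta>
        using base[of "\<lambda>i. 0" \<theta>] ib[of "\<lambda>i. 0" \<theta>] by (simp_all only: zero)
      have bn: "(CLINT x|M. wY D x * iexp (- LY c x + \<theta> * Y j x)) = (CLINT x|N. wZ D x * iexp (- LZ c x + \<theta> * Z j x))"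
        "complex_integrable M (\<lambda>x. wY D x * iexp (- LY c x + \<theta> * Y j x))"
        "complex_integrable N (\<lambda>x. wZ D x * iexp (- LZ c x + \<theta> * Z j x))" for \<theta>
        using base[of ?n \<theta>] ib[of ?n \<theta>] by (simp_all only: neg)
      have C: "(LINT x|M. wY D x * (1 + cos (LY c x)) * indicator (B j) (Y j x)) = (LINT x|N. wZ D x * (1 + cos (LZ c x)) * indicator (B j) (Z j x))"
      proof (rule weighted_Levy[where K=2])
        fix \<theta> 
        show "(CLINT x|M. complex_of_real (wY D x * (1 + cos (LY c x))) * iexp (\<theta> * Y j x)) =
          (CLINT x|N. complex_of_real (wZ D x * (1 + cos (LZ c x))) * iexp (\<theta> * Z j x))"
          unfolding trig using b0 bn base ib
          by (subst (1 2) Bochner_Integration.integral_add; simp only: Bochner_Integration.integrable_add integral_divide_zero Bochner_Integration.integral_add integrable_divide)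
      next
        fix x show "wY D x * (1 + cos (LY c x)) \<le> 2" "0 \<le> wY D x * (1 + cos (LY c x))"
          by (intro bnd w01Y; simp)+
      next
        fix x show "wZ D x * (1 + cos (LZ c x)) \<le> 2" "0 \<le> wZ D x * (1 + cos (LZ c x))"
          by (intro bnd w01Z; simp)+
      qed (use assms(1,2) in auto)
      have S: "(LINT x|M. wY D x * (1 + sin (LY c x)) * indicator (B j) (Y j x)) = (LINT x|N. wZ D x * (1 + sin (LZ c x)) * indicator (B j) (Z j x))"
      proof (rule weighted_Levy[where K=2])
        fix \<theta> 
        show "(CLINT x|M. complex_of_real (wY D x * (1 + sin (LY c x))) * iexp (\<theta> * Y j x)) =
          (CLINT x|N. complex_of_real (wZ D x * (1 + sin (LZ c x))) * iexp (\<theta> * Z j x))"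
          unfolding trig using b0 bn base ib
          by (subst (1 2) Bochner_Integration.integral_add; simp only: Bochner_Integration.integrable_diff integral_divide_zero Bochner_Integration.integral_diff integrable_divide)
      next
        fix x show "wY D x * (1 + sin (LY c x)) \<le> 2" "0 \<le> wY D x * (1 + sin (LY c x))"
          by (intro bnd w01Y; simp)+
      next
        fix x show "wZ D x * (1 + sin (LZ c x)) \<le> 2" "0 \<le> wZ D x * (1 + sin (LZ c x))"
          by (intro bnd w01Z; simp)+
      qed (use assms(1,2) in auto)
      \<comment> \<open>The constant part of the weights alone; subtracted from \<open>C\<close> and
        \<open>S\<close>, it leaves the pure cosine and sine parts.\<close>
      have I: "(LINT x|M. wY D x * indicator (B j) (Y j x)) = (LINT x|N. wZ D x * indicator (B j) (Z j x))"
        using w01 b0(1) by (intro weighted_Levy[where K=1] assms(1,2)) auto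
      have ins: "wY (insert j D) x = wY D x * indicator (B j) (Y j x)" "wZ (insert j D) y = wZ D y * indicator (B j) (Z j y)" for x y
        using jD insert.hyps by (simp_all add: wY_def wZ_def mult.commute)
      have bd: "\<bar>wY (insert j D) x\<bar> \<le> 1" "\<bar>wZ (insert j D) y\<bar> \<le> 1" for x y using w01 by (simp_all add: abs_of_nonneg)
      have iR: "integrable M (wY (insert j D))" "integrable N (wZ (insert j D))" 
        using mw[of "insert j D"] j D bd by (auto intro!: M.integrable_const_bound[of _ 1] N.integrable_const_bound[of _ 1])
      have iR': "integrable M (\<lambda>x. wY (insert j D) x * g (LY c x))" "integrable N (\<lambda>x. wZ (insert j D) x * g (LZ c x))" 
        if "\<And>x. \<bar>g x\<bar> \<le> 1" "g \<in> borel_measurable borel" for g :: "real \<Rightarrow> real"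
        using mw[of "insert j D"] j D bd that 
        by (auto intro!: M.integrable_const_bound[of _ 1] N.integrable_const_bound[of _ 1] simp: abs_mult mult_le_one)
      have I': "(LINT x|M. wY (insert j D) x) = (LINT x|N. wZ (insert j D) x)" using I by (simp add: ins)
      have C': "(LINT x|M. wY (insert j D) x * cos (LY c x)) = (LINT x|N. wZ (insert j D) x * cos (LZ c x))"
      proof -
        have "(LINT x|M. wY (insert j D) x + wY (insert j D) x * cos (LY c x)) = (LINT x|N. wZ (insert j D) x + wZ (insert j D) x * cos (LZ c x))"
          using C by (simp add: ins algebra_simps)
        then show ?thesis using iR iR'[of cos] I' by (subst (asm) (1 2) Bochner_Integration.integral_add) auto
      qed
      have S': "(LINT x|M. wY (insert j D) x * sin (LY c x)) = (LINT x|N. wZ (insert j D) x * sin (LZ c x))"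
      proof -
        have "(LINT x|M. wY (insert j D) x + wY (insert j D) x * sin (LY c x)) = (LINT x|N. wZ (insert j D) x + wZ (insert j D) x * sin (LZ c x))"
          using S by (simp add: ins algebra_simps)
        then show ?thesis using iR iR'[of sin] I' by (subst (asm) (1 2) Bochner_Integration.integral_add) auto
      qed
      have e: "complex_of_real w * iexp l = of_real (w * cos l) + \<i> * of_real (w * sin l)" for w l :: real
        by (simp add: complex_eq_iff Re_exp Im_exp)
      have "(CLINT x|M. wY (insert j D) x * iexp (LY c x)) =
        of_real (LINT x|M. wY (insert j D) x * cos (LY c x)) + \<i> * of_real (LINT x|M. wY (insert j D) x * sin (LY c x))"
        unfolding e using iR'[of cos] iR'[of sin] by (subst Bochner_Integration.integral_add) (auto simp del: of_real_mult)
      moreover have "(CLINT x|N. wZ (insert j D) x * iexp (LZ c x)) =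
        of_real (LINT x|N. wZ (insert j D) x * cos (LZ c x)) + \<i> * of_real (LINT x|N. wZ (insert j D) x * sin (LZ c x))"
        unfolding e using iR'[of cos] iR'[of sin] by (subst Bochner_Integration.integral_add) (auto simp del: of_real_mult)
      ultimately show ?case using C' S' by simp
    qed
  qed
  have "complex_of_real (LINT x|M. wY F x) = of_real (LINT x|N. wZ F x)"
    using H[of F "\<lambda>_. 0"] by (simp add: LY_def LZ_def)
  then have *: "(LINT x|M. wY F x) = (LINT x|N. wZ F x)" by (simp del: integral_of_real)
  have pr: "(\<Prod>i\<in>F. indicator (B i) (u i) :: real) = (if \<forall>i\<in>F. u i \<in> B i then 1 else 0)" for u :: "'i \<Rightarrow> real"
    using F by (induction F) (auto simp: indicator_def)
  have "(LINT x|M. wY F x) = measure M {x\<in>space M. \<forall>i\<in>F. Y i x \<in> B i}"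
  proof -
    have "(LINT x|M. wY F x) = (LINT x|M. indicator {x\<in>space M. \<forall>i\<in>F. Y i x \<in> B i} x)"
      by (intro Bochner_Integration.integral_cong refl) (unfold wY_def pr, auto)
    then show ?thesis by (simp add: Int_absorb2 Collect_subset)
  qed
  moreover have "(LINT x|N. wZ F x) = measure N {x\<in>space N. \<forall>i\<in>F. Z i x \<in> B i}"
  proof -
    have "(LINT x|N. wZ F x) = (LINT x|N. indicator {x\<in>space N. \<forall>i\<in>F. Z i x \<in> B i} x)"
      by (intro Bochner_Integration.integral_cong refl) (unfold wZ_def pr, auto)
    then show ?thesis by (simp add: Int_absorb2 Collect_subset)
  qed
  ultimately show ?thesis using * by simp
qed


lemma integral_pair_prod:
  fixes a b :: "_ \<Rightarrow> complex"
  assumes "prob_space P" "prob_space Q" and [measurable]: "a \<in> borel_measurable P" "b \<in> borel_measurable Q"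
    and bd: "\<And>x. norm (a x) \<le> 1" "\<And>x. norm (b x) \<le> 1"
  shows "(CLINT z|P \<Otimes>\<^sub>M Q. a (fst z) * b (snd z)) = (CLINT x|P. a x) * (CLINT y|Q. b y)"
proof -
  interpret P: prob_space P by fact
  interpret Q: prob_space Q by fact
  interpret PQ: pair_prob_space P Q ..
  have "complex_integrable (P \<Otimes>\<^sub>M Q) (\<lambda>z. a (fst z) * b (snd z))"
    using bd by (intro PQ.integrable_const_bound[of _ 1]) (auto simp: norm_mult mult_le_one)
  from PQ.integral_fst'[OF this] show ?thesis by simp
qed

text \<open>Uncorrelated members of \<open>G\<close> are independent: the variance of a linear
  combination has no mixed terms, so its characteristic function factors and agrees with that of the
  product of the marginals.\<close>

lemma (in gauss_space) uncorrelated_rectangles: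
  assumes U: "U1 \<in> G" "U2 \<in> G" "U3 \<in> G"
    and unc: "cov U1 U2 = 0" "cov U1 U3 = 0" "cov U2 U3 = 0"
    and [measurable]: "B1 \<in> sets borel" "B2 \<in> sets borel" "B3 \<in> sets borel"
  shows "emeasure M {\<omega>\<in>space M. U1 \<omega> \<in> B1 \<and> U2 \<omega> \<in> B2 \<and> U3 \<omega> \<in> B3} =
    emeasure (cnormal (cov U1 U1)) B1 * (emeasure (cnormal (cov U2 U2)) B2 * emeasure (cnormal (cov U3 U3)) B3)"
proof -
  define v1 v2 v3 where v_def: "v1 = cov U1 U1" "v2 = cov U2 U2" "v3 = cov U3 U3"
  have v: "0 \<le> v1" "0 \<le> v2" "0 \<le> v3" by (simp_all add: v_def cov_nonneg)
  interpret N1: prob_space "cnormal v1" by (rule prob_space_cnormal)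
  interpret N2: prob_space "cnormal v2" by (rule prob_space_cnormal)
  interpret N3: prob_space "cnormal v3" by (rule prob_space_cnormal)
  interpret N23: pair_prob_space "cnormal v2" "cnormal v3" ..
  interpret N: pair_prob_space "cnormal v1" "cnormal v2 \<Otimes>\<^sub>M cnormal v3" ..
  let ?N = "cnormal v1 \<Otimes>\<^sub>M (cnormal v2 \<Otimes>\<^sub>M cnormal v3)"
  define Y where "Y i = (if i = 0 then U1 else if i = (1::nat) then U2 else U3)" for i
  define Z :: "nat \<Rightarrow> real \<times> real \<times> real \<Rightarrow> real" where
    "Z i = (if i = 0 then fst else if i = 1 then fst \<circ> snd else snd \<circ> snd)" for i
  define B where "B i = (if i = 0 then B1 else if i = (1::nat) then B2 else B3)" for i
  have "measure M {\<omega>\<in>space M. \<forall>i\<in>{0,1,2}. Y i \<omega> \<in> B i} = measure ?N {z\<in>space ?N. \<forall>i\<in>{0,1,2}. Z i z \<in> B i}"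
  proof (rule Cramer_Wold_rectangles)
    show "prob_space M" "prob_space ?N" by unfold_locales
    show "Y i \<in> borel_measurable M" for i using U measurable_G by (simp add: Y_def)
    show "Z i \<in> borel_measurable ?N" for i by (simp add: Z_def comp_def)
    show "B i \<in> sets borel" for i by (simp add: B_def)
    fix c :: "nat \<Rightarrow> real"
    define L where "L = (\<lambda>\<omega>. 1 * (c 0 * U1 \<omega> + c 1 * U2 \<omega>) + c 2 * U3 \<omega>)"
    have LG: "L \<in> G" unfolding L_def by (intro lin U)
    have "cov L L = (c 0)\<^sup>2 * v1 + (c 1)\<^sup>2 * v2 + (c 2)\<^sup>2 * v3"
      unfolding L_def by (subst cov_square_lin) (auto simp: U lin cov_square_lin cov_lin_left unc v_def)
    then have "(CLINT \<omega>|M. iexp (1 * L \<omega>)) = of_real (exp (- (((c 0)\<^sup>2 * v1 + (c 1)\<^sup>2 * v2 + (c 2)\<^sup>2 * v3) * 1\<^sup>2 / 2)))"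
      using cgauss_char[OF cgauss_cov[OF LG], of 1] by simp
    also have "\<dots> = char (cnormal v1) (c 0) * (char (cnormal v2) (c 1) * char (cnormal v3) (c 2))"
      using v by (simp add: char_cnormal of_real_mult[symmetric] exp_add[symmetric] field_simps del: of_real_mult)
    also have "\<dots> = (CLINT z|?N. iexp (c 0 * fst z) * (iexp (c 1 * fst (snd z)) * iexp (c 2 * snd (snd z))))"
    proof -
      have "char (cnormal v2) (c 1) * char (cnormal v3) (c 2) = 
        (CLINT z|cnormal v2 \<Otimes>\<^sub>M cnormal v3. iexp (c 1 * fst z) * iexp (c 2 * snd z))"
        unfolding char_def by (rule integral_pair_prod[symmetric]) (auto simp: prob_space_cnormal)
      moreover have "char (cnormal v1) (c 0) * (CLINT z|cnormal v2 \<Otimes>\<^sub>M cnormal v3. iexp (c 1 * fst z) * iexp (c 2 * snd z))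
        = (CLINT z|?N. iexp (c 0 * fst z) * (iexp (c 1 * fst (snd z)) * iexp (c 2 * snd (snd z))))"
        unfolding char_def 
        by (rule integral_pair_prod[where b="\<lambda>z. iexp (c 1 * fst z) * iexp (c 2 * snd z)", symmetric])
          (auto simp: prob_space_cnormal N23.prob_space_axioms norm_mult)
      ultimately show ?thesis by simp
    qed
    finally show "(CLINT x|M. iexp (\<Sum>i\<in>{0,1,2}. c i * Y i x)) = (CLINT x|?N. iexp (\<Sum>i\<in>{0,1,2}. c i * Z i x))"
      by (simp add: Y_def Z_def L_def exp_add[symmetric] algebra_simps)
  qed simp
  also have "{z\<in>space ?N. \<forall>i\<in>{0,1,2}. Z i z \<in> B i} = B1 \<times> (B2 \<times> B3)"
    by (auto simp: Z_def B_def space_pair_measure)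
  also have "{\<omega>\<in>space M. \<forall>i\<in>{0,1,2}. Y i \<omega> \<in> B i} = {\<omega>\<in>space M. U1 \<omega> \<in> B1 \<and> U2 \<omega> \<in> B2 \<and> U3 \<omega> \<in> B3}"
    by (auto simp: Y_def B_def)
  finally have "emeasure M {\<omega>\<in>space M. U1 \<omega> \<in> B1 \<and> U2 \<omega> \<in> B2 \<and> U3 \<omega> \<in> B3} = emeasure ?N (B1 \<times> (B2 \<times> B3))"
    by (simp add: emeasure_eq_measure N.emeasure_eq_measure)
  also have "\<dots> = emeasure (cnormal v1) B1 * (emeasure (cnormal v2) B2 * emeasure (cnormal v3) B3)"
    by (simp add: N23.emeasure_pair_measure_Times N3.emeasure_pair_measure_Times)
  finally show ?thesis by (simp add: v_def)
qed

text \<open>The image under \<open>(U1, U2)\<close> of \<open>M\<close> with density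
  \<open>f (U3)\<close> is identified, on rectangles, with the product of the first marginal and
  \<open>F\<close> times the second. Finiteness of \<open>F\<close> keeps this factor finite, so
  that rectangles determine the product.\<close>

lemma (in gauss_space) uncorrelated_nn_integral:
  fixes f :: "real \<Rightarrow> ennreal" and h :: "real \<times> real \<Rightarrow> ennreal"
  assumes U: "U1 \<in> G" "U2 \<in> G" "U3 \<in> G"
    and unc: "cov U1 U2 = 0" "cov U1 U3 = 0" "cov U2 U3 = 0"
    and [measurable]: "f \<in> borel_measurable borel" "h \<in> borel_measurable (borel \<Otimes>\<^sub>M borel)"
    and fin: "(\<integral>\<^sup>+\<omega>. f (U3 \<omega>) \<partial>M) < \<infinity>"
  shows "(\<integral>\<^sup>+\<omega>. f (U3 \<omega>) * h (U1 \<omega>, U2 \<omega>) \<partial>M) =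
    (\<integral>\<^sup>+\<omega>. f (U3 \<omega>) \<partial>M) * (\<integral>\<^sup>+x. (\<integral>\<^sup>+y. h (x, y) \<partial>cnormal (cov U2 U2)) \<partial>cnormal (cov U1 U1))"
proof -
  let ?N1 = "cnormal (cov U1 U1)" and ?N2 = "cnormal (cov U2 U2)" and ?N3 = "cnormal (cov U3 U3)"
  have [measurable]: "U1 \<in> borel_measurable M" "U2 \<in> borel_measurable M" "U3 \<in> borel_measurable M"
    using U measurable_G by auto
  define F where "F = (\<integral>\<^sup>+\<omega>. f (U3 \<omega>) \<partial>M)"
  have F: "F = (\<integral>\<^sup>+x. f x \<partial>?N3)" unfolding F_def
    by (rule cgauss_nn_integral[OF cgauss_cov[OF U(3)]]) simp
  have rect: "(\<integral>\<^sup>+\<omega>. f (U3 \<omega>) * indicator (B1 \<times> B2) (U1 \<omega>, U2 \<omega>) \<partial>M) = emeasure ?N1 B1 * (emeasure ?N2 B2 * F)"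
    if [measurable]: "B1 \<in> sets borel" "B2 \<in> sets borel" for B1 B2
  proof -
    let ?W = "density M (\<lambda>\<omega>. indicator (B1 \<times> B2) (U1 \<omega>, U2 \<omega>))"
    \<comment> \<open>On the event that \<open>(U1, U2)\<close> lies in the rectangle,
      \<open>U3\<close> keeps its marginal law up to the probability of the event. This is what lets
      a general \<open>f\<close> replace indicators.\<close>
    have "distr ?W borel U3 = scale_measure (emeasure ?N1 B1 * emeasure ?N2 B2) ?N3"
    proof (rule measure_eqI)
      fix B3 assume "B3 \<in> sets (distr ?W borel U3)"
      then have [measurable]: "B3 \<in> sets borel" by simp
      have "emeasure (distr ?W borel U3) B3 = (\<integral>\<^sup>+\<omega>. indicator (B1 \<times> B2) (U1 \<omega>, U2 \<omega>) * indicator (U3 -` B3 \<inter> space M) \<omega> \<partial>M)"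
        by (simp add: emeasure_distr emeasure_density)
      also have "\<dots> = (\<integral>\<^sup>+\<omega>. indicator {\<omega>\<in>space M. U1 \<omega> \<in> B1 \<and> U2 \<omega> \<in> B2 \<and> U3 \<omega> \<in> B3} \<omega> \<partial>M)"
        by (intro nn_integral_cong) (auto simp: indicator_def)
      also have "\<dots> = emeasure M {\<omega>\<in>space M. U1 \<omega> \<in> B1 \<and> U2 \<omega> \<in> B2 \<and> U3 \<omega> \<in> B3}"
        by (rule nn_integral_indicator) measurable
      finally show "emeasure (distr ?W borel U3) B3 = emeasure (scale_measure (emeasure ?N1 B1 * emeasure ?N2 B2) ?N3) B3"
        using uncorrelated_rectangles[OF U unc, of B1 B2 B3] by (simp add: mult.assoc)
    qed simp
    then have "(\<integral>\<^sup>+x. f x \<partial>distr ?W borel U3) = emeasure ?N1 B1 * emeasure ?N2 B2 * F"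
      by (simp add: nn_integral_scale_measure F)
    then show ?thesis by (simp add: nn_integral_distr nn_integral_density mult_ac)
  qed
  interpret N1: prob_space ?N1 by (rule prob_space_cnormal)
  interpret N2: prob_space ?N2 by (rule prob_space_cnormal)
  have "emeasure (scale_measure F ?N2) (space (scale_measure F ?N2)) \<noteq> \<infinity>"
    using fin N2.emeasure_space_1 by (simp add: F_def space_scale_measure)
  then interpret S: finite_measure "scale_measure F ?N2" by (rule finite_measureI)
  have "?N1 \<Otimes>\<^sub>M scale_measure F ?N2 = distr (density M (\<lambda>\<omega>. f (U3 \<omega>))) (borel \<Otimes>\<^sub>M borel) (\<lambda>\<omega>. (U1 \<omega>, U2 \<omega>))"
  proof (rule pair_measure_eqI)
    show "sigma_finite_measure ?N1" "sigma_finite_measure (scale_measure F ?N2)" by unfold_locales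
    show "sets (?N1 \<Otimes>\<^sub>M scale_measure F ?N2) = sets (distr (density M (\<lambda>\<omega>. f (U3 \<omega>))) (borel \<Otimes>\<^sub>M borel) (\<lambda>\<omega>. (U1 \<omega>, U2 \<omega>)))"
      by (simp cong: sets_pair_measure_cong)
    fix A B assume "A \<in> sets ?N1" "B \<in> sets (scale_measure F ?N2)"
    then have [measurable]: "A \<in> sets borel" "B \<in> sets borel" by simp_all
    have "emeasure (distr (density M (\<lambda>\<omega>. f (U3 \<omega>))) (borel \<Otimes>\<^sub>M borel) (\<lambda>\<omega>. (U1 \<omega>, U2 \<omega>))) (A \<times> B) =
      (\<integral>\<^sup>+\<omega>. f (U3 \<omega>) * indicator (A \<times> B) (U1 \<omega>, U2 \<omega>) \<partial>M)"
      by (auto simp: emeasure_distr emeasure_density indicator_def intro!: nn_integral_cong)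
    then show "emeasure ?N1 A * emeasure (scale_measure F ?N2) B = 
      emeasure (distr (density M (\<lambda>\<omega>. f (U3 \<omega>))) (borel \<Otimes>\<^sub>M borel) (\<lambda>\<omega>. (U1 \<omega>, U2 \<omega>))) (A \<times> B)"
      using rect[of A B] by (simp add: mult_ac)
  qed
  then have "(\<integral>\<^sup>+z. h z \<partial>(?N1 \<Otimes>\<^sub>M scale_measure F ?N2)) = (\<integral>\<^sup>+\<omega>. f (U3 \<omega>) * h (U1 \<omega>, U2 \<omega>) \<partial>M)"
    by (simp add: nn_integral_distr nn_integral_density)
  moreover have "(\<integral>\<^sup>+z. h z \<partial>(?N1 \<Otimes>\<^sub>M scale_measure F ?N2)) = (\<integral>\<^sup>+x. (\<integral>\<^sup>+y. h (x, y) \<partial>scale_measure F ?N2) \<partial>?N1)"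
    by (rule S.nn_integral_fst[symmetric]) (simp cong: measurable_cong_sets sets_pair_measure_cong)
  moreover have "(\<integral>\<^sup>+x. (\<integral>\<^sup>+y. h (x, y) \<partial>scale_measure F ?N2) \<partial>?N1) = F * (\<integral>\<^sup>+x. (\<integral>\<^sup>+y. h (x, y) \<partial>?N2) \<partial>?N1)"
    by (simp add: nn_integral_scale_measure nn_integral_cmult)
  ultimately show ?thesis by (simp add: F_def)
qed

text \<open>Changing the sign of all \<open>Y i\<close> preserves the centered normal law of every
  linear combination. It serves to exchange the levels \<open>u\<close> and
  \<open>- u\<close>.\<close>

lemma (in gauss_space) symmetric_rectangles:
  assumes "finite F" "\<And>i. i \<in> F \<Longrightarrow> Y i \<in> G" "\<And>i. i \<in> F \<Longrightarrow> B i \<in> sets borel"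
  shows "prob {\<omega>\<in>space M. \<forall>i\<in>F. Y i \<omega> \<in> B i} = prob {\<omega>\<in>space M. \<forall>i\<in>F. - Y i \<omega> \<in> B i}"
proof (cases "F = {}")
  case False
  show ?thesis
  proof (rule Cramer_Wold_rectangles[where Z="\<lambda>i \<omega>. - Y i \<omega>"])
    fix c :: "_ \<Rightarrow> real"
    define L where "L = (\<lambda>\<omega>. \<Sum>i\<in>F. c i * Y i \<omega>)"
    have "L \<in> G" unfolding L_def using assms False by (intro G_sum) auto
    then have "(CLINT \<omega>|M. iexp (1 * L \<omega>)) = (CLINT \<omega>|M. iexp (-1 * L \<omega>))"
      using cgauss_char[OF cgauss_cov, of L] by (simp only:) simp
    then show "(CLINT x|M. iexp (\<Sum>i\<in>F. c i * Y i x)) = (CLINT x|M. iexp (\<Sum>i\<in>F. c i * - Y i x))"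
      by (simp add: L_def sum_negf)
  qed (use assms measurable_G prob_space_axioms in auto)
qed simp

section \<open>Suprema of Gaussian processes\<close>

lemma abs_exp_diff_le:
  fixes a b :: real shows "\<bar>exp b - exp a\<bar> \<le> \<bar>b - a\<bar> * (exp a + exp b)"
proof -
  have *: "exp b - exp a \<le> (b - a) * exp b" for a b :: real
  proof -
    have "(1 + (a - b)) * exp b \<le> exp (a - b) * exp b" by (intro mult_right_mono exp_ge_add_one_self) simp
    then show ?thesis by (simp add: exp_diff algebra_simps)
  qed
  show ?thesis
  proof (cases "a \<le> b")
    case True
    have "0 \<le> (b - a) * exp a" using True by simp
    then have "exp b - exp a \<le> (b - a) * exp a + (b - a) * exp b" using *[of b a] by linarith
    then show ?thesis using *[of a b] True by (simp add: abs_of_nonneg distrib_left)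
  next
    case False
    have "0 \<le> (a - b) * exp b" using False by simp
    then have "exp a - exp b \<le> (a - b) * exp a + (a - b) * exp b" using *[of a b] by linarith
    then show ?thesis using *[of b a] False by (simp add: abs_of_nonpos distrib_left)
  qed
qed

text \<open>The mesh \<open>h\<close> has to come out as a factor, with a remainder of bounded
  expectation, so that the increments along a grid have a bounded sum. The polynomial factor that
  comes from \<open>y\<^sup>2 - x\<^sup>2\<close> is absorbed into \<open>exp (a * T)\<close>, at
  the price of enlarging \<open>\<theta>\<close> to \<open>p * \<theta>\<close>.\<close>

lemma exp_square_increment_le:
  fixes x y D :: real
  assumes "0 < \<theta>" "0 < h" "1 < p" "0 < a" and y: "y = x + h * D"
  defines "e \<equiv> 3 * (a * p / (p - 1))"
  shows "\<bar>exp (\<theta> * y\<^sup>2) - exp (\<theta> * x\<^sup>2)\<bar> \<le> h * (\<theta> / a) *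
    (exp (p * \<theta> * x\<^sup>2) + exp (p * \<theta> * y\<^sup>2) + 2 * (exp (e * D\<^sup>2) + exp (e * x\<^sup>2) + exp (e * y\<^sup>2)))"
proof -
  define T where "T = D\<^sup>2 + x\<^sup>2 + y\<^sup>2"
  have T: "0 \<le> T" by (simp add: T_def)
  \<comment> \<open>Either \<open>a * T\<close> fits into the slack
    \<open>(p - 1) * \<theta> * z\<^sup>2\<close>, or \<open>\<theta> * z\<^sup>2\<close> is at most
    \<open>a * T / (p - 1)\<close>; the second case produces the constant
    \<open>e / 3 = a * p / (p - 1)\<close>.\<close>
  have sp: "exp (\<theta> * z\<^sup>2 + a * T) \<le> exp (p * \<theta> * z\<^sup>2) + exp ((e / 3) * T)" for z
  proof (cases "a * T \<le> (p - 1) * \<theta> * z\<^sup>2")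
    case True
    then have "\<theta> * z\<^sup>2 + a * T \<le> p * \<theta> * z\<^sup>2" by (simp add: algebra_simps)
    then show ?thesis by (simp add: add_increasing2)
  next
    case False
    then have "\<theta> * z\<^sup>2 \<le> a * T / (p - 1)" using assms by (simp add: field_simps)
    then have "\<theta> * z\<^sup>2 + a * T \<le> (e / 3) * T" using assms by (simp add: e_def field_simps)
    then show ?thesis by (simp add: add_increasing)
  qed
  have e: "0 \<le> e" using assms by (simp add: e_def)
  have "T / 3 \<le> max (D\<^sup>2) (max (x\<^sup>2) (y\<^sup>2))" unfolding T_def by (simp add: max_def)
  then have "(e / 3) * T \<le> e * max (D\<^sup>2) (max (x\<^sup>2) (y\<^sup>2))"
    using e mult_left_mono by fastforce
  then have "exp ((e / 3) * T) \<le> exp (e * max (D\<^sup>2) (max (x\<^sup>2) (y\<^sup>2)))" by simp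
  also have "\<dots> \<le> exp (e * D\<^sup>2) + exp (e * x\<^sup>2) + exp (e * y\<^sup>2)"
    by (auto simp: max_def add_increasing add_increasing2)
  finally have eT: "exp ((e / 3) * T) \<le> exp (e * D\<^sup>2) + exp (e * x\<^sup>2) + exp (e * y\<^sup>2)" .
  have "\<bar>y\<^sup>2 - x\<^sup>2\<bar> = h * (\<bar>D\<bar> * \<bar>x + y\<bar>)"
  proof -
    have "y\<^sup>2 - x\<^sup>2 = h * (D * (x + y))" by (simp add: y power2_eq_square algebra_simps)
    then show ?thesis using assms by (simp add: abs_mult)
  qed
  also have "\<dots> \<le> h * T"
  proof (intro mult_left_mono)
    have "\<bar>D\<bar> * \<bar>x + y\<bar> \<le> \<bar>D\<bar> * \<bar>x\<bar> + \<bar>D\<bar> * \<bar>y\<bar>"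
      by (simp add: distrib_left[symmetric] mult_left_mono abs_triangle_ineq)
    moreover have "2 * (\<bar>D\<bar> * \<bar>x\<bar>) \<le> D\<^sup>2 + x\<^sup>2" "2 * (\<bar>D\<bar> * \<bar>y\<bar>) \<le> D\<^sup>2 + y\<^sup>2"
      using sum_squares_bound[of "\<bar>D\<bar>" "\<bar>x\<bar>"] sum_squares_bound[of "\<bar>D\<bar>" "\<bar>y\<bar>"] by auto
    ultimately show "\<bar>D\<bar> * \<bar>x + y\<bar> \<le> T" unfolding T_def using zero_le_power2[of x] zero_le_power2[of y] by linarith
  qed (use assms in simp)
  also have "\<dots> \<le> h * (exp (a * T) / a)"
  proof (intro mult_left_mono)
    have "a * T \<le> exp (a * T)" using exp_ge_add_one_self[of "a * T"] by linarith
    then show "T \<le> exp (a * T) / a" using assms by (simp add: field_simps)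
  qed (use assms in simp)
  finally have d: "\<bar>y\<^sup>2 - x\<^sup>2\<bar> \<le> h * (exp (a * T) / a)" .
  have "\<bar>exp (\<theta> * y\<^sup>2) - exp (\<theta> * x\<^sup>2)\<bar> \<le> \<bar>\<theta> * y\<^sup>2 - \<theta> * x\<^sup>2\<bar> * (exp (\<theta> * x\<^sup>2) + exp (\<theta> * y\<^sup>2))"
    by (rule abs_exp_diff_le)
  also have "\<dots> \<le> (\<theta> * (h * (exp (a * T) / a))) * (exp (\<theta> * x\<^sup>2) + exp (\<theta> * y\<^sup>2))"
  proof (intro mult_right_mono)
    have "\<bar>\<theta> * y\<^sup>2 - \<theta> * x\<^sup>2\<bar> = \<theta> * \<bar>y\<^sup>2 - x\<^sup>2\<bar>"
      using assms by (simp add: abs_mult right_diff_distrib[symmetric])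
    then show "\<bar>\<theta> * y\<^sup>2 - \<theta> * x\<^sup>2\<bar> \<le> \<theta> * (h * (exp (a * T) / a))"
      using mult_left_mono[OF d, of \<theta>] \<open>0 < \<theta>\<close> by simp
  qed (simp add: add_nonneg_nonneg)
  also have "\<dots> = h * (\<theta> / a) * (exp (\<theta> * x\<^sup>2 + a * T) + exp (\<theta> * y\<^sup>2 + a * T))"
    by (simp add: exp_add algebra_simps add_divide_distrib)
  also have "\<dots> \<le> h * (\<theta> / a) * ((exp (p * \<theta> * x\<^sup>2) + exp ((e / 3) * T)) + (exp (p * \<theta> * y\<^sup>2) + exp ((e / 3) * T)))"
    using assms by (intro mult_left_mono add_mono sp) auto
  also have "\<dots> \<le> h * (\<theta> / a) *
    (exp (p * \<theta> * x\<^sup>2) + exp (p * \<theta> * y\<^sup>2) + 2 * (exp (e * D\<^sup>2) + exp (e * x\<^sup>2) + exp (e * y\<^sup>2)))"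
    using assms eT by (intro mult_left_mono) auto
  finally show ?thesis .
qed

text \<open>The supremum of a Gaussian process is controlled by the total variation of \<open>exp (\<theta> Y\<^sub>t\<^sup>2)\<close>,
  whose expectation is finite as long as \<open>2 \<theta>\<close> times the variance stays below \<open>1\<close>.\<close>

lemma (in gauss_space) sup_tail:
  assumes "c < d" and S: "0 < S" "v < S"
    and Y: "\<And>t. t \<in> {c..d} \<Longrightarrow> Y t \<in> G"
    and v: "\<And>t. t \<in> {c..d} \<Longrightarrow> cov (Y t) (Y t) \<le> v"
    and C: "\<And>s t. s \<in> {c..d} \<Longrightarrow> t \<in> {c..d} \<Longrightarrow> cov (\<lambda>\<omega>. Y t \<omega> - Y s \<omega>) (\<lambda>\<omega>. Y t \<omega> - Y s \<omega>) \<le> C * (t - s)\<^sup>2"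
    and cont: "AE \<omega> in M. continuous_on {c..d} (\<lambda>t. Y t \<omega>)"
  shows "\<exists>K \<kappa>. 0 \<le> K \<and> 0 < \<kappa> \<and> (\<forall>u\<ge>0. \<exists>F\<in>sets M. prob F \<le> K * exp (- ((1 + \<kappa>) * u\<^sup>2 / (2 * S))) \<and>
    (AE \<omega> in M. (\<exists>t\<in>{c..d}. u \<le> \<bar>Y t \<omega>\<bar>) \<longrightarrow> \<omega> \<in> F))"
proof -
  have v0: "0 \<le> v" using v[of c] cov_nonneg[of "Y c"] \<open>c < d\<close> by auto
  \<comment> \<open>Small enough for \<open>(1 + \<kappa>)\<^sup>2 * v < S\<close>: one factor
    \<open>p = 1 + \<kappa>\<close> is the gain in the final exponent, the other pays for the
    increment bound.\<close>
  define \<kappa> where "\<kappa> = (S - v) / (6 * S)"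
  have \<kappa>: "0 < \<kappa>" "\<kappa> \<le> 1 / 6" using S v0 by (auto simp: \<kappa>_def field_simps)
  define p where "p = 1 + \<kappa>"
  define \<theta> where "\<theta> = p / (2 * S)"
  have p: "1 < p" and \<theta>: "0 < \<theta>" using \<kappa> S by (auto simp: p_def \<theta>_def)
  have ptv: "2 * (p * \<theta>) * v < 1"
  proof -
    have "\<kappa> * \<kappa> \<le> \<kappa> * 1" using \<kappa> by (intro mult_left_mono) auto
    then have "p\<^sup>2 \<le> 1 + 3 * \<kappa>" by (simp add: p_def power2_eq_square algebra_simps)
    then have "p\<^sup>2 * v \<le> (1 + 3 * \<kappa>) * v" using v0 by (rule mult_right_mono)
    also have "\<dots> = v + (S - v) * (v / (2 * S))" using S by (simp add: \<kappa>_def field_simps)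
    also have "\<dots> < v + (S - v) * 1" using S v0 by (intro add_strict_left_mono mult_strict_left_mono) (auto simp: field_simps)
    finally have "p\<^sup>2 * v < S" by simp
    then show ?thesis using S by (simp add: \<theta>_def power2_eq_square field_simps)
  qed
  \<comment> \<open>\<open>m\<close> dominates the variances of the process and of its difference
    quotients, and \<open>2 * e * m < 1\<close> makes their exponential moments finite;
    \<open>a\<close> is solved from \<open>3 * (a * p / (p - 1)) = e\<close>.\<close>
  define m where "m = max v (max C 0)"
  define e where "e = 1 / (4 * (m + 1))"
  have m: "0 \<le> m" "v \<le> m" "C \<le> m" by (auto simp: m_def)
  have e: "0 < e" "2 * e * m < 1" using m by (auto simp: e_def field_simps)
  define a where "a = e / 3 * (p - 1) / p"
  have a: "0 < a" "3 * (a * p / (p - 1)) = e" using e p by (auto simp: a_def divide_simps)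
  define Q1 where "Q1 = 1 / sqrt (1 - 2 * (p * \<theta>) * v)"
  define Q2 where "Q2 = 1 / sqrt (1 - 2 * e * m)"
  have Q: "0 \<le> Q1" "0 \<le> Q2" using ptv e by (auto simp: Q1_def Q2_def)
  define K1 where "K1 = \<theta> / a * (Q1 + Q1 + 2 * (Q2 + Q2 + Q2))"
  have K1: "0 \<le> K1" using \<theta> a Q by (auto simp: K1_def)
  define h where "h n = (d - c) / real (Suc n)" for n
  define g where "g n i = c + real i * h n" for n i
  have h: "0 < h n" for n using \<open>c < d\<close> by (simp add: h_def)
  have g: "g n i \<in> {c..d}" if "i \<le> Suc n" for n i
  proof -
    have "real i * h n \<le> real (Suc n) * h n" using that h[of n] by (intro mult_right_mono) auto
    also have "\<dots> = d - c" by (simp add: h_def)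
    finally show ?thesis using h[of n] by (auto simp: g_def)
  qed
  \<comment> \<open>Initial value plus variation along the grid: this dominates
    \<open>exp (\<theta> * (Y t)\<^sup>2)\<close> at every grid point, and its expectation is
    bounded uniformly in \<open>n\<close>.\<close>
  define T where "T n \<omega> = exp (\<theta> * (Y c \<omega>)\<^sup>2) + (\<Sum>i<Suc n. \<bar>exp (\<theta> * (Y (g n (Suc i)) \<omega>)\<^sup>2) - exp (\<theta> * (Y (g n i) \<omega>)\<^sup>2)\<bar>)" for n \<omega>
  have mY: "Y t \<in> borel_measurable M" if "t \<in> {c..d}" for t using Y[OF that] by (rule measurable_G)
  have [measurable]: "Y c \<in> borel_measurable M" using \<open>c < d\<close> by (intro mY) auto
  have [measurable]: "T n \<in> borel_measurable M" for n
  proof -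
    have "(\<lambda>\<omega>. \<bar>exp (\<theta> * (Y (g n (Suc i)) \<omega>)\<^sup>2) - exp (\<theta> * (Y (g n i) \<omega>)\<^sup>2)\<bar>) \<in> borel_measurable M" if "i < Suc n" for i
    proof -
      have [measurable]: "Y (g n (Suc i)) \<in> borel_measurable M" "Y (g n i) \<in> borel_measurable M"
        by (rule mY, rule g, use that in simp)+
      show ?thesis by measurable
    qed
    then show ?thesis unfolding T_def[abs_def] by (intro borel_measurable_add borel_measurable_sum) auto
  qed
  have inc: "(\<integral>\<^sup>+\<omega>. ennreal \<bar>exp (\<theta> * (Y (g n (Suc i)) \<omega>)\<^sup>2) - exp (\<theta> * (Y (g n i) \<omega>)\<^sup>2)\<bar> \<partial>M) \<le> ennreal (h n * K1)"
    if "i < Suc n" for n i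
  proof -
    have gi: "g n i \<in> {c..d}" "g n (Suc i) \<in> {c..d}" by (rule g, use that in simp)+
    define x y where xy: "x = Y (g n i)" "y = Y (g n (Suc i))"
    define D where "D = (\<lambda>\<omega>. (1 / h n) * (y \<omega> - x \<omega>))"
    have [measurable]: "x \<in> borel_measurable M" "y \<in> borel_measurable M" using gi mY by (auto simp: xy)
    have [measurable]: "D \<in> borel_measurable M" unfolding D_def by measurable
    have D: "D \<in> G" unfolding D_def using gi Y by (intro G_scale G_diff) (auto simp: xy)
    have "cov D D = (1 / h n)\<^sup>2 * cov (\<lambda>\<omega>. y \<omega> - x \<omega>) (\<lambda>\<omega>. y \<omega> - x \<omega>)"
      unfolding D_def cov_scale_left cov_scale_right by (simp add: power2_eq_square)
    also have "\<dots> \<le> (1 / h n)\<^sup>2 * (C * (g n (Suc i) - g n i)\<^sup>2)"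
      unfolding xy using gi by (intro mult_left_mono C) auto
    also have "\<dots> = C" using h[of n] by (simp add: g_def power2_eq_square field_simps)
    finally have cD: "cov D D \<le> m" using m by simp
    have cx: "cov x x \<le> v" "cov y y \<le> v" using v gi by (auto simp: xy)
    have xyG: "x \<in> G" "y \<in> G" using gi Y by (auto simp: xy)
    have E1: "(\<integral>\<^sup>+\<omega>. ennreal (exp (p * \<theta> * (z \<omega>)\<^sup>2)) \<partial>M) \<le> ennreal Q1" if "z \<in> G" "cov z z \<le> v" for z
      unfolding Q1_def using that ptv p \<theta> by (intro cgauss_exp_square_le[OF cgauss_cov]) auto
    have E2: "(\<integral>\<^sup>+\<omega>. ennreal (exp (e * (z \<omega>)\<^sup>2)) \<partial>M) \<le> ennreal Q2" if "z \<in> G" "cov z z \<le> m" for z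
      unfolding Q2_def using that e by (intro cgauss_exp_square_le[OF cgauss_cov]) auto
    have "(\<integral>\<^sup>+\<omega>. ennreal \<bar>exp (\<theta> * (y \<omega>)\<^sup>2) - exp (\<theta> * (x \<omega>)\<^sup>2)\<bar> \<partial>M) \<le>
      (\<integral>\<^sup>+\<omega>. ennreal (h n * (\<theta> / a)) * (ennreal (exp (p * \<theta> * (x \<omega>)\<^sup>2)) + ennreal (exp (p * \<theta> * (y \<omega>)\<^sup>2)) + 
         2 * (ennreal (exp (e * (D \<omega>)\<^sup>2)) + ennreal (exp (e * (x \<omega>)\<^sup>2)) + ennreal (exp (e * (y \<omega>)\<^sup>2)))) \<partial>M)"
    proof (rule nn_integral_mono)
      fix \<omega>
      have "\<bar>exp (\<theta> * (y \<omega>)\<^sup>2) - exp (\<theta> * (x \<omega>)\<^sup>2)\<bar> \<le> h n * (\<theta> / a) *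
        (exp (p * \<theta> * (x \<omega>)\<^sup>2) + exp (p * \<theta> * (y \<omega>)\<^sup>2) + 2 * (exp (e * (D \<omega>)\<^sup>2) + exp (e * (x \<omega>)\<^sup>2) + exp (e * (y \<omega>)\<^sup>2)))"
        using exp_square_increment_le[OF \<theta> h[of n] p a(1), of "y \<omega>" "x \<omega>" "D \<omega>"] h[of n] unfolding a by (simp add: D_def)
      then show "ennreal \<bar>exp (\<theta> * (y \<omega>)\<^sup>2) - exp (\<theta> * (x \<omega>)\<^sup>2)\<bar> \<le> 
        ennreal (h n * (\<theta> / a)) * (ennreal (exp (p * \<theta> * (x \<omega>)\<^sup>2)) + ennreal (exp (p * \<theta> * (y \<omega>)\<^sup>2)) + 
         2 * (ennreal (exp (e * (D \<omega>)\<^sup>2)) + ennreal (exp (e * (x \<omega>)\<^sup>2)) + ennreal (exp (e * (y \<omega>)\<^sup>2))))"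
        using h[of n] \<theta> a by (subst ennreal_numeral[symmetric]) (simp only: ennreal_plus[symmetric] ennreal_mult[symmetric] exp_ge_zero add_nonneg_nonneg mult_nonneg_nonneg zero_le_numeral less_imp_le divide_nonneg_pos ennreal_leI)
    qed
    also have "\<dots> = ennreal (h n * (\<theta> / a)) * ((\<integral>\<^sup>+\<omega>. ennreal (exp (p * \<theta> * (x \<omega>)\<^sup>2)) \<partial>M) + (\<integral>\<^sup>+\<omega>. ennreal (exp (p * \<theta> * (y \<omega>)\<^sup>2)) \<partial>M) + 
         2 * ((\<integral>\<^sup>+\<omega>. ennreal (exp (e * (D \<omega>)\<^sup>2)) \<partial>M) + (\<integral>\<^sup>+\<omega>. ennreal (exp (e * (x \<omega>)\<^sup>2)) \<partial>M) + (\<integral>\<^sup>+\<omega>. ennreal (exp (e * (y \<omega>)\<^sup>2)) \<partial>M)))"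
      by (simp add: nn_integral_cmult nn_integral_add)
    also have "\<dots> \<le> ennreal (h n * (\<theta> / a)) * (ennreal Q1 + ennreal Q1 + 2 * (ennreal Q2 + ennreal Q2 + ennreal Q2))"
      using cx m cD xyG D by (intro mult_left_mono add_mono E1 E2) auto
    also have "\<dots> = ennreal (h n * K1)"
      unfolding K1_def mult.assoc[symmetric] using h[of n] \<theta> a Q
      by (subst ennreal_numeral[symmetric]) (simp only: ennreal_plus[symmetric] ennreal_mult[symmetric] add_nonneg_nonneg mult_nonneg_nonneg zero_le_numeral less_imp_le divide_nonneg_pos)
    finally show ?thesis by (simp add: xy)
  qed
  define K where "K = Q1 + (d - c) * K1"
  have ET: "(\<integral>\<^sup>+\<omega>. ennreal (T n \<omega>) \<partial>M) \<le> ennreal K" for n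
  proof -
    have "(\<integral>\<^sup>+\<omega>. ennreal (exp (\<theta> * (Y c \<omega>)\<^sup>2)) \<partial>M) \<le> (\<integral>\<^sup>+\<omega>. ennreal (exp (p * \<theta> * (Y c \<omega>)\<^sup>2)) \<partial>M)"
    proof (intro nn_integral_mono ennreal_leI)
      fix \<omega>
      have "1 * (\<theta> * (Y c \<omega>)\<^sup>2) \<le> p * (\<theta> * (Y c \<omega>)\<^sup>2)" using p \<theta> by (intro mult_right_mono) auto
      then show "exp (\<theta> * (Y c \<omega>)\<^sup>2) \<le> exp (p * \<theta> * (Y c \<omega>)\<^sup>2)" by (simp add: mult.assoc)
    qed
    also have "\<dots> \<le> ennreal Q1"
      unfolding Q1_def using ptv p \<theta> v[of c] Y[of c] \<open>c < d\<close> by (intro cgauss_exp_square_le[OF cgauss_cov]) auto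
    finally have 0: "(\<integral>\<^sup>+\<omega>. ennreal (exp (\<theta> * (Y c \<omega>)\<^sup>2)) \<partial>M) \<le> ennreal Q1" .
    have mi: "(\<lambda>\<omega>. ennreal \<bar>exp (\<theta> * (Y (g n (Suc i)) \<omega>)\<^sup>2) - exp (\<theta> * (Y (g n i) \<omega>)\<^sup>2)\<bar>) \<in> borel_measurable M" if "i < Suc n" for i
    proof -
      have [measurable]: "Y (g n (Suc i)) \<in> borel_measurable M" "Y (g n i) \<in> borel_measurable M"
        by (rule mY, rule g, use that in simp)+
      show ?thesis by measurable
    qed
    have "(\<integral>\<^sup>+\<omega>. ennreal (T n \<omega>) \<partial>M) = (\<integral>\<^sup>+\<omega>. ennreal (exp (\<theta> * (Y c \<omega>)\<^sup>2)) + 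
       (\<Sum>i<Suc n. ennreal \<bar>exp (\<theta> * (Y (g n (Suc i)) \<omega>)\<^sup>2) - exp (\<theta> * (Y (g n i) \<omega>)\<^sup>2)\<bar>) \<partial>M)"
      unfolding T_def by (intro nn_integral_cong) (simp add: ennreal_plus sum_nonneg sum_ennreal del: sum.lessThan_Suc)
    also have "\<dots> = (\<integral>\<^sup>+\<omega>. ennreal (exp (\<theta> * (Y c \<omega>)\<^sup>2)) \<partial>M) +
       (\<Sum>i<Suc n. \<integral>\<^sup>+\<omega>. ennreal \<bar>exp (\<theta> * (Y (g n (Suc i)) \<omega>)\<^sup>2) - exp (\<theta> * (Y (g n i) \<omega>)\<^sup>2)\<bar> \<partial>M)"
    proof (subst nn_integral_add)
      show "(\<lambda>\<omega>. \<Sum>i<Suc n. ennreal \<bar>exp (\<theta> * (Y (g n (Suc i)) \<omega>)\<^sup>2) - exp (\<theta> * (Y (g n i) \<omega>)\<^sup>2)\<bar>) \<in> borel_measurable M"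
        by (intro borel_measurable_sum mi) simp
    qed (simp, subst nn_integral_sum, rule mi, simp, rule refl)
    also have "\<dots> \<le> ennreal Q1 + (\<Sum>i<Suc n. ennreal (h n * K1))"
      by (intro add_mono sum_mono 0 inc) auto
    also have "\<dots> = ennreal (Q1 + real (Suc n) * (h n * K1))"
      using h[of n] K1 Q by (subst sum_ennreal) (auto simp: ennreal_plus)
    also have "real (Suc n) * (h n * K1) = (d - c) * K1" by (simp add: h_def)
    finally show ?thesis by (simp add: K_def)
  qed
  \<comment> \<open>Fatou's lemma bounds the expectation of \<open>L\<close>, and by path continuity
    \<open>L\<close> dominates the exponential at every time of the interval.\<close>
  define L where "L \<omega> = liminf (\<lambda>n. ennreal (T n \<omega>))" for \<omega>
  have [measurable]: "L \<in> borel_measurable M" unfolding L_def[abs_def] by measurable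
  have EL: "(\<integral>\<^sup>+\<omega>. L \<omega> \<partial>M) \<le> ennreal K"
  proof -
    have "(\<integral>\<^sup>+\<omega>. L \<omega> \<partial>M) \<le> liminf (\<lambda>n. \<integral>\<^sup>+\<omega>. ennreal (T n \<omega>) \<partial>M)"
      unfolding L_def by (rule nn_integral_liminf) measurable
    also have "\<dots> \<le> liminf (\<lambda>n. ennreal K)" by (intro Liminf_mono) (simp add: ET)
    finally show ?thesis by (simp add: Liminf_const)
  qed
  have K: "0 \<le> K" using Q K1 \<open>c < d\<close> by (simp add: K_def)
  have tele: "exp (\<theta> * (Y (g n j) \<omega>)\<^sup>2) \<le> T n \<omega>" if "j \<le> Suc n" for n j \<omega>
  proof -
    have "exp (\<theta> * (Y (g n j) \<omega>)\<^sup>2) \<le> exp (\<theta> * (Y c \<omega>)\<^sup>2) + (\<Sum>i<j. \<bar>exp (\<theta> * (Y (g n (Suc i)) \<omega>)\<^sup>2) - exp (\<theta> * (Y (g n i) \<omega>)\<^sup>2)\<bar>)"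
    proof (induction j)
      case 0 then show ?case by (simp add: g_def)
    next
      case (Suc j) then show ?case by simp
    qed
    also have "\<dots> \<le> T n \<omega>" unfolding T_def using that by (intro add_left_mono sum_mono2) auto
    finally show ?thesis .
  qed
  have key: "ennreal (exp (\<theta> * (Y t \<omega>)\<^sup>2)) \<le> L \<omega>" if t: "t \<in> {c..d}" and co: "continuous_on {c..d} (\<lambda>t. Y t \<omega>)" for t \<omega>
  proof -
    define j where "j n = nat \<lfloor>(t - c) / h n\<rfloor>" for n
    have jn: "real (j n) * h n \<le> t - c" "t - c < real (j n) * h n + h n" for n
    proof -
      have "0 \<le> (t - c) / h n" using t h[of n] by simp
      then have "real (j n) = of_int \<lfloor>(t - c) / h n\<rfloor>" unfolding j_def by simp
      then have "real (j n) \<le> (t - c) / h n" "(t - c) / h n < real (j n) + 1" by linarith+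
      then show "real (j n) * h n \<le> t - c" "t - c < real (j n) * h n + h n"
        using h[of n] by (auto simp: field_simps)
    qed
    have j: "j n \<le> Suc n" for n
    proof (rule ccontr)
      assume "\<not> j n \<le> Suc n"
      then have "real (Suc n) * h n < real (j n) * h n" using h[of n] by (intro mult_strict_right_mono) auto
      also have "\<dots> \<le> t - c" by (rule jn)
      finally show False using t by (simp add: h_def)
    qed
    have gj: "t - h n \<le> g n (j n)" "g n (j n) \<le> t" for n
      using jn[of n] unfolding g_def by linarith+
    have hl: "h \<longlonglongrightarrow> 0"
      unfolding h_def[abs_def] by (intro LIMSEQ_Suc lim_const_over_n)
    have "(\<lambda>n. g n (j n)) \<longlonglongrightarrow> t"
    proof (rule tendsto_sandwich)
      show "(\<lambda>n. t - h n) \<longlonglongrightarrow> t" using tendsto_diff[OF tendsto_const hl, of t] by simp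
      show "\<forall>\<^sub>F n in sequentially. t - h n \<le> g n (j n)" "\<forall>\<^sub>F n in sequentially. g n (j n) \<le> t"
        using gj by (simp_all add: always_eventually)
    qed auto
    then have "(\<lambda>n. Y (g n (j n)) \<omega>) \<longlonglongrightarrow> Y t \<omega>"
      using t g[OF j] by (intro continuous_on_tendsto_compose[OF co]) auto
    then have "(\<lambda>n. ennreal (exp (\<theta> * (Y (g n (j n)) \<omega>)\<^sup>2))) \<longlonglongrightarrow> ennreal (exp (\<theta> * (Y t \<omega>)\<^sup>2))"
      by (intro tendsto_intros)
    then have "ennreal (exp (\<theta> * (Y t \<omega>)\<^sup>2)) = liminf (\<lambda>n. ennreal (exp (\<theta> * (Y (g n (j n)) \<omega>)\<^sup>2)))"
      by (rule lim_imp_Liminf[OF sequentially_bot, symmetric])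
    also have "\<dots> \<le> L \<omega>" unfolding L_def by (intro Liminf_mono always_eventually allI ennreal_leI tele j)
    finally show ?thesis .
  qed
  show ?thesis
  proof (intro exI conjI allI impI)
    show "0 \<le> K" "0 < \<kappa>" by fact+
    fix u :: real assume u: "0 \<le> u"
    \<comment> \<open>Markov's inequality for \<open>L\<close>; since
      \<open>\<theta> = (1 + \<kappa>) / (2 * S)\<close>, it gives the exponent claimed.\<close>
    define F where "F = {\<omega>\<in>space M. ennreal (exp (\<theta> * u\<^sup>2)) \<le> L \<omega>}"
    have [measurable]: "F \<in> sets M" unfolding F_def by measurable
    have "ennreal (exp (\<theta> * u\<^sup>2)) * emeasure M F = (\<integral>\<^sup>+\<omega>. ennreal (exp (\<theta> * u\<^sup>2)) * indicator F \<omega> \<partial>M)"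
      by (subst nn_integral_cmult_indicator) auto
    also have "\<dots> \<le> (\<integral>\<^sup>+\<omega>. L \<omega> \<partial>M)"
      by (intro nn_integral_mono) (auto simp: F_def indicator_def)
    also have "\<dots> \<le> ennreal K" by (rule EL)
    finally have "exp (\<theta> * u\<^sup>2) * prob F \<le> K"
      using K by (simp add: emeasure_eq_measure ennreal_mult[symmetric])
    then have "prob F \<le> K * exp (- (\<theta> * u\<^sup>2))" by (simp add: exp_minus field_simps)
    then have pF: "prob F \<le> K * exp (- ((1 + \<kappa>) * u\<^sup>2 / (2 * S)))" by (simp add: \<theta>_def p_def)
    have "AE \<omega> in M. (\<exists>t\<in>{c..d}. u \<le> \<bar>Y t \<omega>\<bar>) \<longrightarrow> \<omega> \<in> F"
      using cont AE_space
    proof eventually_elim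
      case (elim \<omega>)
      show ?case
      proof
        assume "\<exists>t\<in>{c..d}. u \<le> \<bar>Y t \<omega>\<bar>"
        then obtain t where t: "t \<in> {c..d}" "u \<le> \<bar>Y t \<omega>\<bar>" by auto
        have "u\<^sup>2 \<le> (Y t \<omega>)\<^sup>2" using u t power_mono[of u "\<bar>Y t \<omega>\<bar>" 2] by simp
        then have "ennreal (exp (\<theta> * u\<^sup>2)) \<le> ennreal (exp (\<theta> * (Y t \<omega>)\<^sup>2))"
          using \<theta> by (intro ennreal_leI) simp
        also have "\<dots> \<le> L \<omega>" using t elim by (intro key) auto
        finally show "\<omega> \<in> F" using elim by (simp add: F_def)
      qed
    qed
    with pF show "\<exists>F\<in>sets M. prob F \<le> K * exp (- ((1 + \<kappa>) * u\<^sup>2 / (2 * S))) \<and>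
      (AE \<omega> in M. (\<exists>t\<in>{c..d}. u \<le> \<bar>Y t \<omega>\<bar>) \<longrightarrow> \<omega> \<in> F)" by (intro bexI[of _ F]) auto
  qed
qed

section \<open>Up-crossings of smooth functions\<close>

lemma first_and_last_time:
  fixes k :: "real \<Rightarrow> real"
  assumes k: "continuous_on {p..r} k" and "closed S" and x: "x \<in> {p..r}" "k x \<in> S"
  shows "\<exists>v\<in>{p..r}. k v \<in> S \<and> (\<forall>w\<in>{p..r}. k w \<in> S \<longrightarrow> v \<le> w)"
    and "\<exists>v\<in>{p..r}. k v \<in> S \<and> (\<forall>w\<in>{p..r}. k w \<in> S \<longrightarrow> w \<le> v)"
proof -
  let ?A = "{p..r} \<inter> k -` S"
  have A: "compact ?A"
    using compact_Int_closed[OF compact_Icc continuous_closed_preimage[OF k closed_real_atLeastAtMost \<open>closed S\<close>], of p r]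
    by (simp add: Int_assoc[symmetric])
  have ne: "?A \<noteq> {}" using x by auto
  obtain v where "v \<in> ?A" "\<forall>w\<in>?A. v \<le> w" using compact_attains_inf[OF A ne] by blast
  then show "\<exists>v\<in>{p..r}. k v \<in> S \<and> (\<forall>w\<in>{p..r}. k w \<in> S \<longrightarrow> v \<le> w)" by (intro bexI[of _ v]) auto
  obtain v where "v \<in> ?A" "\<forall>w\<in>?A. w \<le> v" using compact_attains_sup[OF A ne] by blast
  then show "\<exists>v\<in>{p..r}. k v \<in> S \<and> (\<forall>w\<in>{p..r}. k w \<in> S \<longrightarrow> w \<le> v)" by (intro bexI[of _ v]) auto
qed

text \<open>\<open>v1\<close> is the first time with \<open>k\<close> at least 1, and
  \<open>v0\<close> the last time before \<open>v1\<close> with \<open>k\<close> at most 0.\<close>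

lemma crossing_unit_interval:
  fixes k :: "real \<Rightarrow> real"
  assumes "p \<le> r" and k: "continuous_on {p..r} k" and "k p \<le> 0" "1 \<le> k r"
  shows "\<exists>v0 v1. p \<le> v0 \<and> v0 < v1 \<and> v1 \<le> r \<and> k v0 = 0 \<and> k v1 = 1 \<and> (\<forall>v\<in>{v0..v1}. 0 \<le> k v \<and> k v \<le> 1)"
proof -
  obtain v1 where v1: "v1 \<in> {p..r}" "1 \<le> k v1" and v1m: "\<And>v. v \<in> {p..r} \<Longrightarrow> 1 \<le> k v \<Longrightarrow> v1 \<le> v"
    using first_and_last_time(1)[OF k closed_atLeast[of 1], of r] assms by auto
  have k1: "continuous_on {p..v1} k" using k by (rule continuous_on_subset) (use v1 in auto)
  have kv1: "k v1 = 1"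
  proof -
    obtain w where w: "p \<le> w" "w \<le> v1" "k w = 1" using IVT'[of k p 1 v1] k1 v1 assms by auto
    then have "v1 \<le> w" using v1 by (intro v1m) auto
    then show ?thesis using w by simp
  qed
  obtain v0 where v0: "v0 \<in> {p..v1}" "k v0 \<le> 0" and v0m: "\<And>v. v \<in> {p..v1} \<Longrightarrow> k v \<le> 0 \<Longrightarrow> v \<le> v0"
    using first_and_last_time(2)[OF k1 closed_atMost[of 0], of p] assms v1 by auto
  have kv0: "k v0 = 0"
  proof -
    have "continuous_on {v0..v1} k" using k1 by (rule continuous_on_subset) (use v0 in auto)
    then obtain w where w: "v0 \<le> w" "w \<le> v1" "k w = 0" using IVT'[of k v0 0 v1] v0 kv1 by auto
    then have "w \<le> v0" using v0 by (intro v0m) auto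
    then show ?thesis using w by simp
  qed
  have "v0 \<noteq> v1" using kv0 kv1 by auto
  moreover have "0 \<le> k v \<and> k v \<le> 1" if v: "v \<in> {v0..v1}" for v
  proof
    show "0 \<le> k v"
    proof (rule ccontr)
      assume "\<not> 0 \<le> k v"
      then have "v \<le> v0" using v v0 by (intro v0m) auto
      then show False using v kv0 \<open>\<not> 0 \<le> k v\<close> by auto
    qed
    show "k v \<le> 1"
    proof (rule ccontr)
      assume "\<not> k v \<le> 1"
      then have "v1 \<le> v" using v v0 v1 by (intro v1m) auto
      then show False using v kv1 \<open>\<not> k v \<le> 1\<close> by auto
    qed
  qed
  ultimately show ?thesis using v0 v1 kv0 kv1 by (intro exI[of _ v0] exI[of _ v1]) auto
qed

text \<open>The fundamental theorem of calculus, with the integrand replaced by its positive part.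
  Continuity of \<open>g\<close> is one reason for asking that the second derivative be
  continuous.\<close>

lemma increment_le_nn_integral:
  fixes g G :: "real \<Rightarrow> real" and E :: "real \<Rightarrow> real"
  assumes "p \<le> r" and G: "\<And>v. v \<in> {p..r} \<Longrightarrow> (G has_real_derivative g v) (at v within {p..r})"
    and g: "continuous_on {p..r} g" and le: "\<And>v. v \<in> {p..r} \<Longrightarrow> g v \<le> E v"
  shows "ennreal (G r - G p) \<le> (\<integral>\<^sup>+v. indicator {p..r} v * ennreal (E v) \<partial>lborel)"
proof -
  have i: "integrable lborel (\<lambda>v. indicator {p..r} v *\<^sub>R g v)"
    using borel_integrable_atLeastAtMost'[OF g] by (simp add: set_integrable_def)
  have "G r - G p = (\<integral>v. indicator {p..r} v *\<^sub>R g v \<partial>lborel)"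
    by (rule integral_FTC_atLeastAtMost[OF \<open>p \<le> r\<close> _ g, symmetric])
      (use G in \<open>auto simp: has_real_derivative_iff_has_vector_derivative\<close>)
  also have "\<dots> \<le> (\<integral>v. max 0 (indicator {p..r} v *\<^sub>R g v) \<partial>lborel)"
    using i by (intro integral_mono) (auto intro: Bochner_Integration.integrable_max)
  finally have "ennreal (G r - G p) \<le> ennreal (\<integral>v. max 0 (indicator {p..r} v *\<^sub>R g v) \<partial>lborel)"
    by (rule ennreal_leI)
  also have "\<dots> = (\<integral>\<^sup>+v. ennreal (max 0 (indicator {p..r} v *\<^sub>R g v)) \<partial>lborel)"
    using i by (intro nn_integral_eq_integral[symmetric]) (auto intro: Bochner_Integration.integrable_max)
  also have "\<dots> \<le> (\<integral>\<^sup>+v. indicator {p..r} v * ennreal (E v) \<partial>lborel)"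
  proof (rule nn_integral_mono)
    fix v
    show "ennreal (max 0 (indicator {p..r} v *\<^sub>R g v)) \<le> indicator {p..r} v * ennreal (E v)"
      using le[of v] by (cases "v \<in> {p..r}") (auto simp: max_def ennreal_leI)
  qed
  finally show ?thesis .
qed

text \<open>The arguments \<open>x\<close>, \<open>y\<close>, \<open>z\<close> stand for the
  function and its first two derivatives. The first summand detects excursions that stay above
  \<open>(1 - \<eta>) * u\<close>, the second the deeper ones, which within length \<open>h\<close>
  must climb with slope at least \<open>\<eta> * u / (2 * h)\<close> somewhere. The factors 2 make
  the integral over one excursion at least 1.\<close>

definition excess :: "real \<Rightarrow> real \<Rightarrow> real \<Rightarrow> real \<Rightarrow> real \<Rightarrow> real \<Rightarrow> real" where
  "excess \<eta> h u x y z =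
     (if (1 - \<eta>) * u \<le> x \<and> x < u \<and> 0 \<le> y \<and> y \<le> u - x then 2 * max 0 z / (u - x) else 0) +
     (if \<eta> * u / (2 * h) \<le> y then 2 * y / (\<eta> * u) else 0)"

lemma measurable_excess [measurable]:
  assumes [measurable]: "x \<in> borel_measurable N" "y \<in> borel_measurable N" "z \<in> borel_measurable N"
  shows "(\<lambda>\<omega>. excess \<eta> h u (x \<omega>) (y \<omega>) (z \<omega>)) \<in> borel_measurable N"
  unfolding excess_def by measurable

locale C2_function =
  fixes a b :: real and f f1 f2 :: "real \<Rightarrow> real"
  assumes D1: "\<And>t. t \<in> {a..b} \<Longrightarrow> (f has_real_derivative f1 t) (at t within {a..b})"
    and D2: "\<And>t. t \<in> {a..b} \<Longrightarrow> (f1 has_real_derivative f2 t) (at t within {a..b})"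
    and cont2: "continuous_on {a..b} f2"
    and measurable_f [measurable]: "f \<in> borel_measurable borel" "f1 \<in> borel_measurable borel" "f2 \<in> borel_measurable borel"
begin

lemma cont1: "continuous_on {a..b} f1" and cont0: "continuous_on {a..b} f"
  using D1 D2 by (meson DERIV_continuous_on)+

text \<open>An up-crossing at \<open>s\<close> that is preceded by a value \<open>\<ge> u\<close> ends an excursion below \<open>u\<close>, whose minimum is
  at some \<open>p\<close>. The slope \<open>k = f' / (u - f)\<close> vanishes at \<open>p\<close>, blows up at \<open>s\<close>, and \<open>k' = f'' / (u - f) + k\<^sup>2\<close>;
  so either \<open>f''\<close> must be positive while \<open>0 \<le> k \<le> 1\<close>, or the excursion is deep and \<open>f'\<close> is large.\<close>

lemma excursion:
  assumes h: "b - a \<le> h" "0 < h" "h \<le> 1 / 2" and \<eta>: "0 < \<eta>" and u: "0 < u"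
    and t: "a \<le> t" "t < s" "s \<le> b" "u \<le> f t" and s: "f s = u" "0 < f1 s"
  shows "\<exists>p. a \<le> p \<and> p < s \<and> (\<forall>v\<in>{p..<s}. f v < u) \<and>
    1 \<le> (\<integral>\<^sup>+v. indicator {p..<s} v * ennreal (excess \<eta> h u (f v) (f1 v) (f2 v)) \<partial>lborel)"
proof -
  define E where "E v = excess \<eta> h u (f v) (f1 v) (f2 v)" for v
  have E0: "0 \<le> E v" for v using h \<eta> u unfolding E_def excess_def
    by (smt (verit, best) divide_nonneg_nonneg mult_nonneg_nonneg mult_pos_pos max.cobounded1 zero_le_divide_iff)
  obtain \<gamma> where \<gamma>: "0 < \<gamma>" "\<And>d. 0 < d \<Longrightarrow> s - d \<in> {a..b} \<Longrightarrow> d < \<gamma> \<Longrightarrow> f (s - d) < f s"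
    using has_real_derivative_pos_inc_left[OF D1[of s] s(2)] t by auto
  \<comment> \<open>The search for the last value at least \<open>u\<close> stops short of
    \<open>s\<close>, where \<open>f\<close> equals \<open>u\<close> itself; between
    \<open>s'\<close> and \<open>s\<close> the positive slope at \<open>s\<close> keeps
    \<open>f\<close> below \<open>u\<close>.\<close>
  define s' where "s' = max t (s - \<gamma> / 2)"
  have s': "t \<le> s'" "s' < s" "s - \<gamma> / 2 \<le> s'" using t \<gamma> by (auto simp: s'_def)
  have ct: "continuous_on {t..s'} f" using cont0 by (rule continuous_on_subset) (use t s' in auto)
  obtain q where q: "t \<le> q" "q \<le> s'" "u \<le> f q" and qm: "\<And>v. v \<in> {t..s'} \<Longrightarrow> u \<le> f v \<Longrightarrow> v \<le> q"
    using first_and_last_time(2)[OF ct closed_atLeast[of u], of t] t s' by auto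
  have below: "f v < u" if "v \<in> {q<..<s}" for v
  proof (cases "v \<le> s'")
    case True then show ?thesis using qm[of v] that q by force
  next
    case False
    then show ?thesis using \<gamma>(2)[of "s - v"] \<gamma>(1) that s s' t q by auto
  qed
  have cq: "continuous_on {q..s} f" using cont0 by (rule continuous_on_subset) (use t q in auto)
  obtain p where p: "p \<in> {q..s}" and pm: "\<And>v. v \<in> {q..s} \<Longrightarrow> f p \<le> f v"
    using continuous_attains_inf[OF _ _ cq] q s' by fastforce
  have "f p \<le> f ((q + s) / 2)" using q s' by (intro pm) auto
  also have "\<dots> < u" using q s' by (intro below) auto
  finally have fp: "f p < u" .
  then have p: "q < p" "p < s" using p q s by (auto simp: less_le)
  have "(f has_real_derivative f1 p) (at p)"
    using D1[of p] p q t s' by (simp add: at_within_Icc_at)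
  then have f1p: "f1 p = 0"
  proof (rule DERIV_local_min[where d="min (p - q) (s - p)"])
    show "\<forall>y. \<bar>p - y\<bar> < min (p - q) (s - p) \<longrightarrow> f p \<le> f y" by (auto intro!: pm)
  qed (use p in auto)
  have ap: "a \<le> p" "p < b" using p q t s' by auto
  have belowp: "\<forall>v\<in>{p..<s}. f v < u" using below p by auto
  have "1 \<le> (\<integral>\<^sup>+v. indicator {p..<s} v * ennreal (E v) \<partial>lborel)"
  proof (cases "f p < (1 - \<eta>) * u")
    case True
    \<comment> \<open>A deep excursion: \<open>f\<close> climbs by more than
      \<open>\<eta> * u\<close> from \<open>p\<close> to \<open>s\<close>, and slopes up to
      \<open>w\<close> account for at most half of it, as
      \<open>w * h = \<eta> * u / 2\<close>.\<close>
    define w where "w = \<eta> * u / (2 * h)"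
    have w: "0 < w" "w * h = \<eta> * u / 2" using h \<eta> u by (auto simp: w_def)
    have "w * (s - p) \<le> w * h" using w p q t s' h by (intro mult_left_mono) auto
    then have "\<eta> * u / 2 \<le> (f s - w * s) - (f p - w * p)"
      using True s w by (simp add: algebra_simps)
    then have "ennreal (\<eta> * u / 2) \<le> ennreal ((f s - w * s) - (f p - w * p))" by (rule ennreal_leI)
    also have "\<dots> \<le> (\<integral>\<^sup>+v. indicator {p..s} v * ennreal (\<eta> * u / 2 * E v) \<partial>lborel)"
    proof (rule increment_le_nn_integral[where g="\<lambda>v. f1 v - w"])
      show "p \<le> s" using p by simp
      have sub: "{p..s} \<subseteq> {a..b}" using ap t by auto
      show "((\<lambda>v. f v - w * v) has_real_derivative f1 v - w) (at v within {p..s})" if "v \<in> {p..s}" for v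
        using DERIV_subset[OF D1 sub, of v] that sub by (auto intro!: derivative_eq_intros)
      show "continuous_on {p..s} (\<lambda>v. f1 v - w)"
        using continuous_on_subset[OF cont1 sub] by (intro continuous_intros)
      show "f1 v - w \<le> \<eta> * u / 2 * E v" if "v \<in> {p..s}" for v
      proof (cases "w \<le> f1 v")
        case True
        then have "2 * f1 v / (\<eta> * u) \<le> E v"
          using \<eta> u unfolding E_def excess_def w_def[symmetric] by simp
        then have "f1 v \<le> \<eta> * u / 2 * E v" using \<eta> u by (simp add: field_simps)
        then show ?thesis using w by simp
      next
        case False
        moreover have "0 \<le> \<eta> * u / 2 * E v" using E0[of v] \<eta> u by (intro mult_nonneg_nonneg) auto
        ultimately show ?thesis by linarith
      qed
    qed
    also have "\<dots> = (\<integral>\<^sup>+v. ennreal (\<eta> * u / 2) * (indicator {p..<s} v * ennreal (E v)) \<partial>lborel)"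
      using AE_lborel_singleton[of s]
      by (intro nn_integral_cong_AE, eventually_elim) (use E0 \<eta> u in \<open>auto simp: indicator_def ennreal_mult[symmetric]\<close>)
    also have "\<dots> = ennreal (\<eta> * u / 2) * (\<integral>\<^sup>+v. indicator {p..<s} v * ennreal (E v) \<partial>lborel)"
      by (rule nn_integral_cmult) (simp add: E_def)
    finally have "ennreal (2 / (\<eta> * u)) * ennreal (\<eta> * u / 2) \<le> ennreal (2 / (\<eta> * u)) * (ennreal (\<eta> * u / 2) * (\<integral>\<^sup>+v. indicator {p..<s} v * ennreal (E v) \<partial>lborel))"
      by (rule mult_left_mono) simp
    then show ?thesis using \<eta> u by (simp add: mult.assoc[symmetric] ennreal_mult[symmetric])
  next
    case False
    have sub: "{p..s} \<subseteq> {a..b}" using ap t by auto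
    \<comment> \<open>Where \<open>f < u\<close>, the inequality \<open>k \<ge> 1\<close> means
      \<open>f1 + f - u \<ge> 0\<close>. This form has no pole at \<open>s\<close>, and its limit
      there is \<open>f1 s > 0\<close>.\<close>
    have "((\<lambda>v. f1 v + f v - u) \<longlongrightarrow> f1 s + f s - u) (at s within {p..s})"
      using continuous_on_subset[OF cont1 sub] continuous_on_subset[OF cont0 sub] p
      by (intro tendsto_intros) (auto simp: continuous_on_def)
    then have "\<forall>\<^sub>F v in at s within {p..s}. 0 < f1 v + f v - u"
      by (rule order_tendstoD) (use s in simp)
    then obtain d where d: "0 < d" "\<And>v. v \<in> {p..s} \<Longrightarrow> v \<noteq> s \<Longrightarrow> dist v s < d \<Longrightarrow> 0 < f1 v + f v - u"
      by (auto simp: eventually_at)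
    define r where "r = max p (s - d / 2)"
    have r: "p \<le> r" "r < s" using p d by (auto simp: r_def)
    have "0 < f1 r + f r - u" using r d by (intro d(2)) (auto simp: dist_real_def r_def)
    moreover have "f r < u" using r belowp by auto
    ultimately have kr: "1 \<le> f1 r / (u - f r)" by (simp add: field_simps)
    have subr: "{p..r} \<subseteq> {a..b}" using ap t r by auto
    have ur: "0 < u - f v" if "v \<in> {p..r}" for v using belowp r that by auto
    define k where "k v = f1 v / (u - f v)" for v
    have "continuous_on {p..r} k" unfolding k_def
      using continuous_on_subset[OF cont1 subr] continuous_on_subset[OF cont0 subr] ur
      by (intro continuous_intros) force+
    then obtain v0 v1 where v: "p \<le> v0" "v0 < v1" "v1 \<le> r" "k v0 = 0" "k v1 = 1"
      and k01: "\<And>v. v \<in> {v0..v1} \<Longrightarrow> 0 \<le> k v \<and> k v \<le> 1"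
      using crossing_unit_interval[of p r k] r kr f1p by (auto simp: k_def)
    have subv: "{v0..v1} \<subseteq> {a..b}" using v subr by auto
    have uv: "0 < u - f x" if "x \<in> {v0..v1}" for x using ur that v by auto
    \<comment> \<open>\<open>k\<close> gains 1 over a length of at most \<open>1 / 2\<close>.
      Subtracting the identity absorbs the term \<open>(k x)\<^sup>2 \<le> 1\<close> of the
      derivative, so that \<open>f2 / (u - f)\<close> alone has to produce the remaining
      \<open>1 / 2\<close>.\<close>
    have "ennreal (1 / 2) \<le> ennreal ((k v1 - v1) - (k v0 - v0))"
      using v r t ap h by (intro ennreal_leI) auto
    also have "\<dots> \<le> (\<integral>\<^sup>+x. indicator {v0..v1} x * ennreal (E x / 2) \<partial>lborel)"
    proof (rule increment_le_nn_integral[where g="\<lambda>x. f2 x / (u - f x) + (k x)\<^sup>2 - 1"])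
      show "v0 \<le> v1" using v by simp
      show "((\<lambda>x. k x - x) has_real_derivative f2 x / (u - f x) + (k x)\<^sup>2 - 1) (at x within {v0..v1})" if x: "x \<in> {v0..v1}" for x
      proof -
        have "((\<lambda>x. k x - x) has_real_derivative (f2 x * (u - f x) - f1 x * (0 - f1 x)) / ((u - f x) * (u - f x)) - 1) (at x within {v0..v1})"
          unfolding k_def using DERIV_subset[OF D1 subv, of x] DERIV_subset[OF D2 subv, of x] x subv uv[OF x]
          by (intro DERIV_diff DERIV_divide DERIV_const DERIV_ident) auto
        moreover have "(f2 x * (u - f x) - f1 x * (0 - f1 x)) / ((u - f x) * (u - f x)) - 1 = f2 x / (u - f x) + (k x)\<^sup>2 - 1"
          using uv[OF x] by (simp add: k_def power2_eq_square add_divide_distrib)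
        ultimately show ?thesis by simp
      qed
      show "continuous_on {v0..v1} (\<lambda>x. f2 x / (u - f x) + (k x)\<^sup>2 - 1)" unfolding k_def
        using continuous_on_subset[OF cont1 subv] continuous_on_subset[OF cont0 subv] continuous_on_subset[OF cont2 subv] uv
        by (intro continuous_intros) force+
      show "f2 x / (u - f x) + (k x)\<^sup>2 - 1 \<le> E x / 2" if x: "x \<in> {v0..v1}" for x
      proof -
        have "(k x)\<^sup>2 \<le> 1" using k01[OF x] by (simp add: power_le_one)
        moreover have "f2 x / (u - f x) \<le> max 0 (f2 x) / (u - f x)"
          using uv[OF x] by (intro divide_right_mono) auto
        moreover have "2 * max 0 (f2 x) / (u - f x) \<le> E x"
        proof -
          have "(1 - \<eta>) * u \<le> f x" using False pm[of x] x v r p by force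
          moreover have "0 \<le> f1 x" "f1 x \<le> u - f x" using k01[OF x] uv[OF x] by (auto simp: k_def field_simps zero_le_divide_iff)
          ultimately show ?thesis using uv[OF x] h \<eta> u unfolding E_def excess_def
            by (auto intro!: add_nonneg_nonneg divide_nonneg_nonneg)
        qed
        ultimately show ?thesis by linarith
      qed
    qed
    also have "\<dots> \<le> (\<integral>\<^sup>+x. ennreal (1 / 2) * (indicator {p..<s} x * ennreal (E x)) \<partial>lborel)"
    proof (rule nn_integral_mono)
      fix x
      have "ennreal (E x / 2) = ennreal (1 / 2) * ennreal (E x)"
        using E0[of x] by (subst ennreal_mult[symmetric]) auto
      then show "indicator {v0..v1} x * ennreal (E x / 2) \<le> ennreal (1 / 2) * (indicator {p..<s} x * ennreal (E x))"
        using v r by (simp add: indicator_def)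
    qed
    also have "\<dots> = ennreal (1 / 2) * (\<integral>\<^sup>+v. indicator {p..<s} v * ennreal (E v) \<partial>lborel)"
      by (rule nn_integral_cmult) (simp add: E_def)
    finally have "ennreal 2 * ennreal (1 / 2) \<le> ennreal 2 * (ennreal (1 / 2) * (\<integral>\<^sup>+v. indicator {p..<s} v * ennreal (E v) \<partial>lborel))"
      by (rule mult_left_mono) simp
    moreover have "ennreal 2 * ennreal (1 / 2) = 1" by (subst ennreal_mult[symmetric]) auto
    ultimately show ?thesis by (simp only: mult.assoc[symmetric] mult_1_left)
  qed
  then show ?thesis using ap p belowp unfolding E_def by auto
qed

text \<open>Each of these up-crossings ends its own excursion below \<open>u\<close>. No excursion
  contains another up-crossing, because \<open>f = u\<close> there, so the intervals are disjoint
  and their contributions of at least 1 add up.\<close>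

lemma finite_upcrossings_le:
  assumes h: "b - a \<le> h" "0 < h" "h \<le> 1 / 2" and \<eta>: "0 < \<eta>" and u: "0 < u"
    and F: "finite F" "\<And>s. s \<in> F \<Longrightarrow> s \<in> {a..b} \<and> f s = u \<and> 0 < f1 s \<and> (\<exists>t\<in>{a..<s}. u \<le> f t)"
  shows "of_nat (card F) \<le> (\<integral>\<^sup>+v. indicator {a..b} v * ennreal (excess \<eta> h u (f v) (f1 v) (f2 v)) \<partial>lborel)"
proof -
  define E where "E v = ennreal (excess \<eta> h u (f v) (f1 v) (f2 v))" for v
  have [measurable]: "E \<in> borel_measurable borel" unfolding E_def[abs_def] by measurable
  have "\<exists>p. a \<le> p \<and> p < s \<and> (\<forall>v\<in>{p..<s}. f v < u) \<and> 1 \<le> (\<integral>\<^sup>+v. indicator {p..<s} v * E v \<partial>lborel)" if "s \<in> F" for s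
    using F(2)[OF that] excursion[OF h \<eta> u, of _ s] unfolding E_def by fastforce
  then obtain p where p: "\<And>s. s \<in> F \<Longrightarrow> a \<le> p s \<and> p s < s \<and> (\<forall>v\<in>{p s..<s}. f v < u) \<and> 1 \<le> (\<integral>\<^sup>+v. indicator {p s..<s} v * E v \<partial>lborel)"
    by metis
  have sep: "s < p s'" if "s \<in> F" "s' \<in> F" "s < s'" for s s'
  proof (rule ccontr)
    assume "\<not> s < p s'"
    then have "f s < u" using p[OF that(2)] that by auto
    then show False using F(2)[OF that(1)] by simp
  qed
  have dis: "disjoint_family_on (\<lambda>s. {p s..<s}) F"
    unfolding disjoint_family_on_def
  proof (intro ballI impI)
    fix s s' assume "s \<in> F" "s' \<in> F" "s \<noteq> s'"
    then show "{p s..<s} \<inter> {p s'..<s'} = {}" using sep[of s s'] sep[of s' s] by (cases "s < s'") auto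
  qed
  have "of_nat (card F) = (\<Sum>s\<in>F. (1::ennreal))" by simp
  also have "\<dots> \<le> (\<Sum>s\<in>F. \<integral>\<^sup>+v. indicator {p s..<s} v * E v \<partial>lborel)"
    using p by (intro sum_mono) blast
  also have "\<dots> = (\<integral>\<^sup>+v. (\<Sum>s\<in>F. indicator {p s..<s} v * E v) \<partial>lborel)"
    by (rule nn_integral_sum[symmetric]) simp
  also have "\<dots> = (\<integral>\<^sup>+v. indicator (\<Union>s\<in>F. {p s..<s}) v * E v \<partial>lborel)"
    by (simp add: indicator_UN_disjoint[OF F(1) dis] sum_distrib_right)
  also have "\<dots> \<le> (\<integral>\<^sup>+v. indicator {a..b} v * E v \<partial>lborel)"
  proof (intro nn_integral_mono mult_right_mono)
    fix v
    have "(\<Union>s\<in>F. {p s..<s}) \<subseteq> {a..b}" using p F(2) by force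
    then show "indicator (\<Union>s\<in>F. {p s..<s}) v \<le> (indicator {a..b} v :: ennreal)"
      by (cases "v \<in> (\<Union>s\<in>F. {p s..<s})") (simp_all only: subsetD indicator_simps if_True order_refl zero_le not_False_eq_True)
  qed simp
  finally show ?thesis unfolding E_def .
qed

lemma emeasure_count_space_le:
  assumes "\<And>F. finite F \<Longrightarrow> F \<subseteq> U \<Longrightarrow> of_nat (card F) \<le> (c::ennreal)"
  shows "emeasure (count_space UNIV) U \<le> c"
proof (cases "finite U")
  case True
  then show ?thesis using assms[of U] by simp
next
  case False
  have "of_nat n \<le> c" for n
  proof -
    obtain F where "finite F" "card F = n" "F \<subseteq> U" using infinite_arbitrarily_large[OF False] by metis
    then show ?thesis using assms[of F] by simp
  qed
  then have "c = top" by (meson ennreal_Ex_less_of_nat leD top.not_eq_extremum)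
  then show ?thesis by simp
qed

text \<open>Every up-crossing except possibly the first is preceded by a value at least
  \<open>u\<close>. The exception occurs only for a path that starts below \<open>u\<close>, and the
  event of reaching \<open>u\<close> pays for it.\<close>

lemma upcrossings_le:
  assumes h: "b - a \<le> h" "0 < h" "h \<le> 1 / 2" and \<eta>: "0 < \<eta>" and u: "0 < u"
    and U: "U \<subseteq> {s\<in>{a..b}. f s = u \<and> 0 < f1 s}" and fa: "f a \<noteq> u"
  shows "emeasure (count_space UNIV) U \<le> of_bool (f a < u \<and> (\<exists>t\<in>{a..b}. u \<le> f t)) + 
    (\<integral>\<^sup>+v. indicator {a..b} v * ennreal (excess \<eta> h u (f v) (f1 v) (f2 v)) \<partial>lborel)"
proof (rule emeasure_count_space_le)
  fix F assume F: "finite F" "F \<subseteq> U"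
  let ?R = "(\<integral>\<^sup>+v. indicator {a..b} v * ennreal (excess \<eta> h u (f v) (f1 v) (f2 v)) \<partial>lborel)"
  show "of_nat (card F) \<le> of_bool (f a < u \<and> (\<exists>t\<in>{a..b}. u \<le> f t)) + ?R"
  proof (cases "F = {} \<or> u < f a")
    case True
    have "\<exists>t\<in>{a..<s}. u \<le> f t" if "s \<in> F" for s
    proof -
      have "s \<in> {a..b}" "f s = u" using that F U by auto
      then show ?thesis using True fa that by (intro bexI[of _ a]) (auto simp: less_le)
    qed
    then have "of_nat (card F) \<le> ?R"
      using F U by (intro finite_upcrossings_le[OF h \<eta> u]) auto
    then show ?thesis by (simp add: add_increasing)
  next
    case False
    then have "F \<noteq> {}" and fa: "f a < u" using fa by auto
    define m where "m = Min F"
    have m: "m \<in> F" using F \<open>F \<noteq> {}\<close> by (simp add: m_def)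
    have mU: "m \<in> {a..b}" "f m = u" using m F U by auto
    have "\<exists>t\<in>{a..<s}. u \<le> f t" if "s \<in> F - {m}" for s
    proof -
      have "m \<le> s" using that F by (simp add: m_def)
      then show ?thesis using that mU by (intro bexI[of _ m]) auto
    qed
    then have "of_nat (card (F - {m})) \<le> ?R"
      using F U by (intro finite_upcrossings_le[OF h \<eta> u]) auto
    moreover have "card F = Suc (card (F - {m}))" using card_Suc_Diff1[OF F(1) m] by simp
    ultimately show ?thesis using mU fa by (auto simp: indicator_def)
  qed
qed

end

section \<open>Gaussian processes with smooth paths\<close>

text \<open>Evaluation at the time rounded down to a multiple of 1 / (n + 1) is jointly measurable,
  as only countably many times occur, and it converges by continuity. Fubini's theorem for the
  excess integral asks for this.\<close>

lemma measurable_continuous_paths: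
  fixes f :: "real \<Rightarrow> 'a \<Rightarrow> real"
  assumes f: "\<And>t. f t \<in> borel_measurable M"
    and cont: "\<And>\<omega>. \<omega> \<in> space M \<Longrightarrow> continuous_on UNIV (\<lambda>t. f t \<omega>)"
  shows "(\<lambda>z. f (fst z) (snd z)) \<in> borel_measurable (borel \<Otimes>\<^sub>M M)"
proof (rule borel_measurable_LIMSEQ_real)
  define q where "q n t = of_int \<lfloor>real (Suc n) * t\<rfloor> / real (Suc n)" for n t
  show "(\<lambda>z. f (q n (fst z)) (snd z)) \<in> borel_measurable (borel \<Otimes>\<^sub>M M)" for n
  proof -
    have "(\<lambda>z. f (of_int \<lfloor>real (Suc n) * fst z\<rfloor> / real (Suc n)) (snd z)) \<in> borel_measurable (borel \<Otimes>\<^sub>M M)"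
      by (rule measurable_compose_countable[where f="\<lambda>i z. f (of_int i / real (Suc n)) (snd z)" and g="\<lambda>z. \<lfloor>real (Suc n) * fst z\<rfloor>"])
        (use f in measurable)
    then show ?thesis by (simp add: q_def)
  qed
  fix z :: "real \<times> 'a" assume z: "z \<in> space (borel \<Otimes>\<^sub>M M)"
  have "(\<lambda>n. q n (fst z)) \<longlonglongrightarrow> fst z"
  proof (rule tendsto_sandwich)
    have "(\<lambda>n. 1 / real (Suc n)) \<longlonglongrightarrow> 0" by (intro LIMSEQ_Suc lim_const_over_n)
    from tendsto_diff[OF tendsto_const this, of "fst z"] show "(\<lambda>n. fst z - 1 / real (Suc n)) \<longlonglongrightarrow> fst z" by simp
    have "fst z - 1 / real (Suc n) \<le> q n (fst z) \<and> q n (fst z) \<le> fst z" for n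
    proof -
      have "real (Suc n) * fst z - 1 \<le> of_int \<lfloor>real (Suc n) * fst z\<rfloor>" "of_int \<lfloor>real (Suc n) * fst z\<rfloor> \<le> real (Suc n) * fst z" by linarith+
      moreover have "x - 1 / N \<le> F / N \<and> F / N \<le> x" if "0 < N" "N * x - 1 \<le> F" "F \<le> N * x" for N F x :: real
      proof -
        have "x - 1 / N = (N * x - 1) / N" "x = N * x / N" using that by (simp_all add: diff_divide_distrib)
        then show ?thesis using that by (metis divide_right_mono less_imp_le)
      qed
      ultimately show ?thesis unfolding q_def by simp
    qed
    then show "\<forall>\<^sub>F n in sequentially. fst z - 1 / real (Suc n) \<le> q n (fst z)" "\<forall>\<^sub>F n in sequentially. q n (fst z) \<le> fst z" by simp_all
  qed simp
  moreover have "isCont (\<lambda>t. f t (snd z)) (fst z)"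
    using cont[of "snd z"] z by (auto simp: space_pair_measure continuous_on_eq_continuous_at)
  ultimately show "(\<lambda>n. f (q n (fst z)) (snd z)) \<longlonglongrightarrow> f (fst z) (snd z)"
    by (auto simp: isCont_def intro: isCont_tendsto_compose)
qed

section \<open>Calculus of covariances along smooth paths\<close>

context gauss_space begin

lemma cov_isCont:
  assumes "\<And>s. P s \<in> G" "\<And>s. Q s \<in> G"
    and "\<And>\<omega>. \<omega> \<in> space M \<Longrightarrow> isCont (\<lambda>s. P s \<omega>) t" "\<And>\<omega>. \<omega> \<in> space M \<Longrightarrow> isCont (\<lambda>s. Q s \<omega>) t"
  shows "isCont (\<lambda>s. cov (P s) (Q s)) (t::real)"
  unfolding continuous_at_sequentially comp_def
proof (intro allI impI)
  fix X assume X: "X \<longlonglongrightarrow> t"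
  show "(\<lambda>n. cov (P (X n)) (Q (X n))) \<longlonglongrightarrow> cov (P t) (Q t)"
    using assms X by (intro cov_tendsto AE_I2 isCont_tendsto_compose[where g="\<lambda>s. P s _", OF _ X] isCont_tendsto_compose[where g="\<lambda>s. Q s _", OF _ X])
qed

text \<open>A product rule for second moments: difference quotients converge pathwise to members of
  \<open>G\<close>, so their covariances converge by \<open>cov_tendsto\<close>.\<close>

lemma cov_has_derivative:
  fixes P P' Q Q' :: "real \<Rightarrow> 'a \<Rightarrow> real"
  assumes G: "\<And>s. P s \<in> G" "P' t \<in> G" "\<And>s. Q s \<in> G" "Q' t \<in> G"
    and P: "\<And>\<omega>. \<omega> \<in> space M \<Longrightarrow> ((\<lambda>s. P s \<omega>) has_real_derivative P' t \<omega>) (at t within T)"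
    and Q: "\<And>\<omega>. \<omega> \<in> space M \<Longrightarrow> ((\<lambda>s. Q s \<omega>) has_real_derivative Q' t \<omega>) (at t within T)"
  shows "((\<lambda>s. cov (P s) (Q s)) has_real_derivative cov (P' t) (Q t) + cov (P t) (Q' t)) (at t within T)"
  unfolding has_field_derivative_iff tendsto_at_iff_sequentially
proof (intro allI impI)
  fix X assume X: "\<forall>i. X i \<in> T - {t}" "X \<longlonglongrightarrow> t"
  have quot: "(\<lambda>n. (R (X n) \<omega> - R t \<omega>) / (X n - t)) \<longlonglongrightarrow> D"
    if "((\<lambda>s. R s \<omega>) has_real_derivative D) (at t within T)" for R :: "real \<Rightarrow> 'a \<Rightarrow> real" and D \<omega>
    using that X unfolding has_field_derivative_iff tendsto_at_iff_sequentially comp_def by blast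
  have dq: "(\<lambda>\<omega>. (R s \<omega> - R t \<omega>) / (s - t)) \<in> G" if "\<And>s. R s \<in> G" for R s
    using G_scale[OF G_diff[OF that that], of "1 / (s - t)" s t] by simp
  have cQ: "(\<lambda>n. Q (X n) \<omega>) \<longlonglongrightarrow> Q t \<omega>" if "\<omega> \<in> space M" for \<omega>
  proof -
    have "((\<lambda>s. Q s \<omega>) \<longlongrightarrow> Q t \<omega>) (at t within T)"
      using DERIV_continuous[OF Q[OF that]] by (simp add: continuous_within)
    then show ?thesis using X unfolding tendsto_at_iff_sequentially comp_def by blast
  qed
  have "(\<lambda>n. cov (\<lambda>\<omega>. (P (X n) \<omega> - P t \<omega>) / (X n - t)) (Q (X n)) + cov (P t) (\<lambda>\<omega>. (Q (X n) \<omega> - Q t \<omega>) / (X n - t)))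
      \<longlonglongrightarrow> cov (P' t) (Q t) + cov (P t) (Q' t)"
    by (intro tendsto_add cov_tendsto dq G AE_I2 quot P Q cQ tendsto_const)
  moreover have "cov (\<lambda>\<omega>. (P s \<omega> - P t \<omega>) / (s - t)) (Q s) + cov (P t) (\<lambda>\<omega>. (Q s \<omega> - Q t \<omega>) / (s - t))
    = (cov (P s) (Q s) - cov (P t) (Q t)) / (s - t)" for s
  proof -
    have "cov (\<lambda>\<omega>. 1 / (s - t) * (P s \<omega> - P t \<omega>)) (Q s) = 1 / (s - t) * (cov (P s) (Q s) - cov (P t) (Q s))"
      using G by (simp only: cov_scale_left cov_diff_left)
    moreover have "cov (P t) (\<lambda>\<omega>. 1 / (s - t) * (Q s \<omega> - Q t \<omega>)) = 1 / (s - t) * (cov (P t) (Q s) - cov (P t) (Q t))"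
      using G by (simp only: cov_scale_right cov_diff_right)
    ultimately show ?thesis by (simp add: diff_divide_distrib)
  qed
  ultimately show "((\<lambda>y. (cov (P y) (Q y) - cov (P t) (Q t)) / (y - t)) \<circ> X) \<longlonglongrightarrow> cov (P' t) (Q t) + cov (P t) (Q' t)"
    by (simp add: comp_def)
qed

text \<open>The mean value theorem is applied to the scalar function v \<mapsto>
  \<open>cov (P v) W\<close>, with \<open>W\<close> the increment itself. Cauchy--Schwarz then
  bounds the square of the variance of \<open>W\<close> by \<open>C * (t - s)\<^sup>2\<close> times
  that variance, and one factor cancels.\<close>

lemma cov_Lipschitz:
  fixes P P' :: "real \<Rightarrow> 'a \<Rightarrow> real"
  assumes G: "\<And>s. P s \<in> G" "\<And>s. P' s \<in> G"
    and P: "\<And>\<omega> t. \<omega> \<in> space M \<Longrightarrow> t \<in> {c..d} \<Longrightarrow> ((\<lambda>s. P s \<omega>) has_real_derivative P' t \<omega>) (at t within {c..d})"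
    and C: "\<And>t. t \<in> {c..d} \<Longrightarrow> cov (P' t) (P' t) \<le> C"
    and st: "s \<in> {c..d}" "t \<in> {c..d}"
  shows "cov (\<lambda>\<omega>. P t \<omega> - P s \<omega>) (\<lambda>\<omega>. P t \<omega> - P s \<omega>) \<le> C * (t - s)\<^sup>2"
proof -
  have main: "cov (\<lambda>\<omega>. P t \<omega> - P s \<omega>) (\<lambda>\<omega>. P t \<omega> - P s \<omega>) \<le> C * (t - s)\<^sup>2"
    if st: "s \<in> {c..d}" "t \<in> {c..d}" "s < t" for s t
  proof -
    define W where "W = (\<lambda>\<omega>. P t \<omega> - P s \<omega>)"
    have W: "W \<in> G" unfolding W_def by (intro G_diff G)
    have z: "(\<lambda>\<omega>. 0) \<in> G" using G_scale[OF W, of 0] by simp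
    have z0: "cov Y (\<lambda>\<omega>. 0) = 0" for Y by (simp add: cov_def)
    have sub: "{s..t} \<subseteq> {c..d}" using st by auto
    have "((\<lambda>v. cov (P v) W) has_real_derivative cov (P' v) W) (at v within {s..t})" if "v \<in> {s..t}" for v
      using cov_has_derivative[where P=P and P'=P' and Q="\<lambda>_. W" and Q'="\<lambda>_ _. 0" and t=v and T="{s..t}"]
        DERIV_subset[OF P sub, of _ v] that sub G W z by (auto simp: z0)
    then have "\<exists>\<xi>\<in>{s<..<t}. cov (P t) W - cov (P s) W = cov (P' \<xi>) W * (t - s)"
      using mvt_simple[OF \<open>s < t\<close>, of "\<lambda>v. cov (P v) W" "\<lambda>v h. cov (P' v) W * h"]
      by (auto simp: has_field_derivative_def)
    then obtain \<xi> where \<xi>: "\<xi> \<in> {s<..<t}" "cov (P t) W - cov (P s) W = (t - s) * cov (P' \<xi>) W"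
      by (auto simp: mult.commute)
    have e: "cov W W = (t - s) * cov (P' \<xi>) W"
      using \<xi>(2) cov_diff_left[OF G(1)[of t] G(1)[of s] W] by (simp add: W_def)
    have "cov W W * cov W W = (t - s)\<^sup>2 * (cov (P' \<xi>) W)\<^sup>2" by (simp add: e power2_eq_square)
    also have "\<dots> \<le> (t - s)\<^sup>2 * (cov (P' \<xi>) (P' \<xi>) * cov W W)"
      by (intro mult_left_mono cov_Cauchy_Schwarz G W) simp
    also have "\<dots> \<le> (t - s)\<^sup>2 * (C * cov W W)"
      using \<xi> st by (intro mult_left_mono mult_right_mono C cov_nonneg) auto
    finally have "cov W W * cov W W \<le> C * (t - s)\<^sup>2 * cov W W" by (simp add: mult_ac)
    moreover have "0 \<le> C" using C[OF st(1)] cov_nonneg[of "P' s"] by linarith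
    ultimately have "cov W W \<le> C * (t - s)\<^sup>2"
      using cov_nonneg[of W] by (cases "cov W W = 0") (auto simp: mult_le_cancel_right)
    then show ?thesis by (simp add: W_def)
  qed
  show ?thesis
  proof (cases s t rule: linorder_cases)
    case less then show ?thesis using main st by blast
  next
    case equal
    then show ?thesis using C[OF st(1)] cov_nonneg[of "P' s"] by (simp add: cov_def)
  next
    case greater
    have "cov (\<lambda>\<omega>. P t \<omega> - P s \<omega>) (\<lambda>\<omega>. P t \<omega> - P s \<omega>) = cov (\<lambda>\<omega>. P s \<omega> - P t \<omega>) (\<lambda>\<omega>. P s \<omega> - P t \<omega>)"
      by (simp add: cov_def algebra_simps)
    then show ?thesis using main[of t s] greater st by (simp add: power2_commute)
  qed
qed

end

text \<open>The paths are extended to the whole line by their values at the end points.\<close>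

locale C2_gauss_process = gauss_space +
  fixes A B :: real and x0 x1 x2 :: "real \<Rightarrow> 'a \<Rightarrow> real"
  assumes AB: "A < B"
    and xG: "x0 t \<in> G" "x1 t \<in> G" "x2 t \<in> G"
    and clamp: "x0 (max A (min B t)) = x0 t"
    and xD1: "\<omega> \<in> space M \<Longrightarrow> t \<in> {A..B} \<Longrightarrow> ((\<lambda>s. x0 s \<omega>) has_real_derivative x1 t \<omega>) (at t within {A..B})"
    and xD2: "\<omega> \<in> space M \<Longrightarrow> t \<in> {A..B} \<Longrightarrow> ((\<lambda>s. x1 s \<omega>) has_real_derivative x2 t \<omega>) (at t within {A..B})"
    and xC: "\<omega> \<in> space M \<Longrightarrow> continuous_on UNIV (\<lambda>t. x0 t \<omega>)" "\<omega> \<in> space M \<Longrightarrow> continuous_on UNIV (\<lambda>t. x1 t \<omega>)"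
      "\<omega> \<in> space M \<Longrightarrow> continuous_on UNIV (\<lambda>t. x2 t \<omega>)"
begin

lemma measurable_x [measurable]: "x0 t \<in> borel_measurable M" "x1 t \<in> borel_measurable M" "x2 t \<in> borel_measurable M"
  using xG measurable_G by auto

lemma isCont_x: "\<omega> \<in> space M \<Longrightarrow> isCont (\<lambda>t. x0 t \<omega>) t" "\<omega> \<in> space M \<Longrightarrow> isCont (\<lambda>t. x1 t \<omega>) t"
  "\<omega> \<in> space M \<Longrightarrow> isCont (\<lambda>t. x2 t \<omega>) t"
  using xC by (auto simp: continuous_on_eq_continuous_at)

lemma C2_path_function:
  assumes "\<omega> \<in> space M" "A \<le> a" "b \<le> B"
  shows "C2_function a b (\<lambda>t. x0 t \<omega>) (\<lambda>t. x1 t \<omega>) (\<lambda>t. x2 t \<omega>)"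
proof
  have sub: "{a..b} \<subseteq> {A..B}" using assms by auto
  show "((\<lambda>t. x0 t \<omega>) has_real_derivative x1 t \<omega>) (at t within {a..b})" if "t \<in> {a..b}" for t
    using DERIV_subset[OF xD1 sub] assms that sub by auto
  show "((\<lambda>t. x1 t \<omega>) has_real_derivative x2 t \<omega>) (at t within {a..b})" if "t \<in> {a..b}" for t
    using DERIV_subset[OF xD2 sub] assms that sub by auto
  show "continuous_on {a..b} (\<lambda>t. x2 t \<omega>)" using continuous_on_subset[OF xC(3)] assms by auto
qed (use assms xC in \<open>auto intro: borel_measurable_continuous_onI\<close>)

text \<open>A tangency at \<open>t\<close> forces \<open>\<bar>X - u\<bar> = O(h\<^sup>2)\<close> at a point of any grid of mesh \<open>h\<close>.\<close>

lemma no_tangency: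
  assumes ab: "A \<le> a" "a < b" "b \<le> B" and v0: "0 < v0" "\<And>t. t \<in> {a..b} \<Longrightarrow> v0 \<le> cov (x0 t) (x0 t)"
  shows "AE \<omega> in M. \<not> (\<exists>t\<in>{a..b}. x0 t \<omega> = u \<and> x1 t \<omega> = 0)"
proof -
  define h where "h n = (b - a) / real (Suc n)" for n
  define g where "g n i = a + real i * h n" for n i
  have h: "0 < h n" for n using ab by (simp add: h_def)
  have g: "g n i \<in> {a..b}" if "i \<le> Suc n" for n i
  proof -
    have "real i * h n \<le> real (Suc n) * h n" using that h[of n] by (intro mult_right_mono) auto
    also have "\<dots> = b - a" by (simp add: h_def)
    finally show ?thesis using h[of n] by (auto simp: g_def)
  qed
  \<comment> \<open>\<open>K\<close> bounds the second derivative. About \<open>n\<close> grid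
    points, each with probability of order \<open>(h n)\<^sup>2\<close>, leave a total of order 1 /
    n. As the bound depends on the path, the null sets for all natural \<open>K\<close> are
    combined.\<close>
  define E where "E K n i = {\<omega>\<in>space M. x0 (g n i) \<omega> \<in> {u - real K * (h n)\<^sup>2..u + real K * (h n)\<^sup>2}}" for K n i
  define N where "N K = (\<Inter>n. \<Union>i\<in>{..Suc n}. E K n i)" for K
  have [measurable]: "E K n i \<in> sets M" for K n i unfolding E_def by measurable
  have [measurable]: "N K \<in> sets M" for K unfolding N_def by (intro sets.countable_INT) auto
  have pN: "prob (N K) \<le> 0" for K
  proof (rule LIMSEQ_le_const)
    show "(\<lambda>n. 4 * real K * (b - a)\<^sup>2 / sqrt v0 / real (Suc n)) \<longlonglongrightarrow> 0"
      by (intro LIMSEQ_Suc lim_const_over_n)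
    have "prob (N K) \<le> 4 * real K * (b - a)\<^sup>2 / sqrt v0 / real (Suc n)" for n
    proof -
      have "prob (N K) \<le> prob (\<Union>i\<in>{..Suc n}. E K n i)"
        by (intro finite_measure_mono) (auto simp: N_def)
      also have "\<dots> \<le> (\<Sum>i\<in>{..Suc n}. prob (E K n i))"
        by (intro finite_measure_subadditive_finite) auto
      also have "\<dots> \<le> (\<Sum>i\<in>{..Suc n}. 2 * real K * (h n)\<^sup>2 / sqrt v0)"
      proof (rule sum_mono)
        fix i assume i: "i \<in> {..Suc n}"
        then have gi: "g n i \<in> {a..b}" by (intro g) simp
        have "prob (E K n i) \<le> ((u + real K * (h n)\<^sup>2) - (u - real K * (h n)\<^sup>2)) / sqrt (cov (x0 (g n i)) (x0 (g n i)))"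
          unfolding E_def using v0(1) v0(2)[OF gi] by (intro cgauss_interval_le[OF cgauss_cov[OF xG(1)]]) auto
        also have "\<dots> \<le> ((u + real K * (h n)\<^sup>2) - (u - real K * (h n)\<^sup>2)) / sqrt v0"
          using v0(1) v0(2)[OF gi] by (intro divide_left_mono) auto
        finally show "prob (E K n i) \<le> 2 * real K * (h n)\<^sup>2 / sqrt v0" by simp
      qed
      also have "\<dots> = (real n + 2) * (2 * real K * (h n)\<^sup>2 / sqrt v0)" by simp
      also have "\<dots> \<le> (2 * real (Suc n)) * (2 * real K * (h n)\<^sup>2 / sqrt v0)"
        using v0 by (intro mult_right_mono) auto
      also have "\<dots> = 4 * real K * (b - a)\<^sup>2 / sqrt v0 / real (Suc n)"
      proof -
        have "(2 * N) * (2 * k * (c / N)\<^sup>2 / r) = 4 * k * c\<^sup>2 / r / N" if "N \<noteq> 0" for N k c r :: real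
          using that by (simp add: power2_eq_square mult_ac)
        then show ?thesis unfolding h_def by (simp only: of_nat_eq_0_iff nat.distinct simp_thms)
      qed
      finally show ?thesis .
    qed
    then show "\<exists>n0. \<forall>n\<ge>n0. prob (N K) \<le> 4 * real K * (b - a)\<^sup>2 / sqrt v0 / real (Suc n)" by blast
  qed
  have "AE \<omega> in M. \<omega> \<notin> N K" for K
    using pN[of K] by (intro AE_not_in) (simp add: null_sets_def emeasure_eq_measure measure_le_0_iff)
  then have "AE \<omega> in M. \<forall>K. \<omega> \<notin> N K" by (simp add: AE_all_countable)
  then show ?thesis using AE_space
  proof eventually_elim
    case (elim \<omega>)
    show ?case
    proof
      assume "\<exists>t\<in>{a..b}. x0 t \<omega> = u \<and> x1 t \<omega> = 0"
      then obtain t where t: "t \<in> {a..b}" "x0 t \<omega> = u" "x1 t \<omega> = 0" by auto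
      interpret f: C2_function a b "\<lambda>t. x0 t \<omega>" "\<lambda>t. x1 t \<omega>" "\<lambda>t. x2 t \<omega>"
        using elim ab by (intro C2_path_function) auto
      have "bounded ((\<lambda>t. x2 t \<omega>) ` {a..b})"
        using f.cont2 by (intro compact_imp_bounded compact_continuous_image) auto
      then obtain c where c: "\<And>s. s \<in> {a..b} \<Longrightarrow> \<bar>x2 s \<omega>\<bar> \<le> c"
        unfolding bounded_iff by fastforce
      obtain K :: nat where K: "c \<le> real K" using real_arch_simple by blast
      have x2K: "\<bar>x2 s \<omega>\<bar> \<le> real K" if "s \<in> {a..b}" for s using c[OF that] K by simp
      have x1b: "\<bar>x1 s \<omega>\<bar> \<le> real K * \<bar>s - t\<bar>" if s: "s \<in> {a..b}" for s
        using field_differentiable_bound[of "{a..b}" "\<lambda>t. x1 t \<omega>" "\<lambda>t. x2 t \<omega>" "real K" s t] f.D2 x2K s t by auto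
      have x0b: "\<bar>x0 s \<omega> - u\<bar> \<le> real K * (h n)\<^sup>2" if s: "s \<in> {a..b}" "\<bar>s - t\<bar> \<le> h n" for s n
      proof -
        have sub: "closed_segment t s \<subseteq> {a..b}" using s t by (auto simp: closed_segment_eq_real_ivl)
        have "\<bar>x0 s \<omega> - x0 t \<omega>\<bar> \<le> (real K * h n) * \<bar>s - t\<bar>"
        proof (rule field_differentiable_bound[of "closed_segment t s" "\<lambda>t. x0 t \<omega>" "\<lambda>t. x1 t \<omega>", unfolded real_norm_def])
          fix y assume y: "y \<in> closed_segment t s"
          show "((\<lambda>t. x0 t \<omega>) has_real_derivative x1 y \<omega>) (at y within closed_segment t s)"
            using DERIV_subset[OF f.D1 sub] y sub by auto
          have "\<bar>x1 y \<omega>\<bar> \<le> real K * \<bar>y - t\<bar>" using x1b y sub by auto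
          also have "\<dots> \<le> real K * h n" using y s by (intro mult_left_mono) (auto simp: closed_segment_eq_real_ivl split: if_splits)
          finally show "\<bar>x1 y \<omega>\<bar> \<le> real K * h n" .
        qed auto
        also have "\<dots> \<le> (real K * h n) * h n" using s h[of n] by (intro mult_left_mono) auto
        finally show ?thesis using t by (simp add: power2_eq_square)
      qed
      have "\<omega> \<in> N K"
        unfolding N_def
      proof (rule INT_I)
        fix n
        define i where "i = nat \<lfloor>(t - a) / h n\<rfloor>"
        have "0 \<le> (t - a) / h n" using t h[of n] by simp
        then have ri: "real i = of_int \<lfloor>(t - a) / h n\<rfloor>" unfolding i_def by simp
        have "real i \<le> (t - a) / h n" "(t - a) / h n < real i + 1" unfolding ri by linarith+
        then have i: "real i * h n \<le> t - a" "t - a < real i * h n + h n"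
          using h[of n] by (auto simp: field_simps)
        have iS: "i \<le> Suc n"
        proof (rule ccontr)
          assume "\<not> i \<le> Suc n"
          then have "real (Suc n) * h n < real i * h n" using h[of n] by (intro mult_strict_right_mono) auto
          also have "\<dots> \<le> t - a" by (rule i)
          finally show False using t by (simp add: h_def)
        qed
        have "\<bar>g n i - t\<bar> \<le> h n" using i unfolding g_def by linarith
        then have "\<bar>x0 (g n i) \<omega> - u\<bar> \<le> real K * (h n)\<^sup>2" using g[OF iS] by (intro x0b)
        then have "\<omega> \<in> E K n i" unfolding E_def using elim by auto
        then show "\<omega> \<in> (\<Union>i\<in>{..Suc n}. E K n i)" using iS by auto
      qed
      then show False using elim by blast
    qed
  qed
qed

text \<open>Rational times make the event countable; times outside \<open>{A..B}\<close> do no harm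
  because of \<open>clamp\<close>. The margin \<open>1 / real (Suc m)\<close> is there because the
  level may be attained without being exceeded, or only at irrational times.\<close>

lemma exists_ge_iff:
  assumes "\<omega> \<in> space M" and y: "y = x0 \<or> y = (\<lambda>t \<omega>. - x0 t \<omega>)"
  shows "(\<exists>t\<in>{A..B}. u \<le> y t \<omega>) \<longleftrightarrow> (\<forall>m. \<exists>q\<in>\<rat>. u - 1 / real (Suc m) < y q \<omega>)"
proof
  have cy: "continuous_on UNIV (\<lambda>t. y t \<omega>)" using xC(1)[OF assms(1)] y by (auto intro: continuous_intros)
  have yc: "y (max A (min B t)) = y t" for t using y clamp by auto
  {
    assume "\<exists>t\<in>{A..B}. u \<le> y t \<omega>"
    then obtain t where t: "u \<le> y t \<omega>" by auto
    show "\<forall>m. \<exists>q\<in>\<rat>. u - 1 / real (Suc m) < y q \<omega>"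
    proof
      fix m
      have "open ((\<lambda>t. y t \<omega>) -` {u - 1 / real (Suc m)<..})"
        using cy by (rule open_vimage[rotated]) simp
      moreover have "t \<in> (\<lambda>t. y t \<omega>) -` {u - 1 / real (Suc m)<..}" using t less_le_trans[of "u - 1 / real (Suc m)" u] by simp
      ultimately obtain e where e: "0 < e" "ball t e \<subseteq> (\<lambda>t. y t \<omega>) -` {u - 1 / real (Suc m)<..}"
        using openE by blast
      obtain q where "q \<in> \<rat>" "t - e < q" "q < t" using Rats_dense_in_real[of "t - e" t] e by auto
      then have "q \<in> ball t e" by (auto simp: dist_real_def)
      with e(2) have "u - 1 / real (Suc m) < y q \<omega>" by auto
      then show "\<exists>q\<in>\<rat>. u - 1 / real (Suc m) < y q \<omega>" using \<open>q \<in> \<rat>\<close> by blast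
    qed
  }
  assume q: "\<forall>m. \<exists>q\<in>\<rat>. u - 1 / real (Suc m) < y q \<omega>"
  have "\<exists>t\<in>{A..B}. \<forall>s\<in>{A..B}. y s \<omega> \<le> y t \<omega>"
    using AB by (intro continuous_attains_sup continuous_on_subset[OF cy]) auto
  then obtain t where t: "t \<in> {A..B}" "\<And>s. s \<in> {A..B} \<Longrightarrow> y s \<omega> \<le> y t \<omega>" by blast
  have "u - 1 / real (Suc m) \<le> y t \<omega>" for m
  proof -
    obtain q where "u - 1 / real (Suc m) < y q \<omega>" using q by blast
    also have "y q \<omega> = y (max A (min B q)) \<omega>" by (simp add: yc)
    also have "\<dots> \<le> y t \<omega>" using AB by (intro t(2)) auto
    finally show ?thesis by simp
  qed
  moreover have "(\<lambda>m. u - 1 / real (Suc m)) \<longlonglongrightarrow> u - 0"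
    by (intro tendsto_diff tendsto_const LIMSEQ_Suc lim_const_over_n)
  ultimately have "u \<le> y t \<omega>" using LIMSEQ_le_const2 by fastforce
  then show "\<exists>t\<in>{A..B}. u \<le> y t \<omega>" using t by blast
qed

definition above :: "real \<Rightarrow> 'a set" where "above u = {\<omega>\<in>space M. \<exists>t\<in>{A..B}. u \<le> x0 t \<omega>}"
definition below :: "real \<Rightarrow> 'a set" where "below u = {\<omega>\<in>space M. \<exists>t\<in>{A..B}. u \<le> - x0 t \<omega>}"

lemma above_eq: "above u = {\<omega>\<in>space M. \<forall>m. \<exists>q\<in>\<rat>. u - 1 / real (Suc m) < x0 q \<omega>}"
  unfolding above_def using exists_ge_iff[where y=x0] by blast

lemma below_eq: "below u = {\<omega>\<in>space M. \<forall>m. \<exists>q\<in>\<rat>. u - 1 / real (Suc m) < - x0 q \<omega>}"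
  unfolding below_def using exists_ge_iff[where y="\<lambda>t \<omega>. - x0 t \<omega>"] by blast

lemma sets_above [measurable]: "above u \<in> sets M" and sets_below [measurable]: "below u \<in> sets M"
  unfolding above_eq below_eq using countable_rat by measurable

text \<open>Monotone limits reduce both events to finitely many times and a strict inequality, where
  \<open>symmetric_rectangles\<close> applies to the complements.\<close>

lemma prob_above_below: "prob (above u) = prob (below u)"
proof -
  define q :: "nat \<Rightarrow> real" where "q = from_nat_into \<rat>"
  have q: "range q = \<rat>" unfolding q_def by (rule range_from_nat_into) (auto simp: countable_rat)
  have lim: "(\<lambda>m. prob {\<omega>\<in>space M. \<exists>r\<in>\<rat>. u - 1 / real (Suc m) < y r \<omega>}) \<longlonglongrightarrow> prob {\<omega>\<in>space M. \<forall>m. \<exists>r\<in>\<rat>. u - 1 / real (Suc m) < y r \<omega>}"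
    if [measurable]: "\<And>t. y t \<in> borel_measurable M" for y
  proof -
    have "(\<lambda>m. prob {\<omega>\<in>space M. \<exists>r\<in>\<rat>. u - 1 / real (Suc m) < y r \<omega>}) \<longlonglongrightarrow> prob (\<Inter>m. {\<omega>\<in>space M. \<exists>r\<in>\<rat>. u - 1 / real (Suc m) < y r \<omega>})"
    proof (rule finite_Lim_measure_decseq)
      show "range (\<lambda>m. {\<omega>\<in>space M. \<exists>r\<in>\<rat>. u - 1 / real (Suc m) < y r \<omega>}) \<subseteq> sets M"
      proof safe
        fix m
        have "{\<omega>\<in>space M. \<exists>r\<in>\<rat>. u - 1 / real (Suc m) < y r \<omega>} = (\<Union>r\<in>\<rat>. {\<omega>\<in>space M. u - 1 / real (Suc m) < y r \<omega>})" by auto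
        then show "{\<omega>\<in>space M. \<exists>r\<in>\<rat>. u - 1 / real (Suc m) < y r \<omega>} \<in> sets M"
          by (simp only:) (intro sets.countable_UN'' countable_rat, measurable)
      qed
      show "decseq (\<lambda>m. {\<omega>\<in>space M. \<exists>r\<in>\<rat>. u - 1 / real (Suc m) < y r \<omega>})"
      proof (rule decseq_SucI)
        fix m
        have "u - 1 / real (Suc m) \<le> u - 1 / real (Suc (Suc m))" by (simp add: frac_le)
        then show "{\<omega>\<in>space M. \<exists>r\<in>\<rat>. u - 1 / real (Suc (Suc m)) < y r \<omega>} \<subseteq> {\<omega>\<in>space M. \<exists>r\<in>\<rat>. u - 1 / real (Suc m) < y r \<omega>}"
          by (auto simp del: of_nat_Suc intro!: bexI intro: le_less_trans)
      qed
    qed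
    moreover have "(\<Inter>m. {\<omega>\<in>space M. \<exists>r\<in>\<rat>. u - 1 / real (Suc m) < y r \<omega>}) = {\<omega>\<in>space M. \<forall>m. \<exists>r\<in>\<rat>. u - 1 / real (Suc m) < y r \<omega>}" by auto
    ultimately show ?thesis by simp
  qed
  have lim2: "(\<lambda>n. prob {\<omega>\<in>space M. \<exists>i\<in>{..n}. w < y (q i) \<omega>}) \<longlonglongrightarrow> prob {\<omega>\<in>space M. \<exists>r\<in>\<rat>. w < y r \<omega>}"
    if [measurable]: "\<And>t. y t \<in> borel_measurable M" for y :: "real \<Rightarrow> 'a \<Rightarrow> real" and w
  proof -
    have "(\<lambda>n. prob {\<omega>\<in>space M. \<exists>i\<in>{..n}. w < y (q i) \<omega>}) \<longlonglongrightarrow> prob (\<Union>n. {\<omega>\<in>space M. \<exists>i\<in>{..n}. w < y (q i) \<omega>})"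
    proof (rule finite_Lim_measure_incseq)
      show "range (\<lambda>n. {\<omega>\<in>space M. \<exists>i\<in>{..n}. w < y (q i) \<omega>}) \<subseteq> sets M" by (safe, measurable)
      show "incseq (\<lambda>n. {\<omega>\<in>space M. \<exists>i\<in>{..n}. w < y (q i) \<omega>})"
        by (auto simp: incseq_def intro: order_trans)
    qed
    moreover have "(\<Union>n. {\<omega>\<in>space M. \<exists>i\<in>{..n}. w < y (q i) \<omega>}) = {\<omega>\<in>space M. \<exists>r\<in>\<rat>. w < y r \<omega>}"
      unfolding q[symmetric] by auto
    ultimately show ?thesis by simp
  qed
  have fin: "prob {\<omega>\<in>space M. \<exists>i\<in>{..n}. w < x0 (q i) \<omega>} = prob {\<omega>\<in>space M. \<exists>i\<in>{..n}. w < - x0 (q i) \<omega>}" for n w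
  proof -
    have "prob (space M - {\<omega>\<in>space M. \<forall>i\<in>{..n}. x0 (q i) \<omega> \<in> {..w}}) = prob (space M - {\<omega>\<in>space M. \<forall>i\<in>{..n}. - x0 (q i) \<omega> \<in> {..w}})"
      using symmetric_rectangles[of "{..n}" "\<lambda>i. x0 (q i)" "\<lambda>_. {..w}"] xG by (subst (1 2) prob_compl) auto
    moreover have "space M - {\<omega>\<in>space M. \<forall>i\<in>{..n}. y i \<omega> \<in> {..w}} = {\<omega>\<in>space M. \<exists>i\<in>{..n}. w < y i \<omega>}" for y
      by (auto simp: not_le Ball_def Bex_def)
    ultimately show ?thesis by (simp only:)
  qed
  have "prob {\<omega>\<in>space M. \<exists>r\<in>\<rat>. w < x0 r \<omega>} = prob {\<omega>\<in>space M. \<exists>r\<in>\<rat>. w < - x0 r \<omega>}" for w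
    using lim2[of x0 w] lim2[of "\<lambda>t \<omega>. - x0 t \<omega>" w] fin LIMSEQ_unique by (simp add: fin) blast
  then show ?thesis unfolding above_eq below_eq
    using lim[of x0] lim[of "\<lambda>t \<omega>. - x0 t \<omega>"] LIMSEQ_unique by simp blast
qed

end

section \<open>The expected number of additional up-crossings\<close>

text \<open>One factor \<open>exp (\<theta> * z\<^sup>2)\<close> absorbs the linear growth, a second
  one is traded for the decay in \<open>w\<close>.\<close>

lemma positive_part_le_exp:
  fixes z w \<theta> :: real
  assumes "0 < \<theta>" "0 \<le> w" "w \<le> z"
  shows "z \<le> (1 + 1 / \<theta>) * exp (- (\<theta> * w\<^sup>2)) * exp (2 * \<theta> * z\<^sup>2)"
proof -
  have "z \<le> 1 + z\<^sup>2" using sum_squares_bound[of z 1] zero_le_power2[of z] assms by (smt (verit) mult_cancel_left2 one_power2)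
  also have "\<dots> \<le> (1 + 1 / \<theta>) * exp (\<theta> * z\<^sup>2)"
  proof -
    have "1 \<le> exp (\<theta> * z\<^sup>2)" using assms by simp
    moreover have "z\<^sup>2 \<le> exp (\<theta> * z\<^sup>2) / \<theta>"
    proof -
      have "\<theta> * z\<^sup>2 \<le> exp (\<theta> * z\<^sup>2)" using exp_ge_add_one_self[of "\<theta> * z\<^sup>2"] by linarith
      then show ?thesis using assms by (simp add: pos_le_divide_eq mult.commute)
    qed
    ultimately have "1 + z\<^sup>2 \<le> exp (\<theta> * z\<^sup>2) + exp (\<theta> * z\<^sup>2) / \<theta>" by (rule add_mono)
    then show ?thesis by (simp add: distrib_right)
  qed
  also have "\<dots> \<le> (1 + 1 / \<theta>) * (exp (- (\<theta> * w\<^sup>2)) * exp (2 * \<theta> * z\<^sup>2))"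
  proof (rule mult_left_mono)
    have "w\<^sup>2 \<le> z\<^sup>2" using assms by (intro power_mono) auto
    then have "\<theta> * w\<^sup>2 \<le> \<theta> * z\<^sup>2" using assms by (intro mult_left_mono) auto
    then show "exp (\<theta> * z\<^sup>2) \<le> exp (- (\<theta> * w\<^sup>2)) * exp (2 * \<theta> * z\<^sup>2)" by (simp add: exp_add[symmetric])
  qed (use assms in simp)
  finally show ?thesis by (simp add: mult.assoc)
qed

section \<open>Tail moments and the expected excess at a fixed time\<close>

context gauss_space begin

lemma nn_integral_upper_part_le:
  assumes Y: "Y \<in> G" "cov Y Y \<le> m" and m: "0 < m" and w: "0 \<le> w" and c: "0 \<le> c"
  shows "(\<integral>\<^sup>+\<omega>. ennreal (if w \<le> Y \<omega> then c * Y \<omega> else 0) \<partial>M) \<le>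
    ennreal (c * (1 + 8 * m) * sqrt 2 * exp (- (w\<^sup>2 / (8 * m))))"
proof -
  \<comment> \<open>This makes \<open>2 * (2 * \<theta>) * m = 1 / 2\<close>, whence the factor
    \<open>sqrt 2\<close>.\<close>
  define \<theta> where "\<theta> = 1 / (8 * m)"
  have \<theta>: "0 < \<theta>" using m by (simp add: \<theta>_def)
  have [measurable]: "Y \<in> borel_measurable M" using Y measurable_G by auto
  define k where "k = c * (1 + 1 / \<theta>) * exp (- (\<theta> * w\<^sup>2))"
  have k: "0 \<le> k" using c \<theta> by (simp add: k_def)
  have "(\<integral>\<^sup>+\<omega>. ennreal (if w \<le> Y \<omega> then c * Y \<omega> else 0) \<partial>M) \<le> (\<integral>\<^sup>+\<omega>. ennreal k * ennreal (exp (2 * \<theta> * (Y \<omega>)\<^sup>2)) \<partial>M)"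
  proof (rule nn_integral_mono)
    fix \<omega>
    have "(if w \<le> Y \<omega> then c * Y \<omega> else 0) \<le> k * exp (2 * \<theta> * (Y \<omega>)\<^sup>2)"
    proof (cases "w \<le> Y \<omega>")
      case True
      then show ?thesis using mult_left_mono[OF positive_part_le_exp[OF \<theta> w True] c] by (simp add: k_def mult.assoc)
    next
      case False then show ?thesis using k by simp
    qed
    then show "ennreal (if w \<le> Y \<omega> then c * Y \<omega> else 0) \<le> ennreal k * ennreal (exp (2 * \<theta> * (Y \<omega>)\<^sup>2))"
      using k by (simp add: ennreal_mult[symmetric] ennreal_leI)
  qed
  also have "\<dots> = ennreal k * (\<integral>\<^sup>+\<omega>. ennreal (exp (2 * \<theta> * (Y \<omega>)\<^sup>2)) \<partial>M)" by (simp add: nn_integral_cmult)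
  also have "\<dots> \<le> ennreal k * ennreal (1 / sqrt (1 - 2 * (2 * \<theta>) * m))"
    using Y \<theta> m by (intro mult_left_mono cgauss_exp_square_le[OF cgauss_cov]) (auto simp: \<theta>_def)
  also have "1 / sqrt (1 - 2 * (2 * \<theta>) * m) = sqrt 2"
    using m by (simp add: \<theta>_def real_sqrt_divide)
  also have "ennreal k * ennreal (sqrt 2) = ennreal (c * (1 + 8 * m) * sqrt 2 * exp (- (w\<^sup>2 / (8 * m))))"
    using k by (simp add: ennreal_mult[symmetric] k_def \<theta>_def mult_ac)
  finally show ?thesis .
qed

text \<open>Giving up the fraction \<open>\<eta>\<close> of the exponent keeps the exponential
  moment below \<open>1 / sqrt \<eta>\<close> for all variances up to \<open>S\<close>, so the bound
  is uniform in \<open>s\<close>.\<close>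

lemma cnormal_upper_tail_le:
  assumes "0 \<le> s" "s \<le> S" "0 < S" "0 < \<eta>" "\<eta> < 1" "0 \<le> w"
  shows "emeasure (cnormal s) {w..} \<le> ennreal (1 / sqrt \<eta> * exp (- ((1 - \<eta>) * w\<^sup>2 / (2 * S))))"
proof -
  define \<theta> where "\<theta> = (1 - \<eta>) / (2 * S)"
  have \<theta>: "0 \<le> \<theta>" "2 * \<theta> * S = 1 - \<eta>" using assms by (auto simp: \<theta>_def)
  have "emeasure (cnormal s) {w..} = (\<integral>\<^sup>+x. indicator {w..} x \<partial>cnormal s)" by simp
  also have "\<dots> \<le> (\<integral>\<^sup>+x. ennreal (exp (- (\<theta> * w\<^sup>2))) * ennreal (exp (\<theta> * x\<^sup>2)) \<partial>cnormal s)"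
  proof (rule nn_integral_mono)
    fix x
    have "1 \<le> exp (- (\<theta> * w\<^sup>2)) * exp (\<theta> * x\<^sup>2)" if "w \<le> x"
      using that assms \<theta> power_mono[of w x 2] by (simp add: exp_add[symmetric] mult_left_mono)
    then show "indicator {w..} x \<le> ennreal (exp (- (\<theta> * w\<^sup>2))) * ennreal (exp (\<theta> * x\<^sup>2))"
      by (auto simp: indicator_def ennreal_mult[symmetric] ennreal_1[symmetric] simp del: ennreal_1 intro!: ennreal_leI)
  qed
  also have "\<dots> = ennreal (exp (- (\<theta> * w\<^sup>2))) * (\<integral>\<^sup>+x. ennreal (exp (\<theta> * x\<^sup>2)) \<partial>cnormal s)"
    by (rule nn_integral_cmult) simp
  also have "\<dots> \<le> ennreal (exp (- (\<theta> * w\<^sup>2))) * ennreal (1 / sqrt (1 - 2 * \<theta> * S))"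
    using assms \<theta> by (intro mult_left_mono cnormal_exp_square_le) auto
  also have "\<dots> = ennreal (1 / sqrt \<eta> * exp (- ((1 - \<eta>) * w\<^sup>2 / (2 * S))))"
    unfolding \<theta>(2) using assms by (simp add: ennreal_mult[symmetric] \<theta>_def mult_ac)
  finally show ?thesis .
qed

text \<open>Gram--Schmidt: \<open>X' = r X + U\<^sub>2\<close> and \<open>X'' = \<alpha> X + \<beta> U\<^sub>2 + U\<^sub>3\<close>. Near the level, with a small slope, \<open>X'' > 0\<close>
  forces \<open>U\<^sub>3 > c\<^sub>0 u\<close>, independently of the cost of reaching the level.\<close>

lemma nn_integral_excess_le:
  assumes Y: "Y0 \<in> G" "Y1 \<in> G" "Y2 \<in> G"
    and s: "0 < cov Y0 Y0" "cov Y0 Y0 \<le> S"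
    and r: "r = cov Y0 Y1 / cov Y0 Y0" and v2: "v2 = cov Y1 Y1 - r * cov Y0 Y1"
    and \<alpha>: "\<alpha> = cov Y0 Y2 / cov Y0 Y0" and \<beta>: "\<beta> = (cov Y1 Y2 - r * cov Y0 Y2) / v2"
    and m0: "0 < m0" "m0 \<le> v2" and \<rho>: "\<bar>r\<bar> \<le> \<rho>" and c0: "0 < c0" "\<alpha> \<le> - 4 * c0"
    and \<beta>0: "\<bar>\<beta>\<bar> \<le> \<beta>0" "\<beta>0 * (\<eta> + \<rho>) \<le> c0" and \<eta>: "0 < \<eta>" "\<eta> \<le> 1 / 2"
    and e0: "0 < e0" "cov Y2 Y2 \<le> e0" and m1: "0 < m1" "cov Y1 Y1 \<le> m1"
    and h: "0 < h" and u: "1 \<le> u"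
  shows "(\<integral>\<^sup>+\<omega>. ennreal (excess \<eta> h u (Y0 \<omega>) (Y1 \<omega>) (Y2 \<omega>)) \<partial>M) \<le>
    ennreal (2 * (1 + 8 * e0) * sqrt 2 / sqrt (m0 * \<eta>) * exp (- (c0\<^sup>2 / (8 * e0) + (1 - \<eta>) ^ 3 / (2 * S)) * u\<^sup>2) +
       2 / \<eta> * (1 + 8 * m1) * sqrt 2 * exp (- (\<eta> / (2 * h))\<^sup>2 / (8 * m1) * u\<^sup>2))"
proof -
  have [measurable]: "Y0 \<in> borel_measurable M" "Y1 \<in> borel_measurable M" "Y2 \<in> borel_measurable M"
    using Y measurable_G by auto
  define s' where "s' = cov Y0 Y0"
  define U2 where "U2 = (\<lambda>\<omega>. 1 * Y1 \<omega> + (- r) * Y0 \<omega>)"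
  define P where "P = (\<lambda>\<omega>. \<alpha> * Y0 \<omega> + \<beta> * U2 \<omega>)"
  define U3 where "U3 = (\<lambda>\<omega>. 1 * Y2 \<omega> + (-1) * P \<omega>)"
  have S: "0 < S" using s by simp
  have rs: "r * cov Y0 Y0 = cov Y0 Y1" and as: "\<alpha> * cov Y0 Y0 = cov Y0 Y2" using s by (simp_all add: r \<alpha>)
  have U2: "U2 \<in> G" unfolding U2_def by (intro lin Y)
  have P: "P \<in> G" unfolding P_def by (intro lin Y U2)
  have U3: "U3 \<in> G" unfolding U3_def by (intro lin Y P)
  have [measurable]: "U2 \<in> borel_measurable M" "U3 \<in> borel_measurable M" using U2 U3 measurable_G by auto
  have c02: "cov Y0 U2 = 0" unfolding U2_def using Y rs by (subst cov_lin_right) auto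
  have c22: "cov U2 U2 = v2"
  proof -
    have "cov U2 U2 = 1 * cov Y1 U2 + (- r) * cov Y0 U2"
      by (subst (1) U2_def) (rule cov_lin_left[OF Y(2,1) U2])
    also have "cov Y1 U2 = 1 * cov Y1 Y1 + (- r) * cov Y1 Y0" unfolding U2_def by (rule cov_lin_right[OF Y(2,1,2)])
    finally show ?thesis using c02 by (simp add: v2 cov_commute)
  qed
  have c2Y: "cov U2 Y2 = \<beta> * v2"
  proof -
    have "cov U2 Y2 = 1 * cov Y1 Y2 + (- r) * cov Y0 Y2" unfolding U2_def by (rule cov_lin_left[OF Y(2,1,3)])
    then show ?thesis using m0 by (simp add: \<beta>)
  qed
  have c0P: "cov Y0 P = cov Y0 Y2" unfolding P_def using cov_lin_right[OF Y(1) U2 Y(1), of \<alpha> \<beta>] c02 as by simp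
  have c2P: "cov U2 P = cov U2 Y2" unfolding P_def using cov_lin_right[OF Y(1) U2 U2, of \<alpha> \<beta>] c02 c22 c2Y by (simp add: cov_commute)
  have c03: "cov Y0 U3 = 0" unfolding U3_def using cov_lin_right[OF Y(3) P Y(1), of 1 "-1"] c0P by simp
  have c23: "cov U2 U3 = 0" unfolding U3_def using cov_lin_right[OF Y(3) P U2, of 1 "-1"] c2P by simp
  have cP3: "cov P U3 = 0" unfolding P_def using cov_lin_left[OF Y(1) U2 U3, of \<alpha> \<beta>] c03 c23 by simp
  have c33: "cov U3 U3 \<le> e0"
  proof -
    have Y2e: "Y2 = (\<lambda>\<omega>. 1 * U3 \<omega> + 1 * P \<omega>)" by (simp add: U3_def)
    have "cov Y2 Y2 = cov U3 U3 + cov P P"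
      by (subst (1 2) Y2e) (subst cov_square_lin[OF U3 P], simp add: cov_commute cP3)
    then show ?thesis using cov_nonneg[of P] e0 by simp
  qed
  \<comment> \<open>\<open>f\<close> takes the residual \<open>U3\<close> only and \<open>H\<close>
    the pair \<open>(Y0, U2)\<close> only. Their product majorizes the singular summand of
    \<open>excess\<close>, and its expectation factors.\<close>
  define f where "f z = ennreal (2 * max 0 (z - c0 * u))" for z
  define q where "q x y \<longleftrightarrow> (1 - \<eta>) * u \<le> x \<and> x < u \<and> 0 \<le> y + r * x \<and> y + r * x \<le> u - x" for x y
  define H where "H z = ennreal (if q (fst z) (snd z) then 1 / (u - fst z) else 0)" for z :: "real \<times> real"
  have fm [measurable]: "f \<in> borel_measurable borel" unfolding f_def[abs_def] by measurable
  have Hm [measurable]: "H \<in> borel_measurable (borel \<Otimes>\<^sub>M borel)" unfolding H_def[abs_def] q_def by measurable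
  have Ef: "(\<integral>\<^sup>+\<omega>. f (U3 \<omega>) \<partial>M) \<le> ennreal (2 * (1 + 8 * e0) * sqrt 2 * exp (- ((c0 * u)\<^sup>2 / (8 * e0))))"
  proof -
    have "(\<integral>\<^sup>+\<omega>. f (U3 \<omega>) \<partial>M) \<le> (\<integral>\<^sup>+\<omega>. ennreal (if c0 * u \<le> U3 \<omega> then 2 * U3 \<omega> else 0) \<partial>M)"
      using c0 u unfolding f_def by (intro nn_integral_mono ennreal_leI) (auto simp: max_def)
    also have "\<dots> \<le> ennreal (2 * (1 + 8 * e0) * sqrt 2 * exp (- ((c0 * u)\<^sup>2 / (8 * e0))))"
      using c0 u by (intro nn_integral_upper_part_le U3 c33 e0) auto
    finally show ?thesis .
  qed
  have EH: "(\<integral>\<^sup>+x. (\<integral>\<^sup>+y. H (x, y) \<partial>cnormal (cov U2 U2)) \<partial>cnormal (cov Y0 Y0)) \<le>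
    ennreal (1 / sqrt m0) * ennreal (1 / sqrt \<eta> * exp (- ((1 - \<eta>) * ((1 - \<eta>) * u)\<^sup>2 / (2 * S))))"
  proof -
    \<comment> \<open>For fixed \<open>x\<close> the constraint confines \<open>U2\<close> to an
      interval of length \<open>u - x\<close>, whose probability cancels the singular factor
      \<open>1 / (u - x)\<close>.\<close>
    have inner: "(\<integral>\<^sup>+y. H (x, y) \<partial>cnormal (cov U2 U2)) \<le> ennreal (1 / sqrt m0) * indicator {(1 - \<eta>) * u..} x" for x
    proof (cases "(1 - \<eta>) * u \<le> x \<and> x < u")
      case True
      have "(\<integral>\<^sup>+y. H (x, y) \<partial>cnormal (cov U2 U2)) \<le> (\<integral>\<^sup>+y. ennreal (1 / (u - x)) * indicator {- r * x..u - x - r * x} y \<partial>cnormal v2)"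
        unfolding c22 using True by (intro nn_integral_mono) (auto simp: H_def q_def indicator_def)
      also have "\<dots> = ennreal (1 / (u - x)) * emeasure (cnormal v2) {- r * x..u - x - r * x}"
        by (subst nn_integral_cmult_indicator) auto
      also have "\<dots> \<le> ennreal (1 / (u - x)) * ennreal ((u - x) / sqrt v2)"
        using cnormal_interval_le[of v2 "- r * x" "u - x - r * x"] True m0 by (intro mult_left_mono) auto
      also have "\<dots> = ennreal (1 / sqrt v2)"
        using True m0 by (subst ennreal_mult[symmetric]) auto
      also have "\<dots> \<le> ennreal (1 / sqrt m0)"
        using m0 by (intro ennreal_leI divide_left_mono) auto
      finally show ?thesis using True by simp
    next
      case False
      then have "H (x, y) = 0" for y by (auto simp: H_def q_def)
      then show ?thesis by simp
    qed
    have "(\<integral>\<^sup>+x. (\<integral>\<^sup>+y. H (x, y) \<partial>cnormal (cov U2 U2)) \<partial>cnormal (cov Y0 Y0)) \<le>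
      (\<integral>\<^sup>+x. ennreal (1 / sqrt m0) * indicator {(1 - \<eta>) * u..} x \<partial>cnormal (cov Y0 Y0))"
      by (intro nn_integral_mono inner)
    also have "\<dots> = ennreal (1 / sqrt m0) * emeasure (cnormal (cov Y0 Y0)) {(1 - \<eta>) * u..}"
      by (subst nn_integral_cmult_indicator) auto
    also have "\<dots> \<le> ennreal (1 / sqrt m0) * ennreal (1 / sqrt \<eta> * exp (- ((1 - \<eta>) * ((1 - \<eta>) * u)\<^sup>2 / (2 * S))))"
      using s S \<eta> u by (intro mult_left_mono cnormal_upper_tail_le) auto
    finally show ?thesis .
  qed
  define g where "g x y z = (if (1 - \<eta>) * u \<le> x \<and> x < u \<and> 0 \<le> y \<and> y \<le> u - x then 2 * max 0 z / (u - x) else 0)" for x y z :: real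
  define w where "w = \<eta> * u / (2 * h)"
  define k where "k y = (if w \<le> y then 2 / (\<eta> * u) * y else 0)" for y
  have w: "0 \<le> w" using \<eta> u h by (simp add: w_def)
  have g0: "0 \<le> g x y z" for x y z by (simp add: g_def)
  have k0: "0 \<le> k y" for y using w \<eta> u by (simp add: k_def)
  have gm [measurable]: "(\<lambda>\<omega>. ennreal (g (Y0 \<omega>) (Y1 \<omega>) (Y2 \<omega>))) \<in> borel_measurable M" unfolding g_def by measurable
  have km [measurable]: "(\<lambda>\<omega>. ennreal (k (Y1 \<omega>))) \<in> borel_measurable M" unfolding k_def by measurable
  have pt: "ennreal (g (Y0 \<omega>) (Y1 \<omega>) (Y2 \<omega>)) \<le> f (U3 \<omega>) * H (Y0 \<omega>, U2 \<omega>)" for \<omega>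
  proof (cases "(1 - \<eta>) * u \<le> Y0 \<omega> \<and> Y0 \<omega> < u \<and> 0 \<le> Y1 \<omega> \<and> Y1 \<omega> \<le> u - Y0 \<omega>")
    case True
    \<comment> \<open>With \<open>Y0\<close> between \<open>u / 2\<close> and \<open>u\<close>, the
      term \<open>\<alpha> * Y0\<close> is at most \<open>- 2 * c0 * u\<close> and
      \<open>\<beta> * U2\<close> at most \<open>c0 * u\<close>, so a positive \<open>Y2\<close>
      forces \<open>U3\<close> above \<open>c0 * u\<close>.\<close>
    have "(1 - \<eta>) * u \<ge> 1 / 2 * u" using \<eta> u by (intro mult_right_mono) auto
    then have x: "u / 2 \<le> Y0 \<omega>" "\<bar>Y0 \<omega>\<bar> \<le> u" using True u by linarith+
    have y: "\<bar>Y1 \<omega>\<bar> \<le> \<eta> * u" using True by (simp add: algebra_simps)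
    have "\<bar>r * Y0 \<omega>\<bar> \<le> \<rho> * u" unfolding abs_mult using \<rho> x by (intro mult_mono) auto
    then have U2b: "\<bar>U2 \<omega>\<bar> \<le> (\<eta> + \<rho>) * u" using y by (simp add: U2_def algebra_simps)
    have "\<alpha> * Y0 \<omega> \<le> (- 4 * c0) * Y0 \<omega>" using c0 x u by (intro mult_right_mono) auto
    also have "\<dots> \<le> (- 4 * c0) * (u / 2)" using c0 x by (intro mult_left_mono_neg) auto
    finally have 1: "\<alpha> * Y0 \<omega> \<le> - 2 * c0 * u" by simp
    have "\<beta> * U2 \<omega> \<le> \<bar>\<beta>\<bar> * \<bar>U2 \<omega>\<bar>" by (simp add: abs_mult[symmetric])
    also have "\<dots> \<le> \<beta>0 * ((\<eta> + \<rho>) * u)" using \<beta>0 U2b by (intro mult_mono) auto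
    also have "\<dots> \<le> c0 * u" using mult_right_mono[OF \<beta>0(2), of u] u by (simp add: mult.assoc)
    finally have 2: "\<beta> * U2 \<omega> \<le> c0 * u" .
    have "Y2 \<omega> = \<alpha> * Y0 \<omega> + \<beta> * U2 \<omega> + U3 \<omega>" by (simp add: U3_def P_def)
    then have "Y2 \<omega> \<le> U3 \<omega> - c0 * u" using 1 2 by simp
    then have "max 0 (Y2 \<omega>) \<le> max 0 (U3 \<omega> - c0 * u)" by simp
    then have "g (Y0 \<omega>) (Y1 \<omega>) (Y2 \<omega>) \<le> 2 * max 0 (U3 \<omega> - c0 * u) * (1 / (u - Y0 \<omega>))"
      using True by (auto simp: g_def intro!: divide_right_mono)
    then have "ennreal (g (Y0 \<omega>) (Y1 \<omega>) (Y2 \<omega>)) \<le> f (U3 \<omega>) * ennreal (1 / (u - Y0 \<omega>))"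
      unfolding f_def using True by (subst ennreal_mult[symmetric]) (auto intro!: ennreal_leI)
    moreover have "q (Y0 \<omega>) (U2 \<omega>)" using True by (simp add: q_def U2_def)
    ultimately show ?thesis by (simp add: H_def)
  next
    case False
    then have "g (Y0 \<omega>) (Y1 \<omega>) (Y2 \<omega>) = 0" unfolding g_def by (simp only: if_False)
    then show ?thesis by simp
  qed
  have "(\<integral>\<^sup>+\<omega>. ennreal (excess \<eta> h u (Y0 \<omega>) (Y1 \<omega>) (Y2 \<omega>)) \<partial>M) =
    (\<integral>\<^sup>+\<omega>. ennreal (g (Y0 \<omega>) (Y1 \<omega>) (Y2 \<omega>)) + ennreal (k (Y1 \<omega>)) \<partial>M)"
  proof (intro nn_integral_cong)
    fix \<omega>
    have "excess \<eta> h u (Y0 \<omega>) (Y1 \<omega>) (Y2 \<omega>) = g (Y0 \<omega>) (Y1 \<omega>) (Y2 \<omega>) + k (Y1 \<omega>)"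
      by (simp add: excess_def g_def k_def w_def)
    then show "ennreal (excess \<eta> h u (Y0 \<omega>) (Y1 \<omega>) (Y2 \<omega>)) = ennreal (g (Y0 \<omega>) (Y1 \<omega>) (Y2 \<omega>)) + ennreal (k (Y1 \<omega>))"
      by (simp only: ennreal_plus[OF g0 k0])
  qed
  also have "\<dots> = (\<integral>\<^sup>+\<omega>. ennreal (g (Y0 \<omega>) (Y1 \<omega>) (Y2 \<omega>)) \<partial>M) + (\<integral>\<^sup>+\<omega>. ennreal (k (Y1 \<omega>)) \<partial>M)"
    by (rule nn_integral_add) measurable
  also have "\<dots> \<le> ennreal (2 * (1 + 8 * e0) * sqrt 2 * exp (- ((c0 * u)\<^sup>2 / (8 * e0)))) * 
      (ennreal (1 / sqrt m0) * ennreal (1 / sqrt \<eta> * exp (- ((1 - \<eta>) * ((1 - \<eta>) * u)\<^sup>2 / (2 * S))))) +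
    ennreal (2 / (\<eta> * u) * (1 + 8 * m1) * sqrt 2 * exp (- (w\<^sup>2 / (8 * m1))))"
  proof (rule add_mono)
    show "(\<integral>\<^sup>+\<omega>. ennreal (k (Y1 \<omega>)) \<partial>M) \<le> ennreal (2 / (\<eta> * u) * (1 + 8 * m1) * sqrt 2 * exp (- (w\<^sup>2 / (8 * m1))))"
      unfolding k_def using \<eta> u by (intro nn_integral_upper_part_le Y m1 w) auto
    have "(\<integral>\<^sup>+\<omega>. ennreal (g (Y0 \<omega>) (Y1 \<omega>) (Y2 \<omega>)) \<partial>M) \<le> (\<integral>\<^sup>+\<omega>. f (U3 \<omega>) * H (Y0 \<omega>, U2 \<omega>) \<partial>M)"
      by (intro nn_integral_mono pt)
    also have "\<dots> = (\<integral>\<^sup>+\<omega>. f (U3 \<omega>) \<partial>M) * (\<integral>\<^sup>+x. (\<integral>\<^sup>+y. H (x, y) \<partial>cnormal (cov U2 U2)) \<partial>cnormal (cov Y0 Y0))"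
      using Ef by (intro uncorrelated_nn_integral Y U2 U3 c02 c03 c23 fm Hm) (auto intro: le_less_trans)
    also have "\<dots> \<le> ennreal (2 * (1 + 8 * e0) * sqrt 2 * exp (- ((c0 * u)\<^sup>2 / (8 * e0)))) * 
      (ennreal (1 / sqrt m0) * ennreal (1 / sqrt \<eta> * exp (- ((1 - \<eta>) * ((1 - \<eta>) * u)\<^sup>2 / (2 * S)))))"
      by (intro mult_mono Ef EH) auto
    finally show "(\<integral>\<^sup>+\<omega>. ennreal (g (Y0 \<omega>) (Y1 \<omega>) (Y2 \<omega>)) \<partial>M) \<le> ennreal (2 * (1 + 8 * e0) * sqrt 2 * exp (- ((c0 * u)\<^sup>2 / (8 * e0)))) * 
      (ennreal (1 / sqrt m0) * ennreal (1 / sqrt \<eta> * exp (- ((1 - \<eta>) * ((1 - \<eta>) * u)\<^sup>2 / (2 * S)))))" .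
  qed
  also have "\<dots> = ennreal (2 * (1 + 8 * e0) * sqrt 2 * exp (- ((c0 * u)\<^sup>2 / (8 * e0))) * 
      (1 / sqrt m0 * (1 / sqrt \<eta> * exp (- ((1 - \<eta>) * ((1 - \<eta>) * u)\<^sup>2 / (2 * S))))) +
    2 / (\<eta> * u) * (1 + 8 * m1) * sqrt 2 * exp (- (w\<^sup>2 / (8 * m1))))"
    using m0 \<eta> e0 m1 u by (simp add: ennreal_mult[symmetric] ennreal_plus[symmetric] del: ennreal_plus)
  also have "\<dots> \<le> ennreal (2 * (1 + 8 * e0) * sqrt 2 / sqrt (m0 * \<eta>) * exp (- (c0\<^sup>2 / (8 * e0) + (1 - \<eta>) ^ 3 / (2 * S)) * u\<^sup>2) +
       2 / \<eta> * (1 + 8 * m1) * sqrt 2 * exp (- (\<eta> / (2 * h))\<^sup>2 / (8 * m1) * u\<^sup>2))"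
  proof (intro ennreal_leI add_mono)
    \<comment> \<open>Of the three factors \<open>1 - \<eta>\<close>, one comes from the tail bound
      and two from the lowered level \<open>(1 - \<eta>) * u\<close>.\<close>
    have ee: "exp (- ((c0 * u)\<^sup>2 / (8 * e0))) * exp (- ((1 - \<eta>) * ((1 - \<eta>) * u)\<^sup>2 / (2 * S))) = exp (- (c0\<^sup>2 / (8 * e0) + (1 - \<eta>) ^ 3 / (2 * S)) * u\<^sup>2)"
      by (simp add: exp_add[symmetric] power_mult_distrib power2_eq_square power3_eq_cube algebra_simps)
    have "2 * (1 + 8 * e0) * sqrt 2 * E * (1 / sqrt m0 * (1 / sqrt \<eta> * F)) = 2 * (1 + 8 * e0) * sqrt 2 / sqrt (m0 * \<eta>) * (E * F)" for E F
      by (simp add: real_sqrt_mult)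
    then show "2 * (1 + 8 * e0) * sqrt 2 * exp (- ((c0 * u)\<^sup>2 / (8 * e0))) * 
      (1 / sqrt m0 * (1 / sqrt \<eta> * exp (- ((1 - \<eta>) * ((1 - \<eta>) * u)\<^sup>2 / (2 * S))))) \<le> 2 * (1 + 8 * e0) * sqrt 2 / sqrt (m0 * \<eta>) * exp (- (c0\<^sup>2 / (8 * e0) + (1 - \<eta>) ^ 3 / (2 * S)) * u\<^sup>2)"
      unfolding ee[symmetric] by simp
    have "exp (- (w\<^sup>2 / (8 * m1))) = exp (- (\<eta> / (2 * h))\<^sup>2 / (8 * m1) * u\<^sup>2)"
      by (simp add: w_def power_mult_distrib power_divide)
    moreover have "2 / (\<eta> * u) \<le> 2 / \<eta>" using \<eta> u by (simp add: field_simps)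
    ultimately show "2 / (\<eta> * u) * (1 + 8 * m1) * sqrt 2 * exp (- (w\<^sup>2 / (8 * m1))) \<le> 2 / \<eta> * (1 + 8 * m1) * sqrt 2 * exp (- (\<eta> / (2 * h))\<^sup>2 / (8 * m1) * u\<^sup>2)"
      using m1 by (simp only:) (intro mult_right_mono, auto)
  qed
  finally show ?thesis .
qed

end

section \<open>Behaviour near the maximum of the variance\<close>

text \<open>At the earliest time with a value at least \<open>u\<close> the slope cannot be
  negative, since otherwise earlier values would be larger.\<close>

lemma (in C2_function) first_hit:
  assumes "a < b" "f a < u" "\<exists>t\<in>{a..b}. u \<le> f t"
  shows "\<exists>t\<in>{a<..b}. f t = u \<and> 0 \<le> f1 t"
proof -
  obtain t' where t': "t' \<in> {a..b}" "f t' \<in> {u..}" using assms(3) by auto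
  obtain t where t: "t \<in> {a..b}" "u \<le> f t" and tm: "\<And>s. s \<in> {a..b} \<Longrightarrow> u \<le> f s \<Longrightarrow> t \<le> s"
    using first_and_last_time(1)[OF cont0 closed_atLeast t'] by auto
  have "continuous_on {a..t} f" using cont0 by (rule continuous_on_subset) (use t in auto)
  then obtain s where s: "a \<le> s" "s \<le> t" "f s = u" using IVT'[of f a u t] t assms by auto
  then have "t \<le> s" using t by (intro tm) auto
  then have ft: "f t = u" using s by simp
  have "0 \<le> f1 t"
  proof (rule ccontr)
    assume "\<not> 0 \<le> f1 t"
    then obtain d where d: "0 < d" "\<And>h. 0 < h \<Longrightarrow> t - h \<in> {a..b} \<Longrightarrow> h < d \<Longrightarrow> f t < f (t - h)"
      using has_real_derivative_neg_dec_left[OF D1[OF t(1)]] by auto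
    have at: "a < t" using t assms ft by (cases "t = a") auto
    define h where "h = min (d / 2) ((t - a) / 2)"
    have h: "0 < h" "h < d" "t - h \<in> {a..b}" using d(1) at t by (auto simp: h_def min_def field_simps)
    have "t \<le> t - h" using d(2)[OF h(1,3,2)] ft h by (intro tm) auto
    then show False using h by simp
  qed
  moreover have "a < t" using t assms ft by (cases "t = a") auto
  ultimately show ?thesis using t ft by auto
qed

lemma (in C2_function) last_hit:
  assumes "a < b" "f b < u" "\<exists>t\<in>{a..b}. u \<le> f t"
  shows "\<exists>t\<in>{a..<b}. f t = u \<and> f1 t \<le> 0"
proof -
  obtain t' where t': "t' \<in> {a..b}" "f t' \<in> {u..}" using assms(3) by auto
  obtain t where t: "t \<in> {a..b}" "u \<le> f t" and tm: "\<And>s. s \<in> {a..b} \<Longrightarrow> u \<le> f s \<Longrightarrow> s \<le> t"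
    using first_and_last_time(2)[OF cont0 closed_atLeast t'] by auto
  have "continuous_on {t..b} f" using cont0 by (rule continuous_on_subset) (use t in auto)
  then obtain s where s: "t \<le> s" "s \<le> b" "f s = u" using IVT2'[of f b u t] t assms by auto
  then have "s \<le> t" using t by (intro tm) auto
  then have ft: "f t = u" using s by simp
  have "f1 t \<le> 0"
  proof (rule ccontr)
    assume "\<not> f1 t \<le> 0"
    then obtain d where d: "0 < d" "\<And>h. 0 < h \<Longrightarrow> t + h \<in> {a..b} \<Longrightarrow> h < d \<Longrightarrow> f t < f (t + h)"
      using has_real_derivative_pos_inc_right[OF D1[OF t(1)]] by auto
    have at: "t < b" using t assms ft by (cases "t = b") auto
    define h where "h = min (d / 2) ((b - t) / 2)"
    have h: "0 < h" "h < d" "t + h \<in> {a..b}" using d(1) at t by (auto simp: h_def min_def field_simps)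
    have "t + h \<le> t" using d(2)[OF h(1,3,2)] ft h by (intro tm) auto
    then show False using h by simp
  qed
  moreover have "t < b" using t assms ft by (cases "t = b") auto
  ultimately show ?thesis using t ft by auto
qed

text \<open>This is negligibility in the sense of the overview, with a gain \<open>\<kappa>\<close>
  that may differ between errors. Only an upper bound is recorded, so \<open>e\<close> may take
  negative values.\<close>

definition small :: "real \<Rightarrow> (real \<Rightarrow> real) \<Rightarrow> bool" where
  "small S e \<longleftrightarrow> (\<exists>K \<kappa>. 0 \<le> K \<and> 0 < \<kappa> \<and> (\<forall>u\<ge>1. e u \<le> K * exp (- ((1 + \<kappa>) * u\<^sup>2 / (2 * S)))))"

lemma small_add:
  assumes "0 < S" "small S e" "small S f" shows "small S (\<lambda>u. e u + f u)"
proof -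
  obtain K \<kappa> where e: "0 \<le> K" "0 < \<kappa>" "\<And>u. 1 \<le> u \<Longrightarrow> e u \<le> K * exp (- ((1 + \<kappa>) * u\<^sup>2 / (2 * S)))"
    using assms(2) by (auto simp: small_def)
  obtain L \<mu> where f: "0 \<le> L" "0 < \<mu>" "\<And>u. 1 \<le> u \<Longrightarrow> f u \<le> L * exp (- ((1 + \<mu>) * u\<^sup>2 / (2 * S)))"
    using assms(3) by (auto simp: small_def)
  have mono: "exp (- ((1 + \<nu>) * u\<^sup>2 / (2 * S))) \<le> exp (- ((1 + \<xi>) * u\<^sup>2 / (2 * S)))" if "\<xi> \<le> \<nu>" for \<xi> \<nu> u
    using that assms(1) by (auto intro!: divide_right_mono mult_right_mono)
  have "e u + f u \<le> (K + L) * exp (- ((1 + min \<kappa> \<mu>) * u\<^sup>2 / (2 * S)))" if "1 \<le> u" for u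
    using e(3)[OF that] f(3)[OF that] mult_left_mono[OF mono[of "min \<kappa> \<mu>" \<kappa> u] e(1)] mult_left_mono[OF mono[of "min \<kappa> \<mu>" \<mu> u] f(1)]
    by (simp add: distrib_right)
  then show ?thesis unfolding small_def using e f by (intro exI[of _ "K + L"] exI[of _ "min \<kappa> \<mu>"]) auto
qed

lemma (in gauss_space) cov_add_le:
  assumes "Y \<in> G" "Z \<in> G"
  shows "cov (\<lambda>\<omega>. Y \<omega> + Z \<omega>) (\<lambda>\<omega>. Y \<omega> + Z \<omega>) \<le> 2 * cov Y Y + 2 * cov Z Z"
  using cov_square_lin[OF assms, of 1 1] cov_square_lin[OF assms, of 1 "-1"] cov_nonneg[of "\<lambda>\<omega>. 1 * Y \<omega> + -1 * Z \<omega>"]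
  by simp

text \<open>The event itself may fail to be measurable, so it is covered, up to a null set, by a
  measurable set of negligible probability.\<close>

definition (in prob_space) tail_small :: "real \<Rightarrow> (real \<Rightarrow> 'a \<Rightarrow> bool) \<Rightarrow> bool" where
  "tail_small S P \<longleftrightarrow> (\<exists>e. small S e \<and>
    (\<forall>u\<ge>1. \<exists>F\<in>sets M. prob F \<le> e u \<and> (AE \<omega> in M. P u \<omega> \<longrightarrow> \<omega> \<in> F)))"

lemma (in prob_space) tail_smallD:
  assumes "tail_small S P"
  shows "\<exists>e F. small S e \<and> (\<forall>u\<ge>1. F u \<in> sets M) \<and> (\<forall>u\<ge>1. prob (F u) \<le> e u) \<and>
    (\<forall>u\<ge>1. AE \<omega> in M. P u \<omega> \<longrightarrow> \<omega> \<in> F u)"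
  using assms unfolding tail_small_def by metis

lemma (in gauss_space) sup_tail_small:
  assumes "c < d" "0 < S" "v < S"
    and "\<And>t. t \<in> {c..d} \<Longrightarrow> Y t \<in> G"
    and "\<And>t. t \<in> {c..d} \<Longrightarrow> cov (Y t) (Y t) \<le> v"
    and "\<And>s t. s \<in> {c..d} \<Longrightarrow> t \<in> {c..d} \<Longrightarrow> cov (\<lambda>\<omega>. Y t \<omega> - Y s \<omega>) (\<lambda>\<omega>. Y t \<omega> - Y s \<omega>) \<le> C * (t - s)\<^sup>2"
    and "AE \<omega> in M. continuous_on {c..d} (\<lambda>t. Y t \<omega>)"
  shows "tail_small S (\<lambda>u \<omega>. (\<exists>t\<in>{c..d}. u \<le> \<bar>Y t \<omega>\<bar>))"
proof -
  obtain K \<kappa> where *: "0 \<le> K" "0 < \<kappa>" "\<And>u. 0 \<le> u \<Longrightarrow> \<exists>F\<in>sets M. prob F \<le> K * exp (- ((1 + \<kappa>) * u\<^sup>2 / (2 * S))) \<and>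
    (AE \<omega> in M. (\<exists>t\<in>{c..d}. u \<le> \<bar>Y t \<omega>\<bar>) \<longrightarrow> \<omega> \<in> F)"
    using sup_tail[where c=c and d=d and S=S and v=v and Y=Y and C=C] assms by blast
  then show ?thesis unfolding tail_small_def
    by (intro exI[of _ "\<lambda>u. K * exp (- ((1 + \<kappa>) * u\<^sup>2 / (2 * S)))"]) (auto simp: small_def)
qed

section \<open>The variance function at its unique maximum\<close>

locale C2_gauss_max = C2_gauss_process +
  fixes t0 S :: real
  assumes t0: "t0 \<in> {A..B}"
    and S_def: "S = cov (x0 t0) (x0 t0)"
    and max: "\<And>t. t \<in> {A..B} \<Longrightarrow> t \<noteq> t0 \<Longrightarrow> cov (x0 t) (x0 t) < S"
begin

lemma S_pos: "0 < S"
proof -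
  have "\<exists>t\<in>{A..B}. t \<noteq> t0"
    using AB by (cases "t0 = A") (auto intro: bexI[of _ A] bexI[of _ B])
  then show ?thesis using max cov_nonneg le_less_trans by blast
qed

lemma var_le: "t \<in> {A..B} \<Longrightarrow> cov (x0 t) (x0 t) \<le> S"
  using max S_def by (cases "t = t0") (auto intro: less_imp_le)

lemma var_derivative:
  "t \<in> {A..B} \<Longrightarrow> ((\<lambda>s. cov (x0 s) (x0 s)) has_real_derivative 2 * cov (x0 t) (x1 t)) (at t within {A..B})"
  using cov_has_derivative[where P=x0 and P'=x1 and Q=x0 and Q'=x1 and t=t and T="{A..B}"] xG xD1
  by (simp add: cov_commute)

lemma cov01_derivative:
  "t \<in> {A..B} \<Longrightarrow> ((\<lambda>s. cov (x0 s) (x1 s)) has_real_derivative cov (x1 t) (x1 t) + cov (x0 t) (x2 t)) (at t within {A..B})"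
  using cov_has_derivative[where P=x0 and P'=x1 and Q=x1 and Q'=x2 and t=t and T="{A..B}"] xG xD1 xD2 by simp

lemma isCont_cov:
  "isCont (\<lambda>t. cov (x0 t) (x0 t)) t" "isCont (\<lambda>t. cov (x0 t) (x1 t)) t" "isCont (\<lambda>t. cov (x1 t) (x1 t)) t"
  "isCont (\<lambda>t. cov (x0 t) (x2 t)) t" "isCont (\<lambda>t. cov (x1 t) (x2 t)) t" "isCont (\<lambda>t. cov (x2 t) (x2 t)) t"
  using xG isCont_x by (intro cov_isCont; simp)+

lemma cov_bounded:
  assumes "\<And>t. isCont f t" shows "\<exists>C\<ge>0. \<forall>t\<in>{A..B}. \<bar>f t\<bar> \<le> (C::real)"
proof -
  have "bounded (f ` {A..B})"
    using assms by (intro compact_imp_bounded compact_continuous_image continuous_at_imp_continuous_on) auto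
  then obtain C where C: "\<forall>y\<in>f ` {A..B}. \<bar>y\<bar> \<le> C" by (auto simp: bounded_iff)
  then have "0 \<le> C" using AB abs_ge_zero[of "f A"] by force
  then show ?thesis using C by auto
qed

text \<open>\<open>cov (x0 t) (x1 t)\<close> is half the derivative of the variance, and its sign at
  \<open>t0\<close> is constrained from each side that belongs to the interval.\<close>

lemma cov01_at_max:
  shows "t0 < B \<Longrightarrow> cov (x0 t0) (x1 t0) \<le> 0" and "A < t0 \<Longrightarrow> 0 \<le> cov (x0 t0) (x1 t0)"
proof -
  assume "t0 < B"
  show "cov (x0 t0) (x1 t0) \<le> 0"
  proof (rule ccontr)
    assume "\<not> cov (x0 t0) (x1 t0) \<le> 0"
    then obtain d where d: "0 < d" "\<And>h. 0 < h \<Longrightarrow> t0 + h \<in> {A..B} \<Longrightarrow> h < d \<Longrightarrow> cov (x0 t0) (x0 t0) < cov (x0 (t0 + h)) (x0 (t0 + h))"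
      using has_real_derivative_pos_inc_right[OF var_derivative[OF t0]] by auto
    define h where "h = min (d / 2) (B - t0)"
    have h: "0 < h" "h < d" "t0 + h \<in> {A..B}" using d t0 \<open>t0 < B\<close> by (auto simp: h_def)
    show False using d(2)[OF h(1,3,2)] var_le[OF h(3)] S_def by simp
  qed
next
  assume "A < t0"
  show "0 \<le> cov (x0 t0) (x1 t0)"
  proof (rule ccontr)
    assume "\<not> 0 \<le> cov (x0 t0) (x1 t0)"
    then obtain d where d: "0 < d" "\<And>h. 0 < h \<Longrightarrow> t0 - h \<in> {A..B} \<Longrightarrow> h < d \<Longrightarrow> cov (x0 t0) (x0 t0) < cov (x0 (t0 - h)) (x0 (t0 - h))"
      using has_real_derivative_neg_dec_left[OF var_derivative[OF t0]] by auto
    define h where "h = min (d / 2) (t0 - A)"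
    have h: "0 < h" "h < d" "t0 - h \<in> {A..B}" using d t0 \<open>A < t0\<close> by (auto simp: h_def)
    show False using d(2)[OF h(1,3,2)] var_le[OF h(3)] S_def by simp
  qed
qed

text \<open>The left side is half the second derivative of the variance. Were it positive, the first
  derivative, zero at \<open>t0\<close>, would have the sign of \<open>t - t0\<close> nearby and the
  variance would exceed its maximum. One side of \<open>t0\<close> is enough for the contradiction,
  so end points are included.\<close>

lemma curvature_at_max:
  assumes b0: "cov (x0 t0) (x1 t0) = 0"
  shows "cov (x1 t0) (x1 t0) + cov (x0 t0) (x2 t0) \<le> 0"
proof (rule ccontr)
  assume "\<not> ?thesis"
  then have pos: "0 < cov (x1 t0) (x1 t0) + cov (x0 t0) (x2 t0)" by simp
  have mv: "\<exists>\<xi>\<in>{s<..<t}. cov (x0 t) (x0 t) - cov (x0 s) (x0 s) = 2 * cov (x0 \<xi>) (x1 \<xi>) * (t - s)"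
    if "A \<le> s" "s < t" "t \<le> B" for s t
  proof -
    have "\<exists>\<xi>\<in>{s<..<t}. (\<lambda>v. cov (x0 v) (x0 v)) t - (\<lambda>v. cov (x0 v) (x0 v)) s = 2 * cov (x0 \<xi>) (x1 \<xi>) * (t - s)"
    proof (rule mvt_simple[OF \<open>s < t\<close>])
      fix v assume "s \<le> v" "v \<le> t"
      then show "((\<lambda>v. cov (x0 v) (x0 v)) has_derivative (*) (2 * cov (x0 v) (x1 v))) (at v within {s..t})"
        using DERIV_subset[OF var_derivative[of v], of "{s..t}"] that by (auto simp: has_field_derivative_def)
    qed
    then show ?thesis by simp
  qed
  show False
  proof (cases "t0 < B")
    case True
    obtain d where d: "0 < d" "\<And>h. 0 < h \<Longrightarrow> t0 + h \<in> {A..B} \<Longrightarrow> h < d \<Longrightarrow> cov (x0 t0) (x1 t0) < cov (x0 (t0 + h)) (x1 (t0 + h))"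
      using has_real_derivative_pos_inc_right[OF cov01_derivative[OF t0] pos] by auto
    define t where "t = min (t0 + d / 2) B"
    have t: "t0 < t" "t < t0 + d" "t \<le> B" using d True by (auto simp: t_def)
    obtain \<xi> where \<xi>: "\<xi> \<in> {t0<..<t}" "cov (x0 t) (x0 t) - cov (x0 t0) (x0 t0) = 2 * cov (x0 \<xi>) (x1 \<xi>) * (t - t0)"
      using mv[of t0 t] t t0 by auto
    have "0 < cov (x0 \<xi>) (x1 \<xi>)" using d(2)[of "\<xi> - t0"] \<xi>(1) t t0 b0 by auto
    then have "0 < 2 * cov (x0 \<xi>) (x1 \<xi>) * (t - t0)" using t by simp
    moreover have "cov (x0 t) (x0 t) \<le> cov (x0 t0) (x0 t0)" using var_le[of t] t t0 S_def by auto
    ultimately show False using \<xi>(2) by linarith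
  next
    case False
    then have tB: "t0 = B" "A < t0" using t0 AB by auto
    obtain d where d: "0 < d" "\<And>h. 0 < h \<Longrightarrow> t0 - h \<in> {A..B} \<Longrightarrow> h < d \<Longrightarrow> cov (x0 (t0 - h)) (x1 (t0 - h)) < cov (x0 t0) (x1 t0)"
      using has_real_derivative_pos_inc_left[OF cov01_derivative[OF t0] pos] by auto
    define t where "t = max (t0 - d / 2) A"
    have t: "t < t0" "t0 - d < t" "A \<le> t" using d tB by (auto simp: t_def)
    obtain \<xi> where \<xi>: "\<xi> \<in> {t<..<t0}" "cov (x0 t0) (x0 t0) - cov (x0 t) (x0 t) = 2 * cov (x0 \<xi>) (x1 \<xi>) * (t0 - t)"
      using mv[of t t0] t t0 by auto
    have "cov (x0 \<xi>) (x1 \<xi>) < 0" using d(2)[of "t0 - \<xi>"] \<xi>(1) t t0 b0 by auto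
    then have "2 * cov (x0 \<xi>) (x1 \<xi>) * (t0 - t) < 0" using t by (simp add: mult_neg_pos)
    moreover have "cov (x0 t) (x0 t) \<le> cov (x0 t0) (x0 t0)" using var_le[of t] t t0 S_def by auto
    ultimately show False using \<xi>(2) by linarith
  qed
qed

text \<open>The Gram--Schmidt coefficients are continuous at \<open>t0\<close> and satisfy strict
  inequalities there, hence also on a neighbourhood. Fubini's theorem then integrates the uniform
  estimate at single times.\<close>

lemma expected_excess_small:
  assumes b0: "cov (x0 t0) (x1 t0) = 0" and m: "0 < cov (x1 t0) (x1 t0)"
  shows "\<exists>\<eta> h e. 0 < \<eta> \<and> 0 < h \<and> h \<le> 1 / 2 \<and> small S e \<and>
    (\<forall>t. \<bar>t - t0\<bar> \<le> h \<longrightarrow> S / 2 \<le> cov (x0 t) (x0 t)) \<and>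
    (\<forall>a b u. a \<le> t0 \<and> t0 \<le> b \<and> b - a \<le> h \<and> 1 \<le> u \<longrightarrow>
      (\<integral>\<^sup>+\<omega>. (\<integral>\<^sup>+v. indicator {a..b} v * ennreal (excess \<eta> h u (x0 v \<omega>) (x1 v \<omega>) (x2 v \<omega>)) \<partial>lborel) \<partial>M) \<le> ennreal (e u))"
proof -
  define m' where "m' = cov (x1 t0) (x1 t0)"
  define s where "s t = cov (x0 t) (x0 t)" for t
  define r where "r t = cov (x0 t) (x1 t) / s t" for t
  define v2 where "v2 t = cov (x1 t) (x1 t) - r t * cov (x0 t) (x1 t)" for t
  define \<alpha> where "\<alpha> t = cov (x0 t) (x2 t) / s t" for t
  define \<beta> where "\<beta> t = (cov (x1 t) (x2 t) - r t * cov (x0 t) (x2 t)) / v2 t" for t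
  have S: "0 < S" by (rule S_pos)
  have m': "0 < m'" using m by (simp add: m'_def)
  have at0: "s t0 = S" "r t0 = 0" "v2 t0 = m'" by (simp_all add: s_def r_def v2_def S_def b0 m'_def)
  have c: "cov (x0 t0) (x2 t0) \<le> - m'" using curvature_at_max[OF b0] by (simp add: m'_def)
  have cs: "isCont s t0" unfolding s_def by (rule isCont_cov)
  have cr: "isCont r t0" unfolding r_def using at0 S by (intro continuous_intros isCont_cov cs) simp
  have cv: "isCont v2 t0" unfolding v2_def by (intro continuous_intros isCont_cov cr)
  have ca: "isCont \<alpha> t0" unfolding \<alpha>_def using at0 S by (intro continuous_intros isCont_cov cs) simp
  have cb: "isCont \<beta> t0" unfolding \<beta>_def using at0 m' by (intro continuous_intros isCont_cov cr cv) simp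
  \<comment> \<open>The curvature at the maximum gives
    \<open>\<alpha> t0 \<le> - m' / S = - 8 * c0\<close>, so the bound by \<open>- 4 * c0\<close>
    persists nearby.\<close>
  define c0 where "c0 = m' / (8 * S)"
  define m0 where "m0 = m' / 2"
  define m1 where "m1 = m' + 1"
  define e0 where "e0 = cov (x2 t0) (x2 t0) + 1"
  define \<beta>0 where "\<beta>0 = \<bar>\<beta> t0\<bar> + 1"
  define \<rho> where "\<rho> = c0 / (2 * \<beta>0)"
  \<comment> \<open>The gain in the exponent due to the residual of the second derivative, in units
    of \<open>1 / (2 * S)\<close>. As \<open>(1 - \<eta>) ^ 3 \<ge> 1 - 3 * \<eta>\<close>, the
    choice \<open>\<eta> \<le> \<kappa>1 / 6\<close> spends at most half of it, and
    \<open>\<kappa> = \<kappa>1 / 2\<close> remains.\<close>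
  define \<kappa>1 where "\<kappa>1 = 2 * S * (c0\<^sup>2 / (8 * e0))"
  define \<eta> where "\<eta> = min (1 / 2) (min (\<kappa>1 / 6) (c0 / (2 * \<beta>0)))"
  define \<kappa> where "\<kappa> = \<kappa>1 / 2"
  have c0: "0 < c0" using m' S by (simp add: c0_def)
  have e0: "0 < e0" using cov_nonneg[of "x2 t0"] by (simp add: e0_def)
  have \<beta>0: "0 < \<beta>0" by (simp add: \<beta>0_def add_nonneg_pos)
  have \<rho>: "0 < \<rho>" using c0 \<beta>0 by (simp add: \<rho>_def)
  have \<kappa>1: "0 < \<kappa>1" using S c0 e0 by (simp add: \<kappa>1_def)
  have \<eta>: "0 < \<eta>" "\<eta> \<le> 1 / 2" "\<eta> \<le> \<kappa>1 / 6" "\<eta> \<le> c0 / (2 * \<beta>0)" using \<kappa>1 c0 \<beta>0 by (auto simp: \<eta>_def)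
  have \<beta>\<rho>: "\<beta>0 * (\<eta> + \<rho>) \<le> c0"
  proof -
    have "\<beta>0 * (\<eta> + \<rho>) \<le> \<beta>0 * (c0 / (2 * \<beta>0) + c0 / (2 * \<beta>0))"
      using \<eta> \<beta>0 by (intro mult_left_mono) (auto simp: \<rho>_def)
    then show ?thesis using \<beta>0 by (simp add: field_simps)
  qed
  have "\<alpha> t0 \<le> - (m' / S)" using divide_right_mono[OF c, of S] S at0 by (simp add: \<alpha>_def)
  then have \<alpha>0: "\<alpha> t0 < - 4 * c0" using m' S by (simp add: c0_def field_simps)
  have "\<forall>\<^sub>F t in nhds t0. S / 2 < s t \<and> \<bar>r t\<bar> < \<rho> \<and> m0 < v2 t \<and> \<alpha> t < - 4 * c0 \<and> \<bar>\<beta> t\<bar> < \<beta>0 \<and>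
      cov (x2 t) (x2 t) < e0 \<and> cov (x1 t) (x1 t) < m1"
  proof (intro eventually_conj)
    have lim: "filterlim f (nhds (f t0)) (nhds t0)" if "isCont f t0" for f :: "real \<Rightarrow> real"
      using that by (simp add: isCont_def tendsto_at_iff_tendsto_nhds)
    show "\<forall>\<^sub>F t in nhds t0. S / 2 < s t" using order_tendstoD(1)[OF lim[OF cs], of "S / 2"] at0 S by simp
    show "\<forall>\<^sub>F t in nhds t0. \<bar>r t\<bar> < \<rho>" using order_tendstoD(2)[OF tendsto_rabs[OF lim[OF cr]], of \<rho>] at0 \<rho> by simp
    show "\<forall>\<^sub>F t in nhds t0. m0 < v2 t" using order_tendstoD(1)[OF lim[OF cv], of m0] at0 m' by (simp add: m0_def)
    show "\<forall>\<^sub>F t in nhds t0. \<alpha> t < - 4 * c0" using order_tendstoD(2)[OF lim[OF ca] \<alpha>0] .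
    show "\<forall>\<^sub>F t in nhds t0. \<bar>\<beta> t\<bar> < \<beta>0" using order_tendstoD(2)[OF tendsto_rabs[OF lim[OF cb]], of \<beta>0] by (simp add: \<beta>0_def)
    show "\<forall>\<^sub>F t in nhds t0. cov (x2 t) (x2 t) < e0" using order_tendstoD(2)[OF lim[OF isCont_cov(6)], of e0] by (simp add: e0_def)
    show "\<forall>\<^sub>F t in nhds t0. cov (x1 t) (x1 t) < m1" using order_tendstoD(2)[OF lim[OF isCont_cov(3)], of m1] by (simp add: m1_def m'_def)
  qed
  then obtain d where d: "0 < d" and near: "\<And>t. dist t t0 < d \<Longrightarrow> S / 2 < s t \<and> \<bar>r t\<bar> < \<rho> \<and> m0 < v2 t \<and> \<alpha> t < - 4 * c0 \<and> \<bar>\<beta> t\<bar> < \<beta>0 \<and>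
      cov (x2 t) (x2 t) < e0 \<and> cov (x1 t) (x1 t) < m1"
    unfolding eventually_nhds_metric by blast
  \<comment> \<open>Short intervals make deep excursions steep: with
    \<open>h \<le> \<eta> / (2 * sqrt L)\<close> the tail of the slope beyond
    \<open>\<eta> * u / (2 * h)\<close> has at least the exponent
    \<open>(1 + \<kappa>) / (2 * S)\<close>.\<close>
  define L where "L = (1 + \<kappa>) / (2 * S) * (8 * m1)"
  have L: "0 < L" using \<kappa>1 S m' by (simp add: L_def \<kappa>_def m1_def)
  define h where "h = min (1 / 2) (min (d / 2) (\<eta> / (2 * sqrt L)))"
  have h: "0 < h" "h \<le> 1 / 2" "h \<le> d / 2" "h \<le> \<eta> / (2 * sqrt L)" using d \<eta> L by (auto simp: h_def)
  have ex1: "(1 + \<kappa>) / (2 * S) \<le> (\<eta> / (2 * h))\<^sup>2 / (8 * m1)"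
  proof -
    have "sqrt L \<le> \<eta> / (2 * h)" using h L by (simp add: field_simps)
    then have "(sqrt L)\<^sup>2 \<le> (\<eta> / (2 * h))\<^sup>2" using L by (intro power_mono) auto
    then have "L \<le> (\<eta> / (2 * h))\<^sup>2" using L by simp
    then have "L / (8 * m1) \<le> (\<eta> / (2 * h))\<^sup>2 / (8 * m1)" using m' by (intro divide_right_mono) (auto simp: m1_def)
    then show ?thesis using m' by (simp add: L_def m1_def)
  qed
  have ex2: "(1 + \<kappa>) / (2 * S) \<le> c0\<^sup>2 / (8 * e0) + (1 - \<eta>) ^ 3 / (2 * S)"
  proof -
    have "(1 - \<eta>) ^ 3 = 1 - 3 * \<eta> + \<eta>\<^sup>2 * (3 - \<eta>)" by (simp add: power3_eq_cube power2_eq_square algebra_simps)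
    moreover have "0 \<le> \<eta>\<^sup>2 * (3 - \<eta>)" using \<eta> by simp
    ultimately have "1 - \<kappa>1 / 2 \<le> (1 - \<eta>) ^ 3" using \<eta> by linarith
    then have "(1 - \<kappa>1 / 2) / (2 * S) \<le> (1 - \<eta>) ^ 3 / (2 * S)" using S by (intro divide_right_mono) auto
    moreover have "(1 + \<kappa>) / (2 * S) = c0\<^sup>2 / (8 * e0) + (1 - \<kappa>1 / 2) / (2 * S)"
      using S by (simp add: \<kappa>_def \<kappa>1_def add_divide_distrib diff_divide_distrib)
    ultimately show ?thesis by simp
  qed
  define K where "K = 2 * (1 + 8 * e0) * sqrt 2 / sqrt (m0 * \<eta>) + 2 / \<eta> * (1 + 8 * m1) * sqrt 2"
  have K12: "0 \<le> 2 * (1 + 8 * e0) * sqrt 2 / sqrt (m0 * \<eta>)" "0 \<le> 2 / \<eta> * (1 + 8 * m1) * sqrt 2"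
    using e0 m' \<eta> by (auto simp: m0_def m1_def)
  define e where "e u = K * exp (- ((1 + \<kappa>) * u\<^sup>2 / (2 * S)))" for u
  have sm: "small S e" unfolding small_def e_def using K12 \<kappa>1 by (intro exI[of _ K] exI[of _ \<kappa>]) (auto simp: K_def \<kappa>_def)
  have E: "(\<integral>\<^sup>+\<omega>. ennreal (excess \<eta> h u (x0 t \<omega>) (x1 t \<omega>) (x2 t \<omega>)) \<partial>M) \<le> ennreal (e u)"
    if t: "\<bar>t - t0\<bar> \<le> h" and u: "1 \<le> u" for t u
  proof -
    note n = near[of t, simplified dist_real_def]
    have td: "\<bar>t - t0\<bar> < d" using t h d by linarith
    \<comment> \<open>Here \<open>t\<close> may lie outside \<open>{A..B}\<close>; the constant
      continuation of the paths preserves the bound.\<close>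
    have clamp': "cov (x0 t) (x0 t) \<le> S"
    proof -
      have "cov (x0 t) (x0 t) = cov (x0 (max A (min B t))) (x0 (max A (min B t)))" by (simp only: clamp)
      also have "\<dots> \<le> S" using AB by (intro var_le) auto
      finally show ?thesis .
    qed
    have spos: "0 < cov (x0 t) (x0 t)" using n[OF td] S unfolding s_def by linarith
    have "(\<integral>\<^sup>+\<omega>. ennreal (excess \<eta> h u (x0 t \<omega>) (x1 t \<omega>) (x2 t \<omega>)) \<partial>M) \<le>
      ennreal (2 * (1 + 8 * e0) * sqrt 2 / sqrt (m0 * \<eta>) * exp (- (c0\<^sup>2 / (8 * e0) + (1 - \<eta>) ^ 3 / (2 * S)) * u\<^sup>2) +
       2 / \<eta> * (1 + 8 * m1) * sqrt 2 * exp (- (\<eta> / (2 * h))\<^sup>2 / (8 * m1) * u\<^sup>2))"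
    proof (rule nn_integral_excess_le)
      show "x0 t \<in> G" "x1 t \<in> G" "x2 t \<in> G" by (rule xG)+
      show "0 < cov (x0 t) (x0 t)" "cov (x0 t) (x0 t) \<le> S" by fact+
      show "r t = cov (x0 t) (x1 t) / cov (x0 t) (x0 t)" by (simp add: r_def s_def)
      show "v2 t = cov (x1 t) (x1 t) - r t * cov (x0 t) (x1 t)" by (rule v2_def)
      show "\<alpha> t = cov (x0 t) (x2 t) / cov (x0 t) (x0 t)" by (simp add: \<alpha>_def s_def)
      show "\<beta> t = (cov (x1 t) (x2 t) - r t * cov (x0 t) (x2 t)) / v2 t" by (rule \<beta>_def)
      show "0 < m0" "0 < m1" using m' by (simp_all add: m0_def m1_def)
      show "\<beta>0 * (\<eta> + \<rho>) \<le> c0" by (rule \<beta>\<rho>)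
    qed (use n[OF td] \<eta> e0 h u c0 in auto)
    also have "\<dots> \<le> ennreal (2 * (1 + 8 * e0) * sqrt 2 / sqrt (m0 * \<eta>) * exp (- ((1 + \<kappa>) * u\<^sup>2 / (2 * S))) +
       2 / \<eta> * (1 + 8 * m1) * sqrt 2 * exp (- ((1 + \<kappa>) * u\<^sup>2 / (2 * S))))"
    proof (intro ennreal_leI add_mono mult_left_mono K12)
      have "(1 + \<kappa>) / (2 * S) * u\<^sup>2 \<le> (c0\<^sup>2 / (8 * e0) + (1 - \<eta>) ^ 3 / (2 * S)) * u\<^sup>2" using ex2 by (rule mult_right_mono) simp
      then show "exp (- (c0\<^sup>2 / (8 * e0) + (1 - \<eta>) ^ 3 / (2 * S)) * u\<^sup>2) \<le> exp (- ((1 + \<kappa>) * u\<^sup>2 / (2 * S)))"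
        unfolding exp_le_cancel_iff mult_minus_left by simp
      have "(1 + \<kappa>) / (2 * S) * u\<^sup>2 \<le> (\<eta> / (2 * h))\<^sup>2 / (8 * m1) * u\<^sup>2" using ex1 by (rule mult_right_mono) simp
      then show "exp (- (\<eta> / (2 * h))\<^sup>2 / (8 * m1) * u\<^sup>2) \<le> exp (- ((1 + \<kappa>) * u\<^sup>2 / (2 * S)))" by simp
    qed
    also have "\<dots> = ennreal (e u)" by (simp only: e_def K_def distrib_right)
    finally show ?thesis .
  qed
  have "(\<integral>\<^sup>+\<omega>. (\<integral>\<^sup>+v. indicator {a..b} v * ennreal (excess \<eta> h u (x0 v \<omega>) (x1 v \<omega>) (x2 v \<omega>)) \<partial>lborel) \<partial>M) \<le> ennreal (e u)"
    if ab: "a \<le> t0" "t0 \<le> b" "b - a \<le> h" and u: "1 \<le> u" for a b u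
  proof -
    interpret P: pair_sigma_finite lborel M ..
    have [measurable]: "(\<lambda>z. x0 (fst z) (snd z)) \<in> borel_measurable (lborel \<Otimes>\<^sub>M M)" "(\<lambda>z. x1 (fst z) (snd z)) \<in> borel_measurable (lborel \<Otimes>\<^sub>M M)"
      "(\<lambda>z. x2 (fst z) (snd z)) \<in> borel_measurable (lborel \<Otimes>\<^sub>M M)"
      using measurable_continuous_paths[of x0 M] measurable_continuous_paths[of x1 M] measurable_continuous_paths[of x2 M] xC
      by (simp_all cong: measurable_cong_sets sets_pair_measure_cong)
    have "(\<lambda>z. indicator {a..b} (fst z) * ennreal (excess \<eta> h u (x0 (fst z) (snd z)) (x1 (fst z) (snd z)) (x2 (fst z) (snd z)))) \<in> borel_measurable (lborel \<Otimes>\<^sub>M M)"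
      by measurable
    from P.Fubini'[of "\<lambda>v \<omega>. indicator {a..b} v * ennreal (excess \<eta> h u (x0 v \<omega>) (x1 v \<omega>) (x2 v \<omega>))"] this
    have "(\<integral>\<^sup>+\<omega>. (\<integral>\<^sup>+v. indicator {a..b} v * ennreal (excess \<eta> h u (x0 v \<omega>) (x1 v \<omega>) (x2 v \<omega>)) \<partial>lborel) \<partial>M) =
      (\<integral>\<^sup>+v. (\<integral>\<^sup>+\<omega>. indicator {a..b} v * ennreal (excess \<eta> h u (x0 v \<omega>) (x1 v \<omega>) (x2 v \<omega>)) \<partial>M) \<partial>lborel)"
      by (simp add: case_prod_beta)
    also have "\<dots> \<le> (\<integral>\<^sup>+v. ennreal (e u) * indicator {a..b} v \<partial>lborel)"
    proof (rule nn_integral_mono)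
      fix v
      show "(\<integral>\<^sup>+\<omega>. indicator {a..b} v * ennreal (excess \<eta> h u (x0 v \<omega>) (x1 v \<omega>) (x2 v \<omega>)) \<partial>M) \<le> ennreal (e u) * indicator {a..b} v"
        using E[of v u] ab u by (cases "v \<in> {a..b}") auto
    qed
    also have "\<dots> = ennreal (e u) * ennreal (b - a)"
      using ab by (subst nn_integral_cmult_indicator) auto
    also have "\<dots> \<le> ennreal (e u) * 1"
      using ab h by (intro mult_left_mono) (auto simp: ennreal_1[symmetric] simp del: ennreal_1 intro!: ennreal_leI)
    finally show ?thesis by simp
  qed
  moreover have "S / 2 \<le> cov (x0 t) (x0 t)" if "\<bar>t - t0\<bar> \<le> h" for t
    using near[of t] that h d by (auto simp: dist_real_def s_def)
  ultimately show ?thesis using \<eta>(1) h(1,2) sm by blast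
qed

end

lemma small_max0: "small S e \<Longrightarrow> small S (\<lambda>u. max 0 (e u))"
proof -
  assume "small S e"
  then obtain K \<kappa> where *: "0 \<le> K" "0 < \<kappa>" "\<forall>u\<ge>1. e u \<le> K * exp (- ((1 + \<kappa>) * u\<^sup>2 / (2 * S)))" unfolding small_def by blast
  then have "\<forall>u\<ge>1. max 0 (e u) \<le> K * exp (- ((1 + \<kappa>) * u\<^sup>2 / (2 * S)))" by simp
  then show ?thesis unfolding small_def using * by blast
qed

section \<open>Negligible events: large values away from \<open>t0\<close>, large increments, tilted
  slopes\<close>

context C2_gauss_max begin

lemma var_Lipschitz: "\<exists>C\<ge>0. \<forall>s\<in>{A..B}. \<forall>t\<in>{A..B}. \<bar>cov (x0 t) (x0 t) - cov (x0 s) (x0 s)\<bar> \<le> C * \<bar>t - s\<bar>"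
proof -
  obtain C where C: "0 \<le> C" "\<And>t. t \<in> {A..B} \<Longrightarrow> \<bar>cov (x0 t) (x1 t)\<bar> \<le> C"
    using cov_bounded[OF isCont_cov(2)] by blast
  have "\<bar>cov (x0 t) (x0 t) - cov (x0 s) (x0 s)\<bar> \<le> (2 * C) * \<bar>t - s\<bar>" if "s \<in> {A..B}" "t \<in> {A..B}" for s t
    using field_differentiable_bound[of "{A..B}" "\<lambda>t. cov (x0 t) (x0 t)" "\<lambda>t. 2 * cov (x0 t) (x1 t)" "2 * C" t s] var_derivative C that
    by (simp add: abs_mult)
  then show ?thesis using C by (intro exI[of _ "2 * C"]) auto
qed

lemma increments_bound:
  "\<exists>C\<ge>0. \<forall>s\<in>{A..B}. \<forall>t\<in>{A..B}. cov (\<lambda>\<omega>. x0 t \<omega> - x0 s \<omega>) (\<lambda>\<omega>. x0 t \<omega> - x0 s \<omega>) \<le> C * (t - s)\<^sup>2"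
proof -
  obtain C where C: "0 \<le> C" "\<And>t. t \<in> {A..B} \<Longrightarrow> \<bar>cov (x1 t) (x1 t)\<bar> \<le> C"
    using cov_bounded[OF isCont_cov(3)] by blast
  have "cov (\<lambda>\<omega>. x0 t \<omega> - x0 s \<omega>) (\<lambda>\<omega>. x0 t \<omega> - x0 s \<omega>) \<le> C * (t - s)\<^sup>2" if "s \<in> {A..B}" "t \<in> {A..B}" for s t
    using C that by (intro cov_Lipschitz[where P=x0 and P'=x1 and c=A and d=B] xG xD1) (auto simp: abs_le_iff)
  then show ?thesis using C by blast
qed

lemma continuous_path: "\<omega> \<in> space M \<Longrightarrow> continuous_on T (\<lambda>t. x0 t \<omega>)" "\<omega> \<in> space M \<Longrightarrow> continuous_on T (\<lambda>t. x1 t \<omega>)"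
  using xC continuous_on_subset by blast+

text \<open>The process is rescaled so that its variance never exceeds \<open>S / (1 + \<delta>)\<close>, without changing it where the
  variance is below this value already.\<close>

lemma outside_small:
  assumes \<delta>: "0 < \<delta>"
  shows "tail_small S (\<lambda>u \<omega>. (\<exists>t\<in>{A..B}. cov (x0 t) (x0 t) \<le> S / (1 + \<delta>) \<and> u \<le> \<bar>x0 t \<omega>\<bar>))"
proof -
  have S: "0 < S" by (rule S_pos)
  define c where "c = S / (1 + \<delta>)"
  have c: "0 < c" "c < S" using \<delta> S by (auto simp: c_def field_simps)
  define g where "g t = Orderings.max c (cov (x0 t) (x0 t))" for t
  \<comment> \<open>Since \<open>g\<close> is at least \<open>c > 0\<close>, the scaling factor is
    Lipschitz, as the increment bound of \<open>sup_tail_small\<close> demands; it equals 1 where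
    the variance is at most \<open>c\<close>.\<close>
  define w where "w t = sqrt c / sqrt (g t)" for t
  have g: "c \<le> g t" "cov (x0 t) (x0 t) \<le> g t" "0 < g t" for t using c by (auto simp: g_def)
  have w: "0 \<le> w t" "w t \<le> 1" for t using c g[of t] by (auto simp: w_def)
  have w1: "w t = 1" if "cov (x0 t) (x0 t) \<le> c" for t using that c by (simp add: w_def g_def)
  have w2: "(w t)\<^sup>2 * cov (x0 t) (x0 t) \<le> c" for t
    using g[of t] c by (simp add: w_def power_divide field_simps)
  obtain C where C: "0 \<le> C" "\<And>s t. s \<in> {A..B} \<Longrightarrow> t \<in> {A..B} \<Longrightarrow> \<bar>cov (x0 t) (x0 t) - cov (x0 s) (x0 s)\<bar> \<le> C * \<bar>t - s\<bar>"
    using var_Lipschitz by blast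
  obtain D where D: "0 \<le> D" "\<And>s t. s \<in> {A..B} \<Longrightarrow> t \<in> {A..B} \<Longrightarrow> cov (\<lambda>\<omega>. x0 t \<omega> - x0 s \<omega>) (\<lambda>\<omega>. x0 t \<omega> - x0 s \<omega>) \<le> D * (t - s)\<^sup>2"
    using increments_bound by blast
  have wL: "\<bar>w t - w s\<bar> \<le> C / (2 * c) * \<bar>t - s\<bar>" if st: "s \<in> {A..B}" "t \<in> {A..B}" for s t
  proof -
    have sg: "sqrt c \<le> sqrt (g t)" "sqrt c \<le> sqrt (g s)" "0 < sqrt c" using g c by auto
    have "w t - w s = sqrt c * (sqrt (g s) - sqrt (g t)) / (sqrt (g t) * sqrt (g s))"
      using sg by (simp add: w_def field_simps)
    moreover have "sqrt (g s) - sqrt (g t) = (g s - g t) / (sqrt (g s) + sqrt (g t))"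
    proof -
      have "(sqrt (g s) - sqrt (g t)) * (sqrt (g s) + sqrt (g t)) = g s - g t"
        using g[of s] g[of t] by (simp add: algebra_simps)
      moreover have "sqrt (g s) + sqrt (g t) \<noteq> 0" using sg by linarith
      ultimately show ?thesis by (simp only: nonzero_eq_divide_eq not_False_eq_True)
    qed
    ultimately have "\<bar>w t - w s\<bar> = sqrt c * \<bar>g s - g t\<bar> / ((sqrt (g s) + sqrt (g t)) * (sqrt (g t) * sqrt (g s)))"
      using sg g[of s] g[of t] by (simp add: abs_mult abs_divide)
    also have "\<dots> \<le> sqrt c * \<bar>g s - g t\<bar> / ((sqrt c + sqrt c) * (sqrt c * sqrt c))"
      using sg by (intro divide_left_mono mult_mono add_mono mult_pos_pos add_pos_pos) auto
    also have "\<dots> = \<bar>g s - g t\<bar> / (2 * c)" using c by (simp add: field_simps)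
    also have "\<dots> \<le> (C * \<bar>t - s\<bar>) / (2 * c)"
    proof (intro divide_right_mono)
      have "\<bar>g s - g t\<bar> \<le> \<bar>cov (x0 t) (x0 t) - cov (x0 s) (x0 s)\<bar>" unfolding g_def by (auto simp: max_def)
      then show "\<bar>g s - g t\<bar> \<le> C * \<bar>t - s\<bar>" using C(2)[OF st] by linarith
    qed (use c in simp)
    finally show ?thesis by simp
  qed
  have cov_inc: "cov (\<lambda>\<omega>. w t * x0 t \<omega> - w s * x0 s \<omega>) (\<lambda>\<omega>. w t * x0 t \<omega> - w s * x0 s \<omega>) \<le> (2 * D + 2 * ((C / (2 * c))\<^sup>2 * S)) * (t - s)\<^sup>2"
    if st: "s \<in> {A..B}" "t \<in> {A..B}" for s t
  proof -
    let ?P = "\<lambda>\<omega>. w t * (x0 t \<omega> - x0 s \<omega>)" and ?Q = "\<lambda>\<omega>. (w t - w s) * x0 s \<omega>"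
    have "(\<lambda>\<omega>. w t * x0 t \<omega> - w s * x0 s \<omega>) = (\<lambda>\<omega>. ?P \<omega> + ?Q \<omega>)" by (simp add: algebra_simps)
    then have "cov (\<lambda>\<omega>. w t * x0 t \<omega> - w s * x0 s \<omega>) (\<lambda>\<omega>. w t * x0 t \<omega> - w s * x0 s \<omega>) \<le> 2 * cov ?P ?P + 2 * cov ?Q ?Q"
      by (simp only:) (intro cov_add_le G_scale G_diff xG)
    moreover have "cov ?P ?P \<le> D * (t - s)\<^sup>2"
    proof -
      have "cov ?P ?P = (w t)\<^sup>2 * cov (\<lambda>\<omega>. x0 t \<omega> - x0 s \<omega>) (\<lambda>\<omega>. x0 t \<omega> - x0 s \<omega>)"
        unfolding cov_scale_left cov_scale_right by (simp add: power2_eq_square)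
      also have "\<dots> \<le> 1 * (D * (t - s)\<^sup>2)"
        using w[of t] D st cov_nonneg by (intro mult_mono) (auto simp: power_le_one)
      finally show ?thesis by simp
    qed
    moreover have "cov ?Q ?Q \<le> ((C / (2 * c))\<^sup>2 * S) * (t - s)\<^sup>2"
    proof -
      have "cov ?Q ?Q = (w t - w s)\<^sup>2 * cov (x0 s) (x0 s)"
        unfolding cov_scale_left cov_scale_right by (simp add: power2_eq_square)
      also have "\<dots> \<le> (C / (2 * c) * \<bar>t - s\<bar>)\<^sup>2 * S"
      proof (intro mult_mono)
        show "(w t - w s)\<^sup>2 \<le> (C / (2 * c) * \<bar>t - s\<bar>)\<^sup>2"
          using power_mono[OF wL[OF st], of 2] by simp
        show "cov (x0 s) (x0 s) \<le> S" using var_le st by blast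
      qed (use cov_nonneg in auto)
      also have "\<dots> = ((C / (2 * c))\<^sup>2 * S) * (t - s)\<^sup>2"
        by (simp only: power_mult_distrib power2_abs mult_ac)
      finally show ?thesis .
    qed
    ultimately show ?thesis unfolding distrib_right mult.assoc[of 2] by linarith
  qed
  have wc: "continuous_on {A..B} w"
  proof -
    have "continuous_on {A..B} (\<lambda>t. cov (x0 t) (x0 t))"
      using isCont_cov(1) by (simp add: continuous_at_imp_continuous_on)
    then have "continuous_on {A..B} g" unfolding g_def by (intro continuous_intros)
    then show ?thesis unfolding w_def using g(3) by (intro continuous_intros) (auto simp: less_imp_neq[symmetric])
  qed
  have ts: "tail_small S (\<lambda>u \<omega>. (\<exists>t\<in>{A..B}. u \<le> \<bar>w t * x0 t \<omega>\<bar>))"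
  proof (rule sup_tail_small[where Y="\<lambda>t \<omega>. w t * x0 t \<omega>" and v=c and C="2 * D + 2 * ((C / (2 * c))\<^sup>2 * S)"])
    show "A < B" "0 < S" "c < S" using AB S c by auto
    show "(\<lambda>\<omega>. w t * x0 t \<omega>) \<in> G" for t by (intro G_scale xG)
    show "cov (\<lambda>\<omega>. w t * x0 t \<omega>) (\<lambda>\<omega>. w t * x0 t \<omega>) \<le> c" for t
      using w2[of t] unfolding cov_scale_left cov_scale_right by (simp add: power2_eq_square mult.assoc)
    show "cov (\<lambda>\<omega>. w t * x0 t \<omega> - w s * x0 s \<omega>) (\<lambda>\<omega>. w t * x0 t \<omega> - w s * x0 s \<omega>) \<le> (2 * D + 2 * ((C / (2 * c))\<^sup>2 * S)) * (t - s)\<^sup>2"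
      if "s \<in> {A..B}" "t \<in> {A..B}" for s t using that by (rule cov_inc)
    show "AE \<omega> in M. continuous_on {A..B} (\<lambda>t. w t * x0 t \<omega>)"
      by (intro AE_I2 continuous_on_mult wc continuous_path)
  qed
  obtain e F where e: "small S e" "\<forall>u\<ge>1. F u \<in> sets M" "\<forall>u\<ge>1. prob (F u) \<le> e u"
    and AE: "\<forall>u\<ge>1. AE \<omega> in M. (\<exists>t\<in>{A..B}. u \<le> \<bar>w t * x0 t \<omega>\<bar>) \<longrightarrow> \<omega> \<in> F u"
    using tail_smallD[OF ts] by blast
  have "AE \<omega> in M. (\<exists>t\<in>{A..B}. cov (x0 t) (x0 t) \<le> S / (1 + \<delta>) \<and> u \<le> \<bar>x0 t \<omega>\<bar>) \<longrightarrow> \<omega> \<in> F u" if "1 \<le> u" for u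
    using AE[rule_format, OF that]
  proof eventually_elim
    case (elim \<omega>)
    then show ?case using w1 by (metis c_def mult_1)
  qed
  then show ?thesis unfolding tail_small_def using e by blast
qed

text \<open>Away from \<open>t0\<close> the variance attains a maximum \<open>v < S\<close> by
  compactness, and \<open>\<delta>\<close> is chosen with
  \<open>v < S / (1 + \<delta>)\<close>.\<close>

lemma near_max:
  assumes "0 < r"
  shows "\<exists>\<delta>>0. \<forall>t\<in>{A..B}. S / (1 + \<delta>) \<le> cov (x0 t) (x0 t) \<longrightarrow> \<bar>t - t0\<bar> < r"
proof -
  have S: "0 < S" by (rule S_pos)
  let ?K = "{A..B} - ball t0 r"
  have K: "compact ?K" by (intro compact_diff) auto
  show ?thesis
  proof (cases "?K = {}")
    case True
    then have "\<forall>t\<in>{A..B}. \<bar>t - t0\<bar> < r" by (force simp: dist_real_def abs_minus_commute)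
    then show ?thesis by (intro exI[of _ 1]) auto
  next
    case False
    have "continuous_on ?K (\<lambda>t. cov (x0 t) (x0 t))" using isCont_cov(1) by (simp add: continuous_at_imp_continuous_on)
    then obtain s where s: "s \<in> ?K" "\<And>t. t \<in> ?K \<Longrightarrow> cov (x0 t) (x0 t) \<le> cov (x0 s) (x0 s)"
      using continuous_attains_sup[OF K False] by blast
    define v where "v = cov (x0 s) (x0 s)"
    have "s \<noteq> t0" using s(1) \<open>0 < r\<close> by auto
    then have v: "0 \<le> v" "v < S" using s(1) max[of s] cov_nonneg by (auto simp: v_def)
    define \<delta> where "\<delta> = (S - v) / (2 * S)"
    have \<delta>: "0 < \<delta>" using v S by (simp add: \<delta>_def)
    have "v * (1 + \<delta>) < S"
    proof -
      have "v * (1 + \<delta>) = v + (S - v) * (v / (2 * S))" using S by (simp add: \<delta>_def field_simps)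
      also have "\<dots> < v + (S - v) * 1" using v S by (intro add_strict_left_mono mult_strict_left_mono) (auto simp: field_simps)
      finally show ?thesis by simp
    qed
    then have "v < S / (1 + \<delta>)" using \<delta> by (simp add: field_simps)
    then have "\<bar>t - t0\<bar> < r" if "t \<in> {A..B}" "S / (1 + \<delta>) \<le> cov (x0 t) (x0 t)" for t
      using s(2)[of t] that unfolding v_def[symmetric] by (force simp: dist_real_def abs_minus_commute)
    then show ?thesis using \<delta> by blast
  qed
qed

text \<open>Close to \<open>t0\<close> the increments from \<open>t0\<close> have variance at most
  \<open>S / 2\<close>. A path with a value at least \<open>u\<close> and another at most
  \<open>- u\<close> there deviates from \<open>x0 t0\<close> by at least \<open>u\<close> at one of
  the two times.\<close>

lemma increments_small:
  "\<exists>r>0. \<forall>a b. A \<le> a \<and> a < b \<and> b \<le> B \<and> (\<forall>t\<in>{a..b}. \<bar>t - t0\<bar> \<le> r) \<longrightarrow>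
    (tail_small S (\<lambda>u \<omega>. (\<exists>t\<in>{a..b}. u \<le> \<bar>x0 t \<omega> - x0 t0 \<omega>\<bar>)))"
proof -
  have S: "0 < S" by (rule S_pos)
  obtain D where D: "0 \<le> D" "\<And>s t. s \<in> {A..B} \<Longrightarrow> t \<in> {A..B} \<Longrightarrow> cov (\<lambda>\<omega>. x0 t \<omega> - x0 s \<omega>) (\<lambda>\<omega>. x0 t \<omega> - x0 s \<omega>) \<le> D * (t - s)\<^sup>2"
    using increments_bound by blast
  define r where "r = sqrt (S / (2 * (D + 1)))"
  have r: "0 < r" using S D by (simp add: r_def)
  have Dr: "D * r\<^sup>2 \<le> S / 2"
  proof -
    have "D * r\<^sup>2 \<le> (D + 1) * r\<^sup>2" by (intro mult_right_mono) auto
    also have "\<dots> = S / 2" using S D by (simp add: r_def field_simps)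
    finally show ?thesis .
  qed
  have "tail_small S (\<lambda>u \<omega>. (\<exists>t\<in>{a..b}. u \<le> \<bar>x0 t \<omega> - x0 t0 \<omega>\<bar>))"
    if ab: "A \<le> a" "a < b" "b \<le> B" "\<forall>t\<in>{a..b}. \<bar>t - t0\<bar> \<le> r" for a b
  proof (rule sup_tail_small[where v="S / 2" and C=D])
    show "(\<lambda>\<omega>. x0 t \<omega> - x0 t0 \<omega>) \<in> G" for t by (intro G_diff xG)
    fix t assume t: "t \<in> {a..b}"
    have "cov (\<lambda>\<omega>. x0 t \<omega> - x0 t0 \<omega>) (\<lambda>\<omega>. x0 t \<omega> - x0 t0 \<omega>) \<le> D * (t - t0)\<^sup>2"
      using t ab t0 by (intro D) auto
    also have "(t - t0)\<^sup>2 \<le> r\<^sup>2" using ab(4) t power_mono[of "\<bar>t - t0\<bar>" r 2] by auto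
    then have "D * (t - t0)\<^sup>2 \<le> D * r\<^sup>2" using D by (intro mult_left_mono)
    also note Dr
    finally show "cov (\<lambda>\<omega>. x0 t \<omega> - x0 t0 \<omega>) (\<lambda>\<omega>. x0 t \<omega> - x0 t0 \<omega>) \<le> S / 2" .
    fix s assume s: "s \<in> {a..b}"
    have "(\<lambda>\<omega>. x0 t \<omega> - x0 t0 \<omega> - (x0 s \<omega> - x0 t0 \<omega>)) = (\<lambda>\<omega>. x0 t \<omega> - x0 s \<omega>)" by simp
    then show "cov (\<lambda>\<omega>. x0 t \<omega> - x0 t0 \<omega> - (x0 s \<omega> - x0 t0 \<omega>)) (\<lambda>\<omega>. x0 t \<omega> - x0 t0 \<omega> - (x0 s \<omega> - x0 t0 \<omega>)) \<le> D * (t - s)\<^sup>2"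
      using D(2)[of s t] s t ab by simp
  next
    show "AE \<omega> in M. continuous_on {a..b} (\<lambda>t. x0 t \<omega> - x0 t0 \<omega>)"
      by (intro AE_I2 continuous_on_diff continuous_path continuous_on_const)
  qed (use ab S in auto)
  then show ?thesis using r by blast
qed

text \<open>With \<open>l = - b0 / m\<close> the variance at \<open>t0\<close> is at most
  \<open>S + 2 * l * b0 + l\<^sup>2 * m = S - b0\<^sup>2 / m\<close>, the minimum of this quadratic
  in \<open>l\<close>. Half of the gain survives nearby by continuity. The summand 1 in
  \<open>m\<close> keeps it positive.\<close>

lemma slope_small:
  assumes b: "cov (x0 t0) (x1 t0) \<noteq> 0"
  shows "\<exists>l r. l * cov (x0 t0) (x1 t0) < 0 \<and> 0 < r \<and> (\<forall>a b. A \<le> a \<and> a < b \<and> b \<le> B \<and> (\<forall>t\<in>{a..b}. \<bar>t - t0\<bar> \<le> r) \<longrightarrow>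
    (tail_small S (\<lambda>u \<omega>. (\<exists>t\<in>{a..b}. u \<le> \<bar>1 * x0 t \<omega> + l * x1 t \<omega>\<bar>))))"
proof -
  have S: "0 < S" by (rule S_pos)
  define b0 where "b0 = cov (x0 t0) (x1 t0)"
  define m where "m = cov (x1 t0) (x1 t0) + 1"
  have m: "0 < m" "cov (x1 t0) (x1 t0) \<le> m" using cov_nonneg[of "x1 t0"] by (auto simp: m_def)
  define l where "l = - b0 / m"
  define V where "V t = cov (x0 t) (x0 t) + 2 * l * cov (x0 t) (x1 t) + l\<^sup>2 * cov (x1 t) (x1 t)" for t
  have b0: "0 < b0\<^sup>2" using b by (simp add: b0_def)
  have Vt: "cov (\<lambda>\<omega>. 1 * x0 t \<omega> + l * x1 t \<omega>) (\<lambda>\<omega>. 1 * x0 t \<omega> + l * x1 t \<omega>) = V t" for t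
    unfolding cov_square_lin[OF xG(1,2)] by (simp add: V_def)
  have "l\<^sup>2 * cov (x1 t0) (x1 t0) \<le> l\<^sup>2 * m" using m by (intro mult_left_mono) auto
  then have "V t0 \<le> S + 2 * l * b0 + l\<^sup>2 * m" by (simp add: V_def S_def b0_def)
  also have "\<dots> = S - b0\<^sup>2 / m" using m by (simp add: l_def power2_eq_square field_simps)
  finally have "V t0 \<le> S - b0\<^sup>2 / m" .
  have V0: "V t0 < S - b0\<^sup>2 / (2 * m)" proof -
    have "b0\<^sup>2 / (2 * m) < b0\<^sup>2 / m" using b0 m by (intro divide_strict_left_mono) auto
    then show ?thesis using \<open>V t0 \<le> S - b0\<^sup>2 / m\<close> by linarith
  qed
  have "isCont V t0" unfolding V_def by (intro continuous_intros isCont_cov)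
  then have "filterlim V (nhds (V t0)) (nhds t0)" by (simp add: isCont_def tendsto_at_iff_tendsto_nhds)
  then have "\<forall>\<^sub>F t in nhds t0. V t < S - b0\<^sup>2 / (2 * m)" using V0 by (rule order_tendstoD)
  then obtain d where d: "0 < d" "\<And>t. dist t t0 < d \<Longrightarrow> V t < S - b0\<^sup>2 / (2 * m)" unfolding eventually_nhds_metric by blast
  define W where "W t = cov (\<lambda>\<omega>. 1 * x1 t \<omega> + l * x2 t \<omega>) (\<lambda>\<omega>. 1 * x1 t \<omega> + l * x2 t \<omega>)" for t
  have "isCont W t" for t unfolding W_def cov_square_lin[OF xG(2,3)] by (intro continuous_intros isCont_cov)
  then obtain C where C: "0 \<le> C" "\<And>t. t \<in> {A..B} \<Longrightarrow> \<bar>W t\<bar> \<le> C" using cov_bounded[of W] by blast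
  have "tail_small S (\<lambda>u \<omega>. (\<exists>t\<in>{a..b}. u \<le> \<bar>1 * x0 t \<omega> + l * x1 t \<omega>\<bar>))"
    if ab: "A \<le> a" "a < b" "b \<le> B" "\<forall>t\<in>{a..b}. \<bar>t - t0\<bar> \<le> d / 2" for a b
  proof (rule sup_tail_small[where v="S - b0\<^sup>2 / (2 * m)" and C=C])
    show "(\<lambda>\<omega>. 1 * x0 t \<omega> + l * x1 t \<omega>) \<in> G" for t by (intro lin xG)
    fix t assume t: "t \<in> {a..b}"
    have "dist t t0 < d" using ab(4) t d(1) by (force simp: dist_real_def)
    then show "cov (\<lambda>\<omega>. 1 * x0 t \<omega> + l * x1 t \<omega>) (\<lambda>\<omega>. 1 * x0 t \<omega> + l * x1 t \<omega>) \<le> S - b0\<^sup>2 / (2 * m)"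
      unfolding Vt using d(2) by (intro less_imp_le)
    fix s assume s: "s \<in> {a..b}"
    show "cov (\<lambda>\<omega>. 1 * x0 t \<omega> + l * x1 t \<omega> - (1 * x0 s \<omega> + l * x1 s \<omega>)) (\<lambda>\<omega>. 1 * x0 t \<omega> + l * x1 t \<omega> - (1 * x0 s \<omega> + l * x1 s \<omega>)) \<le> C * (t - s)\<^sup>2"
    proof (rule cov_Lipschitz[where P="\<lambda>t \<omega>. 1 * x0 t \<omega> + l * x1 t \<omega>" and P'="\<lambda>t \<omega>. 1 * x1 t \<omega> + l * x2 t \<omega>" and c=A and d=B])
      show "(\<lambda>\<omega>. 1 * x0 t \<omega> + l * x1 t \<omega>) \<in> G" "(\<lambda>\<omega>. 1 * x1 t \<omega> + l * x2 t \<omega>) \<in> G" for t by (intro lin xG)+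
      show "((\<lambda>s. 1 * x0 s \<omega> + l * x1 s \<omega>) has_real_derivative 1 * x1 t \<omega> + l * x2 t \<omega>) (at t within {A..B})"
        if "\<omega> \<in> space M" "t \<in> {A..B}" for \<omega> t
        by (intro DERIV_add DERIV_cmult xD1 xD2 that)
      show "cov (\<lambda>\<omega>. 1 * x1 t \<omega> + l * x2 t \<omega>) (\<lambda>\<omega>. 1 * x1 t \<omega> + l * x2 t \<omega>) \<le> C" if "t \<in> {A..B}" for t
        using C(2)[OF that] by (simp add: W_def abs_le_iff)
    qed (use s t ab in auto)
  next
    show "AE \<omega> in M. continuous_on {a..b} (\<lambda>t. 1 * x0 t \<omega> + l * x1 t \<omega>)"
      by (intro AE_I2 continuous_on_add continuous_on_mult continuous_path continuous_on_const)
    show "S - b0\<^sup>2 / (2 * m) < S" using b0 m by simp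
  qed (use ab S in auto)
  moreover have "l * b0 < 0" using b0 m by (simp add: l_def power2_eq_square)
  ultimately show ?thesis using d(1) by (intro exI[of _ l] exI[of _ "d / 2"]) (auto simp: b0_def)
qed

lemma prob_above_Un_below:
  assumes F: "F \<in> sets M" "AE \<omega> in M. \<omega> \<in> above u \<inter> below u \<longrightarrow> \<omega> \<in> F"
  shows "2 * prob (above u) - prob F \<le> prob (above u \<union> below u)" "prob (above u \<union> below u) \<le> 2 * prob (above u)"
proof -
  have "prob (above u \<union> below u) = prob (above u) + prob (below u) - prob (above u \<inter> below u)"
    by (rule measure_Un3) (auto simp: fmeasurable_eq_sets)
  moreover have "prob (above u \<inter> below u) \<le> prob F" using F by (intro finite_measure_mono_AE) auto
  ultimately show "2 * prob (above u) - prob F \<le> prob (above u \<union> below u)" "prob (above u \<union> below u) \<le> 2 * prob (above u)"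
    using prob_above_below[of u] by (simp_all add: measure_nonneg)
qed

text \<open>Either one of the two extreme values occurs where the variance is small, or both times
  are near \<open>t0\<close> and one of them shows a large increment.\<close>

lemma above_and_below:
  assumes K: "(\<exists>t\<in>{A..B}. cov (x0 t) (x0 t) \<le> S / (1 + \<delta>) \<and> u \<le> \<bar>x0 t \<omega>\<bar>) \<longrightarrow> \<omega> \<in> F"
    and I: "(\<exists>t\<in>{a..b}. u \<le> \<bar>x0 t \<omega> - x0 t0 \<omega>\<bar>) \<longrightarrow> \<omega> \<in> F'"
    and near: "\<And>t. t \<in> {A..B} \<Longrightarrow> S / (1 + \<delta>) \<le> cov (x0 t) (x0 t) \<Longrightarrow> t \<in> {a..b}"
    and \<omega>: "\<omega> \<in> above u \<inter> below u"
  shows "\<omega> \<in> F \<union> F'"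
proof (rule ccontr)
  assume n: "\<omega> \<notin> F \<union> F'"
  obtain t where t: "t \<in> {A..B}" "u \<le> x0 t \<omega>" using \<omega> by (auto simp: above_def)
  obtain s where s: "s \<in> {A..B}" "u \<le> - x0 s \<omega>" using \<omega> by (auto simp: below_def)
  have "\<not> cov (x0 t) (x0 t) \<le> S / (1 + \<delta>)" "\<not> cov (x0 s) (x0 s) \<le> S / (1 + \<delta>)" using K n t s by force+
  then have "t \<in> {a..b}" "s \<in> {a..b}" using near t s by auto
  moreover have "u \<le> \<bar>x0 t \<omega> - x0 t0 \<omega>\<bar> \<or> u \<le> \<bar>x0 s \<omega> - x0 t0 \<omega>\<bar>" using t s by linarith
  ultimately show False using I n by blast
qed

end

section \<open>The tail of the maximum\<close>

context C2_gauss_max begin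

text \<open>The sign of the covariance determines at which end point \<open>t0\<close> lies, and
  \<open>l\<close> has the opposite sign. A path below \<open>u\<close> at \<open>t0\<close> that
  reaches \<open>u\<close> therefore has a point with \<open>X = u\<close> and
  \<open>l * X' \<ge> 0\<close>, where the tilted process is at least \<open>u\<close>.\<close>

lemma max_tail_slope:
  assumes b: "cov (x0 t0) (x1 t0) \<noteq> 0"
  shows "\<exists>e. small S e \<and> (\<forall>u\<ge>1. \<bar>prob (above u \<union> below u) - 2 * prob {\<omega>\<in>space M. u \<le> x0 t0 \<omega>}\<bar> \<le> e u)"
proof -
  have S: "0 < S" by (rule S_pos)
  obtain r1 where r1': "0 < r1 \<and> (\<forall>a b. A \<le> a \<and> a < b \<and> b \<le> B \<and> (\<forall>t\<in>{a..b}. \<bar>t - t0\<bar> \<le> r1) \<longrightarrow>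
    tail_small S (\<lambda>u \<omega>. (\<exists>t\<in>{a..b}. u \<le> \<bar>x0 t \<omega> - x0 t0 \<omega>\<bar>)))"
    using increments_small ..
  note r1 = conjunct1[OF r1'] and inc = conjunct2[OF r1', THEN spec, THEN spec, THEN mp, OF conjI[OF _ conjI[OF _ conjI]]]
  obtain l r2 where r2': "l * cov (x0 t0) (x1 t0) < 0 \<and> 0 < r2 \<and> (\<forall>a b. A \<le> a \<and> a < b \<and> b \<le> B \<and> (\<forall>t\<in>{a..b}. \<bar>t - t0\<bar> \<le> r2) \<longrightarrow>
    tail_small S (\<lambda>u \<omega>. (\<exists>t\<in>{a..b}. u \<le> \<bar>1 * x0 t \<omega> + l * x1 t \<omega>\<bar>)))"
    using slope_small[OF b] by (elim exE)
  note l = conjunct1[OF r2'] and r2 = conjunct1[OF conjunct2[OF r2']]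
    and slope = conjunct2[OF conjunct2[OF r2'], THEN spec, THEN spec, THEN mp, OF conjI[OF _ conjI[OF _ conjI]]]
  define r where "r = min r1 r2"
  have r: "0 < r" "r \<le> r1" "r \<le> r2" using r1 r2 by (auto simp: r_def)
  define a where "a = Orderings.max A (t0 - r)"
  define b where "b = min B (t0 + r)"
  have ab: "A \<le> a" "a < b" "b \<le> B" "\<And>t. t \<in> {a..b} \<Longrightarrow> \<bar>t - t0\<bar> \<le> r"
    using t0 r(1) AB by (auto simp: a_def b_def abs_le_iff)
  obtain \<delta> where \<delta>: "0 < \<delta>" and near: "\<And>t. t \<in> {A..B} \<Longrightarrow> S / (1 + \<delta>) \<le> cov (x0 t) (x0 t) \<Longrightarrow> \<bar>t - t0\<bar> < r"
    using near_max[OF r(1)] by blast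
  have near': "t \<in> {a..b}" if "t \<in> {A..B}" "S / (1 + \<delta>) \<le> cov (x0 t) (x0 t)" for t
    using near[OF that] that by (auto simp: a_def b_def)
  obtain e1 E1 where e1: "small S e1" "\<forall>u\<ge>1. E1 u \<in> sets M" "\<forall>u\<ge>1. prob (E1 u) \<le> e1 u"
    and AE1: "\<forall>u\<ge>1. AE \<omega> in M. (\<exists>t\<in>{A..B}. cov (x0 t) (x0 t) \<le> S / (1 + \<delta>) \<and> u \<le> \<bar>x0 t \<omega>\<bar>) \<longrightarrow> \<omega> \<in> E1 u"
    using tail_smallD[OF outside_small[OF \<delta>]] by blast
  have near1: "\<forall>t\<in>{a..b}. \<bar>t - t0\<bar> \<le> r1" using ab(4) r(2) order_trans by blast
  obtain e2 E2 where e2: "small S e2" "\<forall>u\<ge>1. E2 u \<in> sets M" "\<forall>u\<ge>1. prob (E2 u) \<le> e2 u"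
    and AE2: "\<forall>u\<ge>1. AE \<omega> in M. (\<exists>t\<in>{a..b}. u \<le> \<bar>x0 t \<omega> - x0 t0 \<omega>\<bar>) \<longrightarrow> \<omega> \<in> E2 u"
    using tail_smallD[OF inc[OF ab(1-3) near1]] by blast
  have near2: "\<forall>t\<in>{a..b}. \<bar>t - t0\<bar> \<le> r2" using ab(4) r(3) order_trans by blast
  obtain e3 E3 where e3: "small S e3" "\<forall>u\<ge>1. E3 u \<in> sets M" "\<forall>u\<ge>1. prob (E3 u) \<le> e3 u"
    and AE3: "\<forall>u\<ge>1. AE \<omega> in M. (\<exists>t\<in>{a..b}. u \<le> \<bar>1 * x0 t \<omega> + l * x1 t \<omega>\<bar>) \<longrightarrow> \<omega> \<in> E3 u"
    using tail_smallD[OF slope[OF ab(1-3) near2]] by blast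
  \<comment> \<open>The one-sided comparison costs \<open>e1 + e3\<close> and counts twice, once per
    sign; \<open>e1 + e2\<close> accounts for paths reaching both levels.\<close>
  define e where "e u = ((e1 u + e1 u) + (e3 u + e3 u)) + (e1 u + e2 u)" for u
  have "small S e" unfolding e_def by (intro small_add S e1 e2 e3)
  moreover have "\<bar>prob (above u \<union> below u) - 2 * prob {\<omega>\<in>space M. u \<le> x0 t0 \<omega>}\<bar> \<le> e u" if u: "1 \<le> u" for u
  proof -
    define F1 where "F1 = E1 u"
    note F1 = e1(2,3)[rule_format, OF u, folded F1_def] AE1[rule_format, OF u, folded F1_def]
    define F2 where "F2 = E2 u"
    note F2 = e2(2,3)[rule_format, OF u, folded F2_def] AE2[rule_format, OF u, folded F2_def]
    define F3 where "F3 = E3 u"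
    note F3 = e3(2,3)[rule_format, OF u, folded F3_def] AE3[rule_format, OF u, folded F3_def]
    have "AE \<omega> in M. \<omega> \<in> above u \<inter> below u \<longrightarrow> \<omega> \<in> F1 \<union> F2"
      using F1(3) F2(3)
    proof eventually_elim
      case (elim \<omega>)
      then show ?case using above_and_below[where \<delta>=\<delta> and u=u and \<omega>=\<omega> and F=F1 and F'=F2 and a=a and b=b] near' by blast
    qed
    note both = prob_above_Un_below[OF sets.Un[OF F1(1) F2(1)] this]
    have F12: "prob (F1 \<union> F2) \<le> e1 u + e2 u" using F1 F2 measure_Un_le[of F1 M F2] by simp
    let ?T = "{\<omega>\<in>space M. u \<le> x0 t0 \<omega>}"
    have "AE \<omega> in M. \<omega> \<in> above u \<longrightarrow> \<omega> \<in> ?T \<union> (F1 \<union> F3)"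
      using F1(3) F3(3) AE_space
    proof eventually_elim
      case (elim \<omega>)
      interpret f: C2_function A B "\<lambda>t. x0 t \<omega>" "\<lambda>t. x1 t \<omega>" "\<lambda>t. x2 t \<omega>"
        using elim by (intro C2_path_function) auto
      show ?case
      proof (intro impI, rule ccontr)
        assume ab': "\<omega> \<in> above u" and n: "\<omega> \<notin> ?T \<union> (F1 \<union> F3)"
        then have ex: "\<exists>t\<in>{A..B}. u \<le> x0 t \<omega>" by (auto simp: above_def)
        have lt: "x0 t0 \<omega> < u" using n elim by auto
        have "\<exists>t\<in>{A..B}. x0 t \<omega> = u \<and> 0 \<le> l * x1 t \<omega>"
        proof (cases "t0 < B")
          case True
          then have c: "cov (x0 t0) (x1 t0) < 0" using cov01_at_max(1) assms by force
          then have "\<not> A < t0" using cov01_at_max(2) by force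
          then have "t0 = A" using t0 by auto
          have "0 < l" using l c by (simp add: mult_less_0_iff)
          then show ?thesis using f.first_hit[OF AB _ ex] lt \<open>t0 = A\<close> by (force simp: zero_le_mult_iff)
        next
          case False
          then have "t0 = B" using t0 by auto
          then have "0 < cov (x0 t0) (x1 t0)" using cov01_at_max(2) assms AB by force
          then have "l < 0" using l by (simp add: mult_less_0_iff)
          then show ?thesis using f.last_hit[OF AB _ ex] lt \<open>t0 = B\<close> by (force simp: zero_le_mult_iff)
        qed
        then obtain t where t: "t \<in> {A..B}" "x0 t \<omega> = u" "0 \<le> l * x1 t \<omega>" by blast
        have "\<not> cov (x0 t) (x0 t) \<le> S / (1 + \<delta>)" using elim(1) n t u by force
        then have "t \<in> {a..b}" using near' t by auto
        moreover have "u \<le> \<bar>1 * x0 t \<omega> + l * x1 t \<omega>\<bar>" using t u by linarith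
        ultimately show False using elim(2) n by blast
      qed
    qed
    then have "prob (above u) \<le> prob (?T \<union> (F1 \<union> F3))" using F1 F3 by (intro finite_measure_mono_AE) auto
    also have "\<dots> \<le> prob ?T + (prob F1 + prob F3)"
      using measure_Un_le[of ?T M "F1 \<union> F3"] measure_Un_le[of F1 M F3] F1 F3 by simp
    finally have up: "prob (above u) \<le> prob ?T + (e1 u + e3 u)" using F1 F3 by linarith
    have lo: "prob ?T \<le> prob (above u)"
      by (rule finite_measure_mono[OF _ sets_above]) (use t0 in \<open>auto simp: above_def\<close>)
    have "0 \<le> e1 u" "0 \<le> e2 u" "0 \<le> e3 u" using F1(2) F2(2) F3(2) measure_nonneg order_trans by metis+
    then show ?thesis using both F12 up lo by (simp add: e_def abs_le_iff)
  qed
  ultimately show ?thesis by blast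
qed

text \<open>The count lies almost surely between the indicator of
  \<open>above u - (T \<union> F1)\<close> and the indicator of \<open>above u - T\<close> plus the
  excess integral; \<open>T\<close>, starting at or above \<open>u\<close>, occurs only for
  \<open>t0 = A\<close>. \<open>N\<close> is any function almost surely equal to the count, so that
  the count along the original paths can be inserted.\<close>

lemma max_tail_flat:
  assumes b0: "cov (x0 t0) (x1 t0) = 0" and m: "0 < cov (x1 t0) (x1 t0)"
  shows "\<exists>\<delta>>0. \<exists>e. small S e \<and> (\<forall>u\<ge>1. \<forall>N.
    (AE \<omega> in M. N \<omega> = emeasure (count_space UNIV) {t\<in>{A..B}. S / (1 + \<delta>) \<le> cov (x0 t) (x0 t) \<and> x0 t \<omega> = u \<and> 0 < x1 t \<omega>}) \<longrightarrow>
    \<bar>prob (above u \<union> below u) - (2 * (if t0 = A then prob {\<omega>\<in>space M. u \<le> x0 t0 \<omega>} else 0) + 2 * enn2real (\<integral>\<^sup>+\<omega>. N \<omega> \<partial>M))\<bar> \<le> e u)"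
proof -
  have S: "0 < S" by (rule S_pos)
  obtain r1 where r1': "0 < r1 \<and> (\<forall>a b. A \<le> a \<and> a < b \<and> b \<le> B \<and> (\<forall>t\<in>{a..b}. \<bar>t - t0\<bar> \<le> r1) \<longrightarrow>
    tail_small S (\<lambda>u \<omega>. (\<exists>t\<in>{a..b}. u \<le> \<bar>x0 t \<omega> - x0 t0 \<omega>\<bar>)))"
    using increments_small ..
  note r1 = conjunct1[OF r1'] and inc = conjunct2[OF r1', THEN spec, THEN spec, THEN mp, OF conjI[OF _ conjI[OF _ conjI]]]
  obtain \<eta> h e3 where ex: "0 < \<eta> \<and> 0 < h \<and> h \<le> 1 / 2 \<and> small S e3 \<and> (\<forall>t. \<bar>t - t0\<bar> \<le> h \<longrightarrow> S / 2 \<le> cov (x0 t) (x0 t)) \<and>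
    (\<forall>a b u. a \<le> t0 \<and> t0 \<le> b \<and> b - a \<le> h \<and> 1 \<le> u \<longrightarrow>
      (\<integral>\<^sup>+\<omega>. (\<integral>\<^sup>+v. indicator {a..b} v * ennreal (excess \<eta> h u (x0 v \<omega>) (x1 v \<omega>) (x2 v \<omega>)) \<partial>lborel) \<partial>M) \<le> ennreal (e3 u))"
    using expected_excess_small[OF b0 m] by (elim exE)
  then have \<eta>: "0 < \<eta>" and h: "0 < h" "h \<le> 1 / 2" and e3: "small S e3"
    and var: "\<And>t. \<bar>t - t0\<bar> \<le> h \<Longrightarrow> S / 2 \<le> cov (x0 t) (x0 t)"
    and exc: "\<And>a b u. a \<le> t0 \<Longrightarrow> t0 \<le> b \<Longrightarrow> b - a \<le> h \<Longrightarrow> 1 \<le> u \<Longrightarrow>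
      (\<integral>\<^sup>+\<omega>. (\<integral>\<^sup>+v. indicator {a..b} v * ennreal (excess \<eta> h u (x0 v \<omega>) (x1 v \<omega>) (x2 v \<omega>)) \<partial>lborel) \<partial>M) \<le> ennreal (e3 u)"
    by simp_all
  \<comment> \<open>For \<open>t0 \<noteq> A\<close> the bound \<open>r \<le> t0 - A\<close> puts
    \<open>A\<close> outside the set of large variance, so that starting above \<open>u\<close>
    becomes negligible.\<close>
  define r where "r = min (min r1 (h / 2)) (if t0 = A then 1 else t0 - A)"
  have r: "0 < r" "r \<le> r1" "r \<le> h / 2" "t0 \<noteq> A \<Longrightarrow> r \<le> t0 - A" using r1 h t0 by (auto simp: r_def)
  define a where "a = Orderings.max A (t0 - r)"
  define b where "b = min B (t0 + r)"
  have ab: "A \<le> a" "a < b" "b \<le> B" "a \<le> t0" "t0 \<le> b" "b - a \<le> h" "\<And>t. t \<in> {a..b} \<Longrightarrow> \<bar>t - t0\<bar> \<le> r"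
    using t0 r(1,3) AB by (auto simp: a_def b_def abs_le_iff)
  have aA: "t0 = A \<Longrightarrow> a = A" using r by (simp add: a_def)
  obtain \<delta> where \<delta>: "0 < \<delta>" and near: "\<And>t. t \<in> {A..B} \<Longrightarrow> S / (1 + \<delta>) \<le> cov (x0 t) (x0 t) \<Longrightarrow> \<bar>t - t0\<bar> < r"
    using near_max[OF r(1)] by blast
  have near': "t \<in> {a..b}" if "t \<in> {A..B}" "S / (1 + \<delta>) \<le> cov (x0 t) (x0 t)" for t
    using near[OF that] that by (auto simp: a_def b_def)
  have farA: "cov (x0 A) (x0 A) \<le> S / (1 + \<delta>)" if "t0 \<noteq> A"
    using near[of A] r(4)[OF that] t0 AB by force
  obtain e1 E1 where e1: "small S e1" "\<forall>u\<ge>1. E1 u \<in> sets M" "\<forall>u\<ge>1. prob (E1 u) \<le> e1 u"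
    and AE1: "\<forall>u\<ge>1. AE \<omega> in M. (\<exists>t\<in>{A..B}. cov (x0 t) (x0 t) \<le> S / (1 + \<delta>) \<and> u \<le> \<bar>x0 t \<omega>\<bar>) \<longrightarrow> \<omega> \<in> E1 u"
    using tail_smallD[OF outside_small[OF \<delta>]] by blast
  have near1: "\<forall>t\<in>{a..b}. \<bar>t - t0\<bar> \<le> r1" using ab(7) r(2) order_trans by blast
  obtain e2 E2 where e2: "small S e2" "\<forall>u\<ge>1. E2 u \<in> sets M" "\<forall>u\<ge>1. prob (E2 u) \<le> e2 u"
    and AE2: "\<forall>u\<ge>1. AE \<omega> in M. (\<exists>t\<in>{a..b}. u \<le> \<bar>x0 t \<omega> - x0 t0 \<omega>\<bar>) \<longrightarrow> \<omega> \<in> E2 u"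
    using tail_smallD[OF inc[OF ab(1-3) near1]] by blast
  \<comment> \<open>The excess integral is bounded by \<open>ennreal (e3 u)\<close>, that is, by the
    positive part of \<open>e3 u\<close>.\<close>
  define e where "e u = ((e1 u + e1 u) + (Orderings.max 0 (e3 u) + Orderings.max 0 (e3 u))) + (e1 u + e2 u)" for u
  have sm: "small S e" unfolding e_def by (intro small_add S e1 e2 small_max0 e3)
  have var_ab: "S / 2 \<le> cov (x0 t) (x0 t)" if "t \<in> {a..b}" for t
    using ab(7)[OF that] r h by (intro var) linarith
  \<comment> \<open>A path that merely touches \<open>u\<close> with slope 0 would reach the level
    without a counted up-crossing.\<close>
  have tang: "AE \<omega> in M. \<not> (\<exists>t\<in>{a..b}. x0 t \<omega> = u \<and> x1 t \<omega> = 0)" for u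
    using S by (rule no_tangency[OF ab(1-3) half_gt_zero var_ab])
  have not_a: "AE \<omega> in M. x0 a \<omega> \<noteq> u" for u
  proof -
    have "prob {\<omega>\<in>space M. x0 a \<omega> \<in> {u..u}} \<le> (u - u) / sqrt (cov (x0 a) (x0 a))"
      using S var_ab[of a] ab by (intro cgauss_interval_le[OF cgauss_cov[OF xG(1)]]) auto
    then have "prob {\<omega>\<in>space M. x0 a \<omega> = u} = 0" by (simp add: measure_le_0_iff)
    then have "AE \<omega> in M. \<omega> \<notin> {\<omega>\<in>space M. x0 a \<omega> = u}"
      by (intro AE_not_in) (simp add: null_sets_def emeasure_eq_measure)
    then show ?thesis using AE_space by eventually_elim auto
  qed
  have bound: "\<bar>prob (above u \<union> below u) - (2 * (if t0 = A then prob {\<omega>\<in>space M. u \<le> x0 t0 \<omega>} else 0) + 2 * enn2real (\<integral>\<^sup>+\<omega>. N \<omega> \<partial>M))\<bar> \<le> e u"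
    if u: "1 \<le> u" and N: "AE \<omega> in M. N \<omega> = emeasure (count_space UNIV) {t\<in>{A..B}. S / (1 + \<delta>) \<le> cov (x0 t) (x0 t) \<and> x0 t \<omega> = u \<and> 0 < x1 t \<omega>}"
    for u N
  proof -
    define F1 where "F1 = E1 u"
    note F1 = e1(2,3)[rule_format, OF u, folded F1_def] AE1[rule_format, OF u, folded F1_def]
    define F2 where "F2 = E2 u"
    note F2 = e2(2,3)[rule_format, OF u, folded F2_def] AE2[rule_format, OF u, folded F2_def]
    have "AE \<omega> in M. \<omega> \<in> above u \<inter> below u \<longrightarrow> \<omega> \<in> F1 \<union> F2"
      using F1(3) F2(3)
    proof eventually_elim
      case (elim \<omega>)
      then show ?case using above_and_below[where \<delta>=\<delta> and u=u and \<omega>=\<omega> and F=F1 and F'=F2 and a=a and b=b] near' by blast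
    qed
    note both = prob_above_Un_below[OF sets.Un[OF F1(1) F2(1)] this]
    have F12: "prob (F1 \<union> F2) \<le> e1 u + e2 u" using F1 F2 measure_Un_le[of F1 M F2] by simp
    define T where "T = (if t0 = A then {\<omega>\<in>space M. u \<le> x0 t0 \<omega>} else {})"
    have T [measurable]: "T \<in> sets M" by (simp add: T_def)
    have Ta: "T \<subseteq> above u" using t0 by (auto simp: T_def above_def split: if_splits)
    have pT: "prob T = (if t0 = A then prob {\<omega>\<in>space M. u \<le> x0 t0 \<omega>} else 0)" by (simp add: T_def)
    define R where "R \<omega> = (\<integral>\<^sup>+v. indicator {a..b} v * ennreal (excess \<eta> h u (x0 v \<omega>) (x1 v \<omega>) (x2 v \<omega>)) \<partial>lborel)" for \<omega>
    have [measurable]: "R \<in> borel_measurable M"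
    proof -
      have [measurable]: "(\<lambda>z. x0 (snd z) (fst z)) \<in> borel_measurable (M \<Otimes>\<^sub>M lborel)" "(\<lambda>z. x1 (snd z) (fst z)) \<in> borel_measurable (M \<Otimes>\<^sub>M lborel)"
        "(\<lambda>z. x2 (snd z) (fst z)) \<in> borel_measurable (M \<Otimes>\<^sub>M lborel)"
        using measurable_compose[OF measurable_pair_swap' measurable_continuous_paths[of x0 M]] measurable_compose[OF measurable_pair_swap' measurable_continuous_paths[of x1 M]]
          measurable_compose[OF measurable_pair_swap' measurable_continuous_paths[of x2 M]] xC
        by (simp_all add: case_prod_beta cong: measurable_cong_sets sets_pair_measure_cong)
      show ?thesis unfolding R_def by (rule lborel.borel_measurable_nn_integral) (simp add: case_prod_beta)
    qed
    have ER: "(\<integral>\<^sup>+\<omega>. R \<omega> \<partial>M) \<le> ennreal (e3 u)" unfolding R_def using ab u by (intro exc) auto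
    have "AE \<omega> in M. N \<omega> \<le> indicator (above u - T) \<omega> + R \<omega>"
      using N not_a[of u] AE_space
    proof eventually_elim
      case (elim \<omega>)
      interpret f: C2_function a b "\<lambda>t. x0 t \<omega>" "\<lambda>t. x1 t \<omega>" "\<lambda>t. x2 t \<omega>"
        using elim ab by (intro C2_path_function) auto
      have "N \<omega> \<le> of_bool (x0 a \<omega> < u \<and> (\<exists>t\<in>{a..b}. u \<le> x0 t \<omega>)) + R \<omega>"
        unfolding elim(1) R_def using elim u near' by (intro f.upcrossings_le ab(6) h \<eta>) auto
      also have "of_bool (x0 a \<omega> < u \<and> (\<exists>t\<in>{a..b}. u \<le> x0 t \<omega>)) \<le> (indicator (above u - T) \<omega> :: ennreal)"
      proof (cases "x0 a \<omega> < u \<and> (\<exists>t\<in>{a..b}. u \<le> x0 t \<omega>)")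
        case True
        \<comment> \<open>If \<open>t0 = A\<close> then \<open>a = A\<close>, and a path below
          \<open>u\<close> at \<open>a\<close> is outside \<open>T\<close>; otherwise
          \<open>T\<close> is empty.\<close>
        then have "\<omega> \<in> above u - T" using aA ab elim by (auto simp: above_def T_def)
        then show ?thesis by simp
      next
        case False
        then show ?thesis unfolding of_bool_def by (simp only: if_False zero_le)
      qed
      finally show ?case by (simp add: add_right_mono)
    qed
    then have "(\<integral>\<^sup>+\<omega>. N \<omega> \<partial>M) \<le> (\<integral>\<^sup>+\<omega>. indicator (above u - T) \<omega> + R \<omega> \<partial>M)" by (rule nn_integral_mono_AE)
    also have "\<dots> = emeasure M (above u - T) + (\<integral>\<^sup>+\<omega>. R \<omega> \<partial>M)" by (subst nn_integral_add) auto
    also have "\<dots> \<le> ennreal (prob (above u) - prob T) + ennreal (Orderings.max 0 (e3 u))"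
      using ER Ta by (intro add_mono) (auto simp: emeasure_eq_measure finite_measure_Diff ennreal_max_0 max.commute)
    also have "\<dots> = ennreal (prob (above u) - prob T + Orderings.max 0 (e3 u))"
      using Ta by (intro ennreal_plus[symmetric]) (auto intro: finite_measure_mono)
    finally have up: "(\<integral>\<^sup>+\<omega>. N \<omega> \<partial>M) \<le> ennreal (prob (above u) - prob T + Orderings.max 0 (e3 u))" .
    \<comment> \<open>Off \<open>T\<close> and \<open>F1\<close> the path starts below
      \<open>u\<close> and first hits it where the variance is large, with slope at least 0; without
      tangencies this is a counted up-crossing.\<close>
    have "AE \<omega> in M. indicator (above u - (T \<union> F1)) \<omega> \<le> N \<omega>"
      using N tang[of u] F1(3) AE_space
    proof eventually_elim
      case (elim \<omega>)
      interpret f: C2_function A B "\<lambda>t. x0 t \<omega>" "\<lambda>t. x1 t \<omega>" "\<lambda>t. x2 t \<omega>"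
        using elim by (intro C2_path_function) auto
      show ?case
      proof (cases "\<omega> \<in> above u - (T \<union> F1)")
        case True
        then have ex: "\<exists>t\<in>{A..B}. u \<le> x0 t \<omega>" by (auto simp: above_def)
        have "x0 A \<omega> < u"
        proof (cases "t0 = A")
          case True then show ?thesis using \<open>\<omega> \<in> above u - (T \<union> F1)\<close> elim by (auto simp: T_def)
        next
          case False
          then have "\<not> u \<le> \<bar>x0 A \<omega>\<bar>" using farA AB elim(3) True by auto
          then show ?thesis by linarith
        qed
        then obtain t where t: "t \<in> {A<..B}" "x0 t \<omega> = u" "0 \<le> x1 t \<omega>" using f.first_hit[OF AB _ ex] by blast
        have "\<not> (cov (x0 t) (x0 t) \<le> S / (1 + \<delta>) \<and> u \<le> \<bar>x0 t \<omega>\<bar>)" using elim(3) True t by auto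
        then have V: "S / (1 + \<delta>) \<le> cov (x0 t) (x0 t)" using t u by auto
        then have "t \<in> {a..b}" using near' t by auto
        then have "x1 t \<omega> \<noteq> 0" using elim(2) t by blast
        then have "{t} \<subseteq> {t\<in>{A..B}. S / (1 + \<delta>) \<le> cov (x0 t) (x0 t) \<and> x0 t \<omega> = u \<and> 0 < x1 t \<omega>}" using t V by auto
        then have "emeasure (count_space UNIV) {t} \<le> N \<omega>" unfolding elim(1) by (intro emeasure_mono) auto
        then show ?thesis by (auto simp: indicator_def)
      qed simp
    qed
    then have "(\<integral>\<^sup>+\<omega>. indicator (above u - (T \<union> F1)) \<omega> \<partial>M) \<le> (\<integral>\<^sup>+\<omega>. N \<omega> \<partial>M)" by (rule nn_integral_mono_AE)
    then have "ennreal (prob (above u - (T \<union> F1))) \<le> (\<integral>\<^sup>+\<omega>. N \<omega> \<partial>M)" using F1 by (simp add: emeasure_eq_measure)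
    moreover have "prob (above u) \<le> prob (above u - (T \<union> F1)) + (prob T + prob F1)"
    proof -
      have "prob (above u) \<le> prob ((above u - (T \<union> F1)) \<union> (T \<union> F1))" using F1 by (intro finite_measure_mono) auto
      also have "\<dots> \<le> prob (above u - (T \<union> F1)) + prob (T \<union> F1)" using F1 by (intro measure_Un_le) auto
      also have "prob (T \<union> F1) \<le> prob T + prob F1" using F1 by (intro measure_Un_le) auto
      finally show ?thesis by simp
    qed
    ultimately have lo: "ennreal (prob (above u) - prob T - prob F1) \<le> (\<integral>\<^sup>+\<omega>. N \<omega> \<partial>M)"
      by (smt (verit) ennreal_leI order_trans)
    define I where "I = enn2real (\<integral>\<^sup>+\<omega>. N \<omega> \<partial>M)"
    \<comment> \<open>The upper bound makes the integral finite, so \<open>enn2real\<close> does not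
      collapse it to 0.\<close>
    have I: "ennreal I = (\<integral>\<^sup>+\<omega>. N \<omega> \<partial>M)" "0 \<le> I"
      using up unfolding I_def by (auto simp: less_top[symmetric] top_unique intro!: ennreal_enn2real le_less_trans[OF up])
    have pos: "0 \<le> prob (above u) - prob T" using Ta by (simp add: finite_measure_mono)
    have I1: "I \<le> prob (above u) - prob T + Orderings.max 0 (e3 u)"
      using up pos unfolding I(1)[symmetric] by (subst (asm) ennreal_le_iff) auto
    have I2: "prob (above u) - prob T - prob F1 \<le> I"
      using lo I(2) unfolding I(1)[symmetric] by (auto simp: ennreal_le_iff2)  
    have "0 \<le> e1 u" "0 \<le> e2 u" using F1(2) F2(2) measure_nonneg order_trans by metis+
    then show ?thesis using both F12 I1 I2 F1(2) unfolding pT[symmetric] I_def[symmetric] e_def abs_le_iff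
      by linarith
  qed
  show ?thesis using \<delta> sm bound by blast
qed

end

section \<open>Regular versions and the main result\<close>

context prob_space begin

lemma cgauss_normal:
  assumes "0 < s" "distributed M lborel Y (\<lambda>x. ennreal (normal_density 0 s x))"
  shows "cgauss (s\<^sup>2) Y"
proof -
  have mY [measurable]: "Y \<in> borel_measurable M" using distributed_measurable[OF assms(2)] by simp
  have "distributed M lborel (\<lambda>x. (Y x - 0) / s) (\<lambda>x. ennreal (std_normal_density x))"
    using normal_standard_normal_convert[of s Y 0] assms by simp
  then have "distr M lborel (\<lambda>x. Y x / s) = std_normal_distribution"
    using distributed_distr_eq_density by fastforce
  then have "cnormal (s\<^sup>2) = distr (distr M lborel (\<lambda>x. Y x / s)) borel (\<lambda>x. sqrt (s\<^sup>2) * x)"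
    by (simp add: cnormal_def)
  also have "\<dots> = distr M borel Y"
    using assms(1) by (subst distr_distr) (auto simp: comp_def)
  finally show ?thesis by (simp add: cgauss_def)
qed

lemma gaussian_rv_integrable:
  assumes "gaussian_rv M Y" shows "integrable M Y"
  using assms unfolding gaussian_rv_def
proof (elim conjE disjE exE)
  fix m s assume Y: "Y \<in> borel_measurable M" and d: "0 < s" "distributed M lborel Y (\<lambda>x. ennreal (normal_density m s x))"
  have "integrable M (\<lambda>x. Y x)"
    by (subst distributed_integrable[OF d(2), symmetric]) (use d integrable_normal_moment_nz_1 in auto)
  then show "integrable M Y" .
next
  fix m assume "Y \<in> borel_measurable M" "AE \<omega> in M. Y \<omega> = m"
  then show "integrable M Y" by (subst integrable_cong_AE[where g="\<lambda>_. m"]) auto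
qed

lemma gaussian_rv_centered:
  assumes "gaussian_rv M Y" "expectation Y = 0"
  shows "\<exists>v. cgauss v Y"
  using assms(1) unfolding gaussian_rv_def
proof (elim conjE disjE exE)
  fix m s assume d: "0 < s" "distributed M lborel Y (\<lambda>x. ennreal (normal_density m s x))"
  then have "m = 0" using normal_distributed_expectation[OF d] assms(2) by simp
  then show ?thesis using cgauss_normal d by blast
next
  fix m assume Y: "Y \<in> borel_measurable M" "AE \<omega> in M. Y \<omega> = m"
  have "expectation Y = expectation (\<lambda>_. m)" using Y by (intro integral_cong_AE) auto
  then have "m = 0" using assms(2) by (simp add: prob_space)
  have "cgauss 0 (\<lambda>_. 0)" by (rule cgaussI_char) (auto simp: prob_space)
  then have "cgauss 0 Y" by (rule cgauss_AE_cong) (use Y \<open>m = 0\<close> in auto)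
  then show ?thesis by blast
qed

lemma gauss_space_span:
  assumes X: "gaussian_process M T X" and mean: "\<forall>t\<in>T. expectation (X t) = 0"
  shows "gauss_space M {Y. \<exists>F c. finite F \<and> F \<subseteq> T \<and> Y = (\<lambda>\<omega>. \<Sum>t\<in>F. c t * X t \<omega>)}"
proof unfold_locales
  have single: "gaussian_rv M (X t)" if "t \<in> T" for t
    using X that unfolding gaussian_process_def by (auto dest!: spec[of _ "{t}"] spec[of _ "\<lambda>_. 1"])
  fix Y assume "Y \<in> {Y. \<exists>F c. finite F \<and> F \<subseteq> T \<and> Y = (\<lambda>\<omega>. \<Sum>t\<in>F. c t * X t \<omega>)}"
  then obtain F c where F: "finite F" "F \<subseteq> T" and Y: "Y = (\<lambda>\<omega>. \<Sum>t\<in>F. c t * X t \<omega>)" by blast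
  have g: "gaussian_rv M Y" using X F unfolding gaussian_process_def Y by blast
  have "expectation Y = (\<Sum>t\<in>F. expectation (\<lambda>\<omega>. c t * X t \<omega>))"
    unfolding Y using F single gaussian_rv_integrable by (intro Bochner_Integration.integral_sum) auto
  also have "\<dots> = 0" using F mean by (intro sum.neutral) auto
  finally show "\<exists>v. cgauss v Y" by (rule gaussian_rv_centered[OF g])
next
  fix Y Z :: "'a \<Rightarrow> real" and a b
  assume "Y \<in> {Y. \<exists>F c. finite F \<and> F \<subseteq> T \<and> Y = (\<lambda>\<omega>. \<Sum>t\<in>F. c t * X t \<omega>)}"
    "Z \<in> {Y. \<exists>F c. finite F \<and> F \<subseteq> T \<and> Y = (\<lambda>\<omega>. \<Sum>t\<in>F. c t * X t \<omega>)}"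
  then obtain F c F' c' where F: "finite F" "F \<subseteq> T" "finite F'" "F' \<subseteq> T"
    and Y: "Y = (\<lambda>\<omega>. \<Sum>t\<in>F. c t * X t \<omega>)" and Z: "Z = (\<lambda>\<omega>. \<Sum>t\<in>F'. c' t * X t \<omega>)" by blast
  define k where "k t = (if t \<in> F then a * c t else 0) + (if t \<in> F' then b * c' t else 0)" for t
  have "a * Y \<omega> + b * Z \<omega> = (\<Sum>t\<in>F \<union> F'. k t * X t \<omega>)" for \<omega>
  proof -
    have 1: "(\<Sum>t\<in>F \<union> F'. (if t \<in> F then a * c t else 0) * X t \<omega>) = a * Y \<omega>"
    proof -
      have "(\<Sum>t\<in>F \<union> F'. (if t \<in> F then a * c t else 0) * X t \<omega>) = (\<Sum>t\<in>F. (if t \<in> F then a * c t else 0) * X t \<omega>)"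
        using F by (intro sum.mono_neutral_right) auto
      also have "\<dots> = a * Y \<omega>" unfolding Y sum_distrib_left by (intro sum.cong) auto
      finally show ?thesis .
    qed
    have 2: "(\<Sum>t\<in>F \<union> F'. (if t \<in> F' then b * c' t else 0) * X t \<omega>) = b * Z \<omega>"
    proof -
      have "(\<Sum>t\<in>F \<union> F'. (if t \<in> F' then b * c' t else 0) * X t \<omega>) = (\<Sum>t\<in>F'. (if t \<in> F' then b * c' t else 0) * X t \<omega>)"
        using F by (intro sum.mono_neutral_right) auto
      also have "\<dots> = b * Z \<omega>" unfolding Z sum_distrib_left by (intro sum.cong) auto
      finally show ?thesis .
    qed
    show ?thesis unfolding k_def distrib_right sum.distrib 1 2 ..
  qed
  then show "(\<lambda>\<omega>. a * Y \<omega> + b * Z \<omega>) \<in> {Y. \<exists>F c. finite F \<and> F \<subseteq> T \<and> Y = (\<lambda>\<omega>. \<Sum>t\<in>F. c t * X t \<omega>)}"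
    using F by (intro CollectI exI[of _ "F \<union> F'"] exI[of _ k]) auto
qed

text \<open>Paths are replaced by 0 on a null set and continued constantly beyond
  \<open>{A..B}\<close>. The second derivative is picked path by path, with no measurability built
  in; as a pointwise limit of difference quotients along a fixed sequence of times it is nonetheless
  measurable and Gaussian.\<close>

lemma exists_regular_version:
  assumes AB: "A < B" and X: "gaussian_process M {A..B} X" and mean: "\<forall>t\<in>{A..B}. expectation (X t) = 0"
    and C2: "AE \<omega> in M. C2_path A B (\<lambda>t. X t \<omega>) (\<lambda>t. X' t \<omega>)"
    and X': "\<And>t. t \<in> {A..B} \<Longrightarrow> X' t \<in> borel_measurable M"
  shows "\<exists>G x0 x1 x2. C2_gauss_process M G A B x0 x1 x2 \<and>
    (AE \<omega> in M. \<forall>t\<in>{A..B}. x0 t \<omega> = X t \<omega> \<and> x1 t \<omega> = X' t \<omega>)"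
proof -
  define G0 where "G0 = {Y. \<exists>F c. finite F \<and> F \<subseteq> {A..B} \<and> Y = (\<lambda>\<omega>. \<Sum>t\<in>F. c t * X t \<omega>)}"
  interpret G0: gauss_space M G0 unfolding G0_def using X mean by (rule gauss_space_span)
  define G1 where "G1 = AE_closure G0"
  interpret G1: gauss_space M G1 unfolding G1_def by (rule G0.gauss_space_AE_closure)
  define G where "G = AE_closure G1"
  interpret G: gauss_space M G unfolding G_def by (rule G1.gauss_space_AE_closure)
  have XG0: "X t \<in> G0" if "t \<in> {A..B}" for t
    unfolding G0_def using that by (intro CollectI exI[of _ "{t}"] exI[of _ "\<lambda>_. 1"]) auto
  obtain N where N: "{\<omega>\<in>space M. \<not> C2_path A B (\<lambda>t. X t \<omega>) (\<lambda>t. X' t \<omega>)} \<subseteq> N" "N \<in> null_sets M"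
    using C2 by (auto simp: eventually_ae_filter)
  define \<Omega> where "\<Omega> = space M - N"
  have [measurable]: "\<Omega> \<in> sets M" using N(2) by (auto simp: \<Omega>_def)
  have AE\<Omega>: "AE \<omega> in M. \<omega> \<in> \<Omega>" using AE_not_in[OF N(2)] AE_space by eventually_elim (simp add: \<Omega>_def)
  have path: "C2_path A B (\<lambda>t. X t \<omega>) (\<lambda>t. X' t \<omega>)" if "\<omega> \<in> \<Omega>" for \<omega> using that N(1) by (auto simp: \<Omega>_def)
  define f2 where "f2 \<omega> = (SOME f''. continuous_on {A..B} f'' \<and>
    (\<forall>t\<in>{A..B}. ((\<lambda>t. X' t \<omega>) has_real_derivative f'' t) (at t within {A..B})))" for \<omega>
  have f2: "continuous_on {A..B} (f2 \<omega>) \<and> (\<forall>t\<in>{A..B}. ((\<lambda>t. X' t \<omega>) has_real_derivative f2 \<omega> t) (at t within {A..B}))"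
    if "\<omega> \<in> \<Omega>" for \<omega>
  proof -
    have "\<exists>f''. continuous_on {A..B} f'' \<and> (\<forall>t\<in>{A..B}. ((\<lambda>t. X' t \<omega>) has_real_derivative f'' t) (at t within {A..B}))"
      using path[OF that] unfolding C2_path_def by (rule conjunct2)
    from someI_ex[OF this] show ?thesis unfolding f2_def .
  qed
  have D1: "((\<lambda>t. X t \<omega>) has_real_derivative X' t \<omega>) (at t within {A..B})" if "\<omega> \<in> \<Omega>" "t \<in> {A..B}" for \<omega> t
    using path that unfolding C2_path_def by blast
  define k where "k t = max A (min B t)" for t
  have k: "k t \<in> {A..B}" "t \<in> {A..B} \<Longrightarrow> k t = t" for t using AB by (auto simp: k_def)
  define x0 where "x0 t \<omega> = (if \<omega> \<in> \<Omega> then X (k t) \<omega> else 0)" for t \<omega>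
  define x1 where "x1 t \<omega> = (if \<omega> \<in> \<Omega> then X' (k t) \<omega> else 0)" for t \<omega>
  define x2 where "x2 t \<omega> = (if \<omega> \<in> \<Omega> then f2 \<omega> (k t) else 0)" for t \<omega>
  have d0: "((\<lambda>s. x0 s \<omega>) has_real_derivative x1 t \<omega>) (at t within {A..B})" if t: "t \<in> {A..B}" for t \<omega>
  proof (cases "\<omega> \<in> \<Omega>")
    case True
    show ?thesis
      by (rule has_field_derivative_transform_within[OF _ zero_less_one t, of "\<lambda>t. X t \<omega>"])
        (use True t D1 k(2) in \<open>auto simp: x0_def x1_def\<close>)
  qed (simp add: x0_def x1_def)
  have d1: "((\<lambda>s. x1 s \<omega>) has_real_derivative x2 t \<omega>) (at t within {A..B})" if t: "t \<in> {A..B}" for t \<omega>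
  proof (cases "\<omega> \<in> \<Omega>")
    case True
    show ?thesis
      by (rule has_field_derivative_transform_within[OF _ zero_less_one t, of "\<lambda>t. X' t \<omega>"])
        (use True t f2 k(2) in \<open>auto simp: x1_def x2_def\<close>)
  qed (simp add: x1_def x2_def)
  have kc: "continuous_on UNIV k" unfolding k_def by (intro continuous_intros)
  have kk: "k (k t) = k t" for t using k by simp
  have xk: "x0 (k t) = x0 t" "x1 (k t) = x1 t" "x2 (k t) = x2 t" for t by (simp_all add: fun_eq_iff x0_def x1_def x2_def kk)
  have c0: "continuous_on UNIV (\<lambda>t. x0 t \<omega>)" for \<omega>
  proof -
    have "continuous_on {A..B} (\<lambda>t. x0 t \<omega>)" using d0 by (rule DERIV_continuous_on)
    then have "continuous_on UNIV (\<lambda>t. x0 (k t) \<omega>)" by (rule continuous_on_compose2[OF _ kc]) (use k in auto)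
    then show ?thesis by (simp add: xk)
  qed
  have c1: "continuous_on UNIV (\<lambda>t. x1 t \<omega>)" for \<omega>
  proof -
    have "continuous_on {A..B} (\<lambda>t. x1 t \<omega>)" using d1 by (rule DERIV_continuous_on)
    then have "continuous_on UNIV (\<lambda>t. x1 (k t) \<omega>)" by (rule continuous_on_compose2[OF _ kc]) (use k in auto)
    then show ?thesis by (simp add: xk)
  qed
  have c2: "continuous_on UNIV (\<lambda>t. x2 t \<omega>)" for \<omega>
  proof (cases "\<omega> \<in> \<Omega>")
    case True
    then have "continuous_on UNIV (\<lambda>t. f2 \<omega> (k t))" using f2 by (intro continuous_on_compose2[OF _ kc]) (use k in auto)
    then show ?thesis using True by (simp add: x2_def)
  qed (simp add: x2_def)
  \<comment> \<open>A point of the interval different from \<open>t\<close>, so that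
    \<open>q t\<close> approaches \<open>t\<close> from within the interval without meeting
    it.\<close>
  define z where "z t = (if t < B then B else A)" for t
  define q where "q t n = t + (z t - t) / real (n + 2)" for t n
  have q: "q t n \<in> {A..B} - {t}" if t: "t \<in> {A..B}" for t n
  proof -
    have zt: "z t \<in> {A..B}" "z t \<noteq> t" using t AB by (auto simp: z_def)
    have "q t n = (1 - 1 / real (n + 2)) *\<^sub>R t + (1 / real (n + 2)) *\<^sub>R z t"
      by (simp add: q_def left_diff_distrib diff_divide_distrib)
    also have "\<dots> \<in> {A..B}" by (rule convexD[OF _ t zt(1)]) auto
    finally show ?thesis using zt by (simp add: q_def)
  qed
  have ql: "q t \<longlonglongrightarrow> t" for t
  proof -
    have "(\<lambda>n. (z t - t) / real (n + 2)) \<longlonglongrightarrow> 0" by (intro LIMSEQ_ignore_initial_segment lim_const_over_n)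
    from tendsto_add[OF tendsto_const this, of t] show ?thesis by (simp add: q_def[abs_def])
  qed
  have quot: "(\<lambda>n. (f (q t n) - f t) / (q t n - t)) \<longlonglongrightarrow> D"
    if "(f has_real_derivative D) (at t within {A..B})" "t \<in> {A..B}" for f :: "real \<Rightarrow> real" and D t
    using that q[OF that(2)] ql[of t] unfolding has_field_derivative_iff tendsto_at_iff_sequentially comp_def by blast
  have m0: "x0 t \<in> borel_measurable M" for t
  proof -
    have [measurable]: "X (k t) \<in> borel_measurable M" using XG0 k(1) G0.measurable_G by blast
    show ?thesis unfolding x0_def by measurable
  qed
  have m1: "x1 t \<in> borel_measurable M" for t
  proof -
    have [measurable]: "X' (k t) \<in> borel_measurable M" using X' k(1) by blast
    show ?thesis unfolding x1_def by measurable
  qed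
  \<comment> \<open>The modified variable agrees only almost surely with a given one, so a constant
    sequence places it in the closure.\<close>
  have g0: "x0 t \<in> G1" for t
    unfolding G1_def AE_closure_def using m0 XG0[OF k(1)] AE\<Omega>
    by (auto intro!: exI[of _ "\<lambda>n. X (k t)"] simp: x0_def elim!: eventually_mono)
  have g1: "x1 t \<in> G1" for t
  proof -
    have "(\<lambda>\<omega>. (1 / (q (k t) n - k t)) * (X (q (k t) n) \<omega> - X (k t) \<omega>)) \<in> G0" for n
      using q[OF k(1)] k(1) by (intro G0.G_scale G0.G_diff XG0) auto
    moreover have "AE \<omega> in M. (\<lambda>n. (1 / (q (k t) n - k t)) * (X (q (k t) n) \<omega> - X (k t) \<omega>)) \<longlonglongrightarrow> x1 t \<omega>"
      using AE\<Omega>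
    proof eventually_elim
      case (elim \<omega>)
      then show ?case using quot[OF D1[OF elim k(1)[of t]] k(1)[of t]] by (simp add: x1_def)
    qed
    ultimately show ?thesis unfolding G1_def AE_closure_def using m1
      by (auto intro!: exI[of _ "\<lambda>n \<omega>. (1 / (q (k t) n - k t)) * (X (q (k t) n) \<omega> - X (k t) \<omega>)"])
  qed
  have lim2: "(\<lambda>n. (1 / (q (k t) n - k t)) * (x1 (q (k t) n) \<omega> - x1 (k t) \<omega>)) \<longlonglongrightarrow> x2 t \<omega>" for t \<omega>
    using quot[OF d1[OF k(1)[of t]] k(1)[of t]] by (simp add: xk)
  have G1: "(\<lambda>\<omega>. (1 / (q (k t) n - k t)) * (x1 (q (k t) n) \<omega> - x1 (k t) \<omega>)) \<in> G1" for t n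
    by (intro G1.G_scale G1.G_diff g1)
  have m2: "x2 t \<in> borel_measurable M" for t
    by (rule borel_measurable_LIMSEQ_real[OF lim2]) (intro G1.measurable_G G1)
  have g2: "x2 t \<in> G" for t
    unfolding G_def AE_closure_def using m2 lim2 G1
    by (auto intro!: exI[of _ "\<lambda>n \<omega>. (1 / (q (k t) n - k t)) * (x1 (q (k t) n) \<omega> - x1 (k t) \<omega>)"])
  have "C2_gauss_process M G A B x0 x1 x2"
  proof unfold_locales
    show "A < B" by fact
    show "x0 t \<in> G" "x1 t \<in> G" "x2 t \<in> G" for t using g0 g1 g2 G1.subset_AE_closure unfolding G_def by auto
    show "x0 (max A (min B t)) = x0 t" for t using xk(1) by (simp add: k_def)
  qed (use d0 d1 c0 c1 c2 in auto)
  moreover have "AE \<omega> in M. \<forall>t\<in>{A..B}. x0 t \<omega> = X t \<omega> \<and> x1 t \<omega> = X' t \<omega>"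
    using AE\<Omega> by eventually_elim (simp add: x0_def x1_def k)
  ultimately show ?thesis by blast
qed

end

lemma small_imp_bigo:
  assumes "0 < S" "small S e" "\<And>u. 1 \<le> u \<Longrightarrow> \<bar>f u\<bar> \<le> e u"
  shows "\<exists>\<kappa>>0. f \<in> O[at_top](\<lambda>u. exp (- (u\<^sup>2 * (1 + \<kappa>) / (2 * S))))"
proof -
  obtain K \<kappa> where K: "0 < \<kappa>" "\<forall>u\<ge>1. e u \<le> K * exp (- ((1 + \<kappa>) * u\<^sup>2 / (2 * S)))"
    using assms(2) unfolding small_def by blast
  have "f \<in> O[at_top](\<lambda>u. exp (- (u\<^sup>2 * (1 + \<kappa>) / (2 * S))))"
  proof (rule bigoI[of _ K])
    show "\<forall>\<^sub>F u in at_top. norm (f u) \<le> K * norm (exp (- (u\<^sup>2 * (1 + \<kappa>) / (2 * S))))"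
      unfolding eventually_at_top_linorder
    proof (intro exI[of _ 1] allI impI)
      fix u :: real assume "1 \<le> u"
      then show "norm (f u) \<le> K * norm (exp (- (u\<^sup>2 * (1 + \<kappa>) / (2 * S))))"
        using assms(3)[of u] K(2) by (force simp: mult.commute)
    qed
  qed
  then show ?thesis using K(1) by blast
qed

theorem theorem1:
  fixes M :: "'a measure" and A B t0 :: real and X X' :: "real \<Rightarrow> 'a \<Rightarrow> real"
  assumes "prob_space M" and "A < B"
    and "gaussian_process M {A..B} X"
    and "\<forall>t\<in>{A..B}. (\<integral>\<omega>. X t \<omega> \<partial>M) = 0"
    and "AE \<omega> in M. C2_path A B (\<lambda>t. X t \<omega>) (\<lambda>t. X' t \<omega>)"
    and "\<forall>t\<in>{A..B}. \<exists>p. distributed M (lborel \<Otimes>\<^sub>M lborel) (\<lambda>\<omega>. (X t \<omega>, X' t \<omega>)) p"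
    and "t0 \<in> {A..B}"
    and "\<forall>t\<in>{A..B}. t \<noteq> t0 \<longrightarrow> process_var M X t < process_var M X t0"
    and "process_sd_deriv M A B X t0 = 0 \<longrightarrow> measure M {\<omega>\<in>space M. X' t0 \<omega> = 0} < 1"
  shows "\<exists>\<delta>>0. \<exists>\<kappa>>0.
    (\<lambda>u. prob_max_abs_ge M A B X u - max_tail_approx M A B X X' t0 \<delta> u)
      \<in> O[at_top](\<lambda>u. exp (- (u\<^sup>2 * (1 + \<kappa>) / (2 * process_var M X t0))))"
proof -
  interpret prob_space M by fact
  have pair: "(\<lambda>\<omega>. (X t \<omega>, X' t \<omega>)) \<in> measurable M (lborel \<Otimes>\<^sub>M lborel)" if t: "t \<in> {A..B}" for t
    using bspec[OF assms(6) t] distributed_measurable by (rule exE)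
  have X': "X' t \<in> borel_measurable M" and Xm: "X t \<in> borel_measurable M" if t: "t \<in> {A..B}" for t
    using measurable_compose[OF pair[OF t] measurable_snd] measurable_compose[OF pair[OF t] measurable_fst] by simp_all
  obtain G x0 x1 x2 where proc: "C2_gauss_process M G A B x0 x1 x2"
    and eq: "AE \<omega> in M. \<forall>t\<in>{A..B}. x0 t \<omega> = X t \<omega> \<and> x1 t \<omega> = X' t \<omega>"
    using exists_regular_version[OF assms(2,3,4,5) X'] by blast
  interpret C2_gauss_process M G A B x0 x1 x2 by fact
  have var: "process_var M X t = cov (x0 t) (x0 t)" if t: "t \<in> {A..B}" for t
  proof -
    have "process_var M X t = expectation (\<lambda>\<omega>. X t \<omega> * X t \<omega>)"
      using assms(4) t by (simp add: process_var_def power2_eq_square)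
    also have "\<dots> = cov (x0 t) (x0 t)" unfolding cov_def
      using Xm[OF t] measurable_x eq t by (intro integral_cong_AE) (auto elim!: eventually_mono)
    finally show ?thesis .
  qed
  define S where "S = cov (x0 t0) (x0 t0)"
  interpret C2_gauss_max M G A B x0 x1 x2 t0 S
    by unfold_locales (use assms(7,8) var in \<open>auto simp: S_def\<close>)
  note S = S_pos
  \<comment> \<open>Chain rule at the positive value \<open>S\<close>; the derivative of the
    standard deviation and \<open>cov (x0 t0) (x1 t0)\<close> thus vanish together.\<close>
  have sd: "process_sd_deriv M A B X t0 = cov (x0 t0) (x1 t0) / sqrt S"
  proof -
    have "((\<lambda>s. sqrt (cov (x0 s) (x0 s))) has_real_derivative inverse (sqrt (cov (x0 t0) (x0 t0))) / 2 * (2 * cov (x0 t0) (x1 t0))) (at t0 within {A..B})"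
      using S by (intro DERIV_chain2[OF DERIV_real_sqrt var_derivative]) (use t0 in \<open>auto simp: S_def\<close>)
    then have "((\<lambda>s. sqrt (process_var M X s)) has_real_derivative cov (x0 t0) (x1 t0) / sqrt S) (at t0 within {A..B})"
      by (rule has_field_derivative_transform_within[OF _ zero_less_one t0, THEN DERIV_cong])
        (use var in \<open>auto simp: S_def field_simps\<close>)
    then show ?thesis unfolding process_sd_deriv_def
      using AB t0 by (intro vector_derivative_within_closed_interval) (auto simp: has_real_derivative_iff_has_vector_derivative)
  qed
  then have sd0: "process_sd_deriv M A B X t0 = 0 \<longleftrightarrow> cov (x0 t0) (x1 t0) = 0" using S by simp
  \<comment> \<open>The set defined by the supremum differs from
    \<open>above u \<union> below u\<close> only within a null set, hence belongs to the
    completion.\<close>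
  have pmax: "prob_max_abs_ge M A B X u = prob (above u \<union> below u)" for u
  proof -
    obtain N where N: "\<And>\<omega>. \<omega> \<in> space M - N \<Longrightarrow> \<forall>t\<in>{A..B}. x0 t \<omega> = X t \<omega> \<and> x1 t \<omega> = X' t \<omega>" "N \<in> null_sets M"
      using AE_E3[OF eq] by blast
    define Z where "Z = {\<omega>\<in>space M. u \<le> (SUP t\<in>{A..B}. \<bar>X t \<omega>\<bar>)}"
    have iff: "\<omega> \<in> Z \<longleftrightarrow> \<omega> \<in> above u \<union> below u" if \<omega>: "\<omega> \<in> space M - N" for \<omega>
    proof -
      have e: "\<And>t. t \<in> {A..B} \<Longrightarrow> X t \<omega> = x0 t \<omega>" using N(1)[OF \<omega>] by simp
      have c: "continuous_on {A..B} (\<lambda>t. \<bar>x0 t \<omega>\<bar>)" using \<omega> by (intro continuous_intros continuous_path) auto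
      obtain s where s: "s \<in> {A..B}" "\<And>t. t \<in> {A..B} \<Longrightarrow> \<bar>x0 t \<omega>\<bar> \<le> \<bar>x0 s \<omega>\<bar>"
        using continuous_attains_sup[OF compact_Icc _ c] AB by auto
      have "(SUP t\<in>{A..B}. \<bar>X t \<omega>\<bar>) = (SUP t\<in>{A..B}. \<bar>x0 t \<omega>\<bar>)" using e by (intro SUP_cong) auto
      also have "\<dots> = \<bar>x0 s \<omega>\<bar>" using s by (intro cSup_eq_maximum) auto
      finally have "\<omega> \<in> Z \<longleftrightarrow> u \<le> \<bar>x0 s \<omega>\<bar>" using \<omega> by (simp add: Z_def)
      also have "\<dots> \<longleftrightarrow> (\<exists>t\<in>{A..B}. u \<le> \<bar>x0 t \<omega>\<bar>)" using s by (meson order_trans)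
      also have "\<dots> \<longleftrightarrow> \<omega> \<in> above u \<union> below u"
      proof -
        have "u \<le> \<bar>y\<bar> \<longleftrightarrow> u \<le> y \<or> u \<le> - y" for y by linarith
        then show ?thesis unfolding above_def below_def using \<omega> by blast
      qed
      finally show ?thesis .
    qed
    have "Z \<in> sets (completion M)"
    proof -
      have "Z = ((above u \<union> below u) - N) \<union> (Z \<inter> N)" using iff by (auto simp: Z_def above_def below_def)
      moreover have "Z \<inter> N \<in> null_sets (completion M)"
        by (rule null_sets_completion_subset[of _ N]) (use N(2) in \<open>auto intro: null_sets_completionI\<close>)
      moreover have "(above u \<union> below u) - N \<in> sets (completion M)" using N(2) by (intro sets_completionI_sets) auto
      ultimately show ?thesis by (metis (no_types) sets.Un null_setsD2)
    qed
    moreover have "AE \<omega> in completion M. \<omega> \<in> Z \<longleftrightarrow> \<omega> \<in> above u \<union> below u"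
    proof (rule AE_completion)
      show "AE \<omega> in M. \<omega> \<in> Z \<longleftrightarrow> \<omega> \<in> above u \<union> below u"
        using AE_not_in[OF N(2)] AE_space
      proof eventually_elim
        case (elim \<omega>)
        then show ?case by (intro iff) simp
      qed
    qed
    ultimately have "measure (completion M) Z = measure (completion M) (above u \<union> below u)"
      by (intro measure_eq_AE) auto
    then show ?thesis by (simp add: prob_max_abs_ge_def Z_def)
  qed
  have pt0: "measure M {\<omega>\<in>space M. u \<le> X t0 \<omega>} = prob {\<omega>\<in>space M. u \<le> x0 t0 \<omega>}" for u
  proof (rule measure_eq_AE)
    show "AE \<omega> in M. (\<omega> \<in> {\<omega>\<in>space M. u \<le> X t0 \<omega>}) = (\<omega> \<in> {\<omega>\<in>space M. u \<le> x0 t0 \<omega>})"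
      using eq by eventually_elim (use t0 in auto)
    have [measurable]: "X t0 \<in> borel_measurable M" using Xm t0 by blast
    show "{\<omega>\<in>space M. u \<le> X t0 \<omega>} \<in> sets M" "{\<omega>\<in>space M. u \<le> x0 t0 \<omega>} \<in> sets M" by measurable
  qed
  show ?thesis
  proof (cases "cov (x0 t0) (x1 t0) = 0")
    case False
    then have "t0 = A \<or> t0 = B" using cov01_at_max t0 by force
    \<comment> \<open>In this case the approximation does not depend on \<open>\<delta>\<close>; the
      value 1 is arbitrary.\<close>
    then have P: "max_tail_approx M A B X X' t0 1 u = 2 * prob {\<omega>\<in>space M. u \<le> x0 t0 \<omega>}" for u
      using False sd0 pt0 by (simp add: max_tail_approx_def)
    obtain e where "small S e" "\<forall>u\<ge>1. \<bar>prob (above u \<union> below u) - 2 * prob {\<omega>\<in>space M. u \<le> x0 t0 \<omega>}\<bar> \<le> e u"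
      using max_tail_slope[OF False] by blast
    then have "\<exists>\<kappa>>0. (\<lambda>u. prob_max_abs_ge M A B X u - max_tail_approx M A B X X' t0 1 u) \<in> O[at_top](\<lambda>u. exp (- (u\<^sup>2 * (1 + \<kappa>) / (2 * S))))"
      using S by (intro small_imp_bigo) (auto simp: P pmax)
    then show ?thesis using var[OF t0] by (intro exI[of _ 1]) (auto simp: S_def)
  next
    case True
    \<comment> \<open>With variance 0 the derivative at \<open>t0\<close> would vanish almost
      surely, which the last hypothesis excludes.\<close>
    have m: "0 < cov (x1 t0) (x1 t0)"
    proof (rule ccontr)
      assume "\<not> 0 < cov (x1 t0) (x1 t0)"
      then have "expectation (\<lambda>\<omega>. x1 t0 \<omega> * x1 t0 \<omega>) = 0" using cov_nonneg[of "x1 t0"] unfolding cov_def by linarith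
      then have "AE \<omega> in M. x1 t0 \<omega> * x1 t0 \<omega> = 0"
        using integral_nonneg_eq_0_iff_AE[OF integrable_prod[OF xG(2) xG(2)]] by simp
      then have "AE \<omega> in M. X' t0 \<omega> = 0" using eq by eventually_elim (use t0 in auto)
      moreover have [measurable]: "X' t0 \<in> borel_measurable M" using X' t0 by blast
      ultimately have "measure M {\<omega>\<in>space M. X' t0 \<omega> = 0} = 1" by (subst prob_Collect_eq_1) auto
      then show False using assms(9) sd0 True by simp
    qed
    obtain \<delta> e where \<delta>: "0 < \<delta>" and e: "small S e" and bound: "\<forall>u\<ge>1. \<forall>N.
      (AE \<omega> in M. N \<omega> = emeasure (count_space UNIV) {t\<in>{A..B}. S / (1 + \<delta>) \<le> cov (x0 t) (x0 t) \<and> x0 t \<omega> = u \<and> 0 < x1 t \<omega>}) \<longrightarrow>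
      \<bar>prob (above u \<union> below u) - (2 * (if t0 = A then prob {\<omega>\<in>space M. u \<le> x0 t0 \<omega>} else 0) + 2 * enn2real (\<integral>\<^sup>+\<omega>. N \<omega> \<partial>M))\<bar> \<le> e u"
      using max_tail_flat[OF True m] by blast
    define N where "N u \<omega> = num_upcrossings (\<lambda>t. X t \<omega>) (\<lambda>t. X' t \<omega>) u (near_max_set M A B X t0 \<delta>)" for u \<omega>
    have N: "AE \<omega> in M. N u \<omega> = emeasure (count_space UNIV) {t\<in>{A..B}. S / (1 + \<delta>) \<le> cov (x0 t) (x0 t) \<and> x0 t \<omega> = u \<and> 0 < x1 t \<omega>}" for u
      using eq
    proof eventually_elim
      case (elim \<omega>)
      have "{t\<in>near_max_set M A B X t0 \<delta>. X t \<omega> = u \<and> 0 < X' t \<omega>} =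
        {t\<in>{A..B}. S / (1 + \<delta>) \<le> cov (x0 t) (x0 t) \<and> x0 t \<omega> = u \<and> 0 < x1 t \<omega>}"
        using elim var var[OF t0] by (auto simp: near_max_set_def S_def)
      then show ?case by (simp add: N_def num_upcrossings_def)
    qed
    have P: "max_tail_approx M A B X X' t0 \<delta> u =
      2 * (if t0 = A then prob {\<omega>\<in>space M. u \<le> x0 t0 \<omega>} else 0) + 2 * enn2real (\<integral>\<^sup>+\<omega>. N u \<omega> \<partial>M)" for u
      using True sd0 pt0[of u]
      by (cases "t0 = A") (simp_all add: max_tail_approx_def expected_upcrossings_def nn_integral_completion N_def)
    have "\<exists>\<kappa>>0. (\<lambda>u. prob_max_abs_ge M A B X u - max_tail_approx M A B X X' t0 \<delta> u) \<in> O[at_top](\<lambda>u. exp (- (u\<^sup>2 * (1 + \<kappa>) / (2 * S))))"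
    proof (rule small_imp_bigo[OF S e])
      fix u :: real assume "1 \<le> u"
      then show "\<bar>prob_max_abs_ge M A B X u - max_tail_approx M A B X X' t0 \<delta> u\<bar> \<le> e u"
        unfolding P pmax using bound N by blast
    qed
    then show ?thesis using \<delta> var[OF t0] by (intro exI[of _ \<delta>]) (auto simp: S_def)
  qed
qed

end
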